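(* For every instance of edge-weighted online stochastic matching with free disposal, the Regularized Greedy algorithm for edge-weighted matching with free disposal (defined in the context) is $0.706$-competitive.
   Context: Edge-weighted online stochastic matching with free disposal: a finite type graph $G=(I,J,E)$ with online vertex types $I$, offline vertices $J$, neighborhoods $I_j$ ($j\in J$) and $J_i$ ($i\in I$), edge weights $w_{ij}>0$, and arrival rates $\lambda_i>0$, all known in advance. Online vertices of each type $i$ arrive during the time interval $[0,1]$ according to independent Poisson processes of rate $\lambda_i$. When an online vertex arrives, its type is revealed and the algorithm must immediately and irrevocably match it to an offline neighbor or leave it unmatched. Offline vertices may be matched multiple times (free disposal), and the objective is $\sum_{j\in J}$ (largest weight of an edge matched to $j$, or $0$). The algorithm is $\Gamma$-competitive if for every instance its expected objective is at least $\Gamma$ times the expected weight of the optimal offline (hindsight) matching of the realized graph. Natural LP: maximize $\sum_{(i,j)\in E} w_{ij}x_{ij}$ subject to $\sum_{j\in J_i}x_{ij}\le\lambda_i$ for all $i\in I$; $\sum_{i\in S}x_{ij}\le 1-\exp(-\sum_{i\in S}\lambda_i)$ for all $j\in J$ and $S\subseteq I_j$; $x_{ij}\ge 0$. Let $(x_{ij})$ be an optimal solution, given to the algorithm as input. Notation at time $t\in[0,1]$: $w_j(t)$ is the largest weight of an edge matched to $j$ strictly before time $t$ ($0$ if none); $w_{ij}(t)=(w_{ij}-w_j(t))^+$ where $a^+=\max\{a,0\}$. For a weight level $w\ge0$: $x_{ij}(t,w)=x_{ij}$ if $w\le w_{ij}(t)$ and $0$ otherwise; $\rho_{ij}(t,w)=x_{ij}(t,w)/\lambda_i$;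 $\rho_i(t,w)=\sum_{j\in J_i}\rho_{ij}(t,w)$. Let $p(\rho)=\min\{2\rho,1\}$ and $\alpha(t)=1-\frac{1}{e(1-\ln2)}(2e)^t+\frac{1+\ln2}{e^2(1-\ln2)}e^{2t}$, $\beta(t)=\frac{1}{2e(1-\ln2)}(2e)^t-\frac{1}{e^2(1-\ln2)}e^{2t}$. Define $$r_{ij}(t)=\alpha(t)\sum_{i'\in I_j}\Bigl(w_{i'j}(t)-\bigl(w_{i'j}(t)-w_{ij}(t)\bigr)^+\Bigr)x_{i'j}+\beta(t)\sum_{i'\in I_j}\int_{(w_{i'j}(t)-w_{ij}(t))^+}^{w_{i'j}(t)}\lambda_{i'}\Bigl(p\bigl(\rho_{i'}(t,w)\bigr)-p\bigl(\rho_{i'}(t,w)-\rho_{i'j}(t,w)\bigr)\Bigr)dw.$$ Regularized Greedy (edge-weighted, free disposal): when an online vertex of type $i$ arrives at time $t$, match it to an offline neighbor $j\in J_i$ that maximizes $w_{ij}(t)-r_{ij}(t)$ (ties broken arbitrarily, e.g. lexicographically). *)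

theory Defs
  imports "HOL-Probability.Probability"
begin

section \<open>Instances and the Natural LP\<close>

record ('i, 'j) type_graph =
  online :: "'i set"
  offline :: "'j set"
  edges :: "('i \<times> 'j) set"
  weight :: "'i \<Rightarrow> 'j \<Rightarrow> real"
  rate :: "'i \<Rightarrow> real"

definition type_graph :: "('i, 'j) type_graph \<Rightarrow> bool" where
  "type_graph G \<longleftrightarrow>
     finite (online G) \<and> finite (offline G) \<and> edges G \<subseteq> online G \<times> offline G \<and>
     (\<forall>(i, j) \<in> edges G. weight G i j > 0) \<and> (\<forall>i \<in> online G. rate G i > 0)"

definition on_nbrs :: "('i, 'j) type_graph \<Rightarrow> 'j \<Rightarrow> 'i set" where
  "on_nbrs G j = {i. (i, j) \<in> edges G}"

definition off_nbrs :: "('i, 'j) type_graph \<Rightarrow> 'i \<Rightarrow> 'j set" where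
  "off_nbrs G i = {j. (i, j) \<in> edges G}"

definition lp_feasible :: "('i, 'j) type_graph \<Rightarrow> ('i \<Rightarrow> 'j \<Rightarrow> real) \<Rightarrow> bool" where
  "lp_feasible G x \<longleftrightarrow>
     (\<forall>i \<in> online G. (\<Sum>j \<in> off_nbrs G i. x i j) \<le> rate G i) \<and>
     (\<forall>j \<in> offline G. \<forall>S \<subseteq> on_nbrs G j. (\<Sum>i \<in> S. x i j) \<le> 1 - exp (- (\<Sum>i \<in> S. rate G i))) \<and>
     (\<forall>(i, j) \<in> edges G. x i j \<ge> 0)"

definition lp_value :: "('i, 'j) type_graph \<Rightarrow> ('i \<Rightarrow> 'j \<Rightarrow> real) \<Rightarrow> real" where
  "lp_value G x = (\<Sum>(i, j) \<in> edges G. weight G i j * x i j)"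

definition lp_optimal :: "('i, 'j) type_graph \<Rightarrow> ('i \<Rightarrow> 'j \<Rightarrow> real) \<Rightarrow> bool" where
  "lp_optimal G x \<longleftrightarrow> is_arg_max (lp_value G) (lp_feasible G) x"


section \<open>Poisson arrivals\<close>

text \<open>
  The Poisson process of type \<open>i\<close> is given by its independent, exponentially distributed
  inter-arrival times \<open>\<omega> (i, 0), \<omega> (i, 1), \<dots>\<close>; independence across types comes from the
  product measure.
\<close>

definition arrival_space :: "('i, 'j) type_graph \<Rightarrow> ('i \<times> nat \<Rightarrow> real) measure" where
  "arrival_space G =
     (\<Pi>\<^sub>M (i, k) \<in> online G \<times> UNIV. density lborel (\<lambda>s. ennreal (exponential_density (rate G i) s)))"

definition arrival_time :: "('i \<times> nat \<Rightarrow> real) \<Rightarrow> 'i \<Rightarrow> nat \<Rightarrow> real" where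
  "arrival_time \<omega> i k = (\<Sum>l \<le> k. \<omega> (i, l))"

text \<open>
  The arrivals (time, type) during \<open>[0, 1]\<close> in chronological order. Almost surely there are only
  finitely many and their times are positive and pairwise distinct; on the remaining null set the
  value of this list is irrelevant.
\<close>

definition arrivals :: "('i, 'j) type_graph \<Rightarrow> ('i \<times> nat \<Rightarrow> real) \<Rightarrow> (real \<times> 'i) list" where
  "arrivals G \<omega> =
     sorted_key_list_of_set fst {(arrival_time \<omega> i k, i) | i k. i \<in> online G \<and> arrival_time \<omega> i k \<le> 1}"


section \<open>Online policies and the offline optimum\<close>

text \<open>\<open>A h (t, i)\<close> is the decision for an arrival of type \<open>i\<close> at time \<open>t\<close> after the arrivals \<open>h\<close>.\<close>

type_synonym ('i, 'j) policy = "(real \<times> 'i) list \<Rightarrow> real \<times> 'i \<Rightarrow> 'j option"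

text \<open>
  The second conjunct makes decisions measurable in the arrival times, so that expectations are
  meaningful.
\<close>

definition online_policy :: "('i, 'j) type_graph \<Rightarrow> ('i, 'j) policy \<Rightarrow> bool" where
  "online_policy G A \<longleftrightarrow>
     (\<forall>h t. \<forall>i \<in> online G. \<forall>j. A h (t, i) = Some j \<longrightarrow> j \<in> off_nbrs G i) \<and>
     (\<forall>n \<iota>. (\<forall>k \<le> n. \<iota> k \<in> online G) \<longrightarrow>
        (\<lambda>\<tau>. A (map (\<lambda>k. (\<tau> k, \<iota> k)) [0..<n]) (\<tau> n, \<iota> n))
          \<in> (\<Pi>\<^sub>M k \<in> {..n}. (borel :: real measure)) \<rightarrow>\<^sub>M count_space UNIV)"

text \<open>
  The largest weight of an edge matched to \<open>j\<close> during the history \<open>h\<close>. This is \<open>w\<^sub>j(t)\<close> when \<open>h\<close>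
  consists of the arrivals before time \<open>t\<close>.
\<close>

definition level :: "('i, 'j) type_graph \<Rightarrow> ('i, 'j) policy \<Rightarrow> (real \<times> 'i) list \<Rightarrow> 'j \<Rightarrow> real" where
  "level G A h j =
     Max (insert 0 {weight G (snd (h ! n)) j | n. n < length h \<and> A (take n h) (h ! n) = Some j})"

definition objective :: "('i, 'j) type_graph \<Rightarrow> ('i, 'j) policy \<Rightarrow> (real \<times> 'i) list \<Rightarrow> real" where
  "objective G A h = (\<Sum>j \<in> offline G. level G A h j)"

text \<open>Online vertices of the realized graph are the positions in the list of arrivals.\<close>

definition offline_matching :: "('i, 'j) type_graph \<Rightarrow> (real \<times> 'i) list \<Rightarrow> (nat \<times> 'j) set \<Rightarrow> bool" where
  "offline_matching G h m \<longleftrightarrow>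
     m \<subseteq> {(n, j). n < length h \<and> (snd (h ! n), j) \<in> edges G} \<and> inj_on fst m \<and> inj_on snd m"

definition opt :: "('i, 'j) type_graph \<Rightarrow> (real \<times> 'i) list \<Rightarrow> real" where
  "opt G h = Max {(\<Sum>(n, j) \<in> m. weight G (snd (h ! n)) j) | m. offline_matching G h m}"

definition expected_objective :: "('i, 'j) type_graph \<Rightarrow> ('i, 'j) policy \<Rightarrow> ennreal" where
  "expected_objective G A = (\<integral>\<^sup>+ \<omega>. ennreal (objective G A (arrivals G \<omega>)) \<partial>arrival_space G)"

definition expected_opt :: "('i, 'j) type_graph \<Rightarrow> ennreal" where
  "expected_opt G = (\<integral>\<^sup>+ \<omega>. ennreal (opt G (arrivals G \<omega>)) \<partial>arrival_space G)"

text \<open>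
  An algorithm is given by the policies it may follow on each instance; several policies are
  possible because its description can leave choices open (LP solution, tie breaking).
\<close>

type_synonym ('i, 'j) algorithm = "('i, 'j) type_graph \<Rightarrow> ('i, 'j) policy \<Rightarrow> bool"

definition competitive :: "real \<Rightarrow> ('i, 'j) algorithm \<Rightarrow> bool" where
  "competitive \<Gamma> alg \<longleftrightarrow>
     (\<forall>G A. type_graph G \<longrightarrow> online_policy G A \<longrightarrow> alg G A \<longrightarrow>
        expected_objective G A \<ge> ennreal \<Gamma> * expected_opt G)"


section \<open>Regularized Greedy\<close>

text \<open>Throughout, \<open>v j\<close> stands for \<open>w\<^sub>j(t)\<close>.\<close>

definition gain :: "('i, 'j) type_graph \<Rightarrow> ('j \<Rightarrow> real) \<Rightarrow> 'i \<Rightarrow> 'j \<Rightarrow> real" where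
  "gain G v i j = max (weight G i j - v j) 0"

definition edge_ratio ::
  "('i, 'j) type_graph \<Rightarrow> ('i \<Rightarrow> 'j \<Rightarrow> real) \<Rightarrow> ('j \<Rightarrow> real) \<Rightarrow> real \<Rightarrow> 'i \<Rightarrow> 'j \<Rightarrow> real" where
  "edge_ratio G x v w i j = (if w \<le> gain G v i j then x i j else 0) / rate G i"

definition type_ratio ::
  "('i, 'j) type_graph \<Rightarrow> ('i \<Rightarrow> 'j \<Rightarrow> real) \<Rightarrow> ('j \<Rightarrow> real) \<Rightarrow> real \<Rightarrow> 'i \<Rightarrow> real" where
  "type_ratio G x v w i = (\<Sum>j \<in> off_nbrs G i. edge_ratio G x v w i j)"

definition p_fun :: "real \<Rightarrow> real" where
  "p_fun \<rho> = min (2 * \<rho>) 1"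

definition \<alpha>_fun :: "real \<Rightarrow> real" where
  "\<alpha>_fun t = 1 - 1 / (exp 1 * (1 - ln 2)) * (2 * exp 1) powr t
               + (1 + ln 2) / ((exp 1)\<^sup>2 * (1 - ln 2)) * exp (2 * t)"

definition \<beta>_fun :: "real \<Rightarrow> real" where
  "\<beta>_fun t = 1 / (2 * exp 1 * (1 - ln 2)) * (2 * exp 1) powr t
               - 1 / ((exp 1)\<^sup>2 * (1 - ln 2)) * exp (2 * t)"

definition regularizer ::
  "('i, 'j) type_graph \<Rightarrow> ('i \<Rightarrow> 'j \<Rightarrow> real) \<Rightarrow> ('j \<Rightarrow> real) \<Rightarrow> real \<Rightarrow> 'i \<Rightarrow> 'j \<Rightarrow> real" where
  "regularizer G x v t i j =
     \<alpha>_fun t * (\<Sum>i' \<in> on_nbrs G j.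
        (gain G v i' j - max (gain G v i' j - gain G v i j) 0) * x i' j) +
     \<beta>_fun t * (\<Sum>i' \<in> on_nbrs G j.
        integral {max (gain G v i' j - gain G v i j) 0 .. gain G v i' j}
          (\<lambda>w. rate G i' * (p_fun (type_ratio G x v w i')
                            - p_fun (type_ratio G x v w i' - edge_ratio G x v w i' j))))"

definition greedy_choice ::
  "('i, 'j) type_graph \<Rightarrow> ('i \<Rightarrow> 'j \<Rightarrow> real) \<Rightarrow> ('j \<Rightarrow> real) \<Rightarrow> real \<Rightarrow> 'i \<Rightarrow> 'j \<Rightarrow> bool" where
  "greedy_choice G x v t i j \<longleftrightarrow>
     is_arg_max (\<lambda>j. gain G v i j - regularizer G x v t i j) (\<lambda>j. j \<in> off_nbrs G i) j"

text \<open>Ties may be broken arbitrarily, also depending on the history.\<close>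

definition regularized_greedy :: "('i, 'j) algorithm" where
  "regularized_greedy G A \<longleftrightarrow>
     (\<exists>x. lp_optimal G x \<and>
        (\<forall>h. \<forall>t \<in> {0..1}. \<forall>i \<in> online G. off_nbrs G i \<noteq> {} \<longrightarrow>
           (\<exists>j. A h (t, i) = Some j \<and> greedy_choice G x (level G A h) t i j)))"

end

(*
  Primal-dual style potential argument. Let A be the gain still available to the LP solution x and
  B the gain of sampling from it with doubled fractions capped at one, both relative to the current
  levels w_j(t). The potential
    Psi(t) = (sum of the levels) + alpha(t) * A + beta(t) * B
  drops by exactly r_ij when j is raised to w_ij, apart from the gained w_ij(t), so the greedy rule
  maximises its jump. Comparing with the algorithm that matches every type with twice its LP
  fractions in order of decreasing gain, the LP constraints for j bound the expected loss in B by
  (1 - ln 2) B + (1 + ln 2) (2 B - 2 A), and the differential equations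
    alpha' = -2 (1 + ln 2) beta,  beta' = alpha + (3 + ln 2) beta - 1,  alpha(1) = beta(1) = 0
  are those for which the drift of Psi is then nonnegative. Hence the expected objective is at least
  Psi(0) >= (alpha(0) + beta(0)) LP >= 0.706 LP, and the LP value bounds the expected offline optimum.

  The Poisson arrivals enter only through the formula
    E F = exp(-Lambda) * sum over words i_1 ... i_n of the integral over 0 < s_1 < ... < s_n <= 1 of
          lambda_(i_1) ... lambda_(i_n) * F((s_1, i_1), ..., (s_n, i_n)),
  obtained by integrating out one inter-arrival time after the other.
*)
theory Submission
  imports Defs
begin

section \<open>Finite type graphs\<close>

text \<open>Greedy maximises the jump of Psi, so its expected jump rate is at least that of the
  comparison algorithm, which earns B, loses at most B in the A-part, and loses the stated amount in
  the B-part. Requiring this to cancel alpha' A + beta' B, separately in the coefficients of A and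
  of B, yields the differential equations; 3 + ln 2 is (1 - ln 2) + 2 (1 + ln 2). The homogeneous
  system has the characteristic values 2 and 1 + ln 2, and alpha = 1, beta = 0 is a particular
  solution; hence e^(2t) and (2e)^t.

  The obstacle is the loss in B: it is quadratic (matching rate into j times accumulated marginals
  of p), while the drift needs a bound linear in A and B. The marginals cannot fall below the excess
  max(2 x_ij - lambda_i, 0), and the LP constraints bound the sum of the excesses at j by the
  maximum over y of 2 (1 - e^(-y)) - y, which is 1 - ln 2. This number is the slope of the linear
  bound, and 1 + ln 2 = 2 - (1 - ln 2) is its complement.

  The policy may depend on all past arrival times, so the drift is used for each fixed history, as
  an integral inequality in t.\<close>

locale type_graph_instance =
  fixes G :: "('i, 'j) type_graph"
  assumes type_graph: "type_graph G"
begin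

lemma finite_online [simp, intro]: "finite (online G)"
  and finite_offline [simp, intro]: "finite (offline G)"
  and rate_pos: "i \<in> online G \<Longrightarrow> 0 < rate G i"
  using type_graph by (auto simp: type_graph_def)

lemma mem_on_nbrs: "i \<in> on_nbrs G j \<longleftrightarrow> i \<in> online G \<and> j \<in> off_nbrs G i"
  and mem_off_nbrs: "j \<in> off_nbrs G i \<longleftrightarrow> j \<in> offline G \<and> i \<in> on_nbrs G j"
  using type_graph by (auto simp: type_graph_def on_nbrs_def off_nbrs_def)

lemma on_nbrsD: "i \<in> on_nbrs G j \<Longrightarrow> i \<in> online G"
  and off_nbrsD: "j \<in> off_nbrs G i \<Longrightarrow> j \<in> offline G" "j \<in> off_nbrs G i \<Longrightarrow> i \<in> online G"
  using mem_on_nbrs mem_off_nbrs by blast+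

lemma finite_on_nbrs [simp, intro]: "finite (on_nbrs G j)"
  and finite_off_nbrs [simp, intro]: "finite (off_nbrs G i)"
  by (auto intro: finite_subset[OF _ finite_online] finite_subset[OF _ finite_offline]
           dest: on_nbrsD off_nbrsD)

lemma sum_online_swap:
  "(\<Sum>i\<in>online G. \<Sum>j\<in>off_nbrs G i. f i j) = (\<Sum>j\<in>offline G. \<Sum>i\<in>on_nbrs G j. f i j)"
proof -
  have *: "off_nbrs G i = {j \<in> offline G. (i, j) \<in> edges G}"
     "on_nbrs G j = {i \<in> online G. (i, j) \<in> edges G}" for i j
    using type_graph by (auto simp: type_graph_def on_nbrs_def off_nbrs_def)
  show ?thesis
    unfolding * by (rule sum.swap_restrict) auto
qed

lemma sum_edges: "(\<Sum>(i, j)\<in>edges G. f i j) = (\<Sum>i\<in>online G. \<Sum>j\<in>off_nbrs G i. f i j)"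
proof -
  have "edges G = (SIGMA i:online G. off_nbrs G i)"
    using type_graph by (auto simp: type_graph_def off_nbrs_def)
  then show ?thesis
    by (simp add: sum.Sigma)
qed

section \<open>Law of the arrival sequence\<close>


text \<open>The dummy rate outside \<open>online G\<close> makes every gap a probability space.\<close>

definition gap :: "'i \<Rightarrow> real measure" where
  "gap i = density lborel (exponential_density (if i \<in> online G then rate G i else 1))"

lemma sets_gap [measurable_cong, simp]: "sets (gap i) = sets borel"
  by (simp add: gap_def)

lemma space_gap [simp]: "space (gap i) = UNIV"
  by (simp add: gap_def)

lemma prob_space_gap: "prob_space (gap i)"
  unfolding gap_def by (rule prob_space_exponential_density) (auto simp: rate_pos)

sublocale product_prob_space "\<lambda>z. gap (fst z)" "online G \<times> (UNIV :: nat set)"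
  by (simp add: product_prob_space_def product_prob_space_axioms_def product_sigma_finite_def
        prob_space_gap prob_space_imp_sigma_finite)

lemma arrival_space_eq: "arrival_space G = Pi\<^sub>M (online G \<times> UNIV) (\<lambda>z. gap (fst z))"
  unfolding arrival_space_def by (intro PiM_cong refl) (auto simp: gap_def)

lemma prob_space_arrival_space: "prob_space (arrival_space G)"
  unfolding arrival_space_eq by (rule P.prob_space_axioms)

lemma measurable_gap_component [measurable (raw)]:
  assumes "i \<in> online G"
  shows "(\<lambda>\<omega>. \<omega> (i, k)) \<in> borel_measurable (arrival_space G)"
proof -
  have "(\<lambda>\<omega>. \<omega> (i, k)) \<in> arrival_space G \<rightarrow>\<^sub>M gap (fst (i, k))"
    unfolding arrival_space_eq using assms by (intro measurable_component_singleton) auto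
  then show ?thesis
    by (simp cong: measurable_cong_sets)
qed

lemma emeasure_gap_greaterThan:
  assumes "i \<in> online G" "0 \<le> b"
  shows "emeasure (gap i) {b<..} = ennreal (exp (- rate G i * b))"
proof -
  interpret gap: prob_space "gap i" by (rule prob_space_gap)
  have "distributed (gap i) lborel (\<lambda>x. x) (exponential_density (rate G i))"
    unfolding gap_def using assms rate_pos[of i]
    by (auto simp: distributed_def distr_id2 exponential_density_nonneg)
  from gap.exponential_distributedD_gt[OF this \<open>0 \<le> b\<close>] rate_pos[OF assms(1)]
  have "gap.prob {b<..} = exp (- b * rate G i)"
    by (simp add: greaterThan_def)
  then show ?thesis
    by (simp add: gap.emeasure_eq_measure mult.commute)
qed

lemma AE_gap_pos: "AE u in gap i. 0 < u"
  unfolding gap_def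
  by (subst AE_density) (use AE_lborel_singleton[of 0] in \<open>auto simp: exponential_density_def\<close>)

lemma AE_gaps_pos: "AE \<omega> in arrival_space G. \<forall>i\<in>online G. \<forall>k. 0 < \<omega> (i, k)"
proof -
  have "AE \<omega> in arrival_space G. 0 < \<omega> (i, k)" if "i \<in> online G" for i k
  proof -
    have "AE u in gap (fst (i, k)). 0 < u"
      using AE_gap_pos by (simp only: fst_conv)
    then show ?thesis
      unfolding arrival_space_eq using that
      by (intro AE_PiM_component[where M = "\<lambda>z. gap (fst z)"] prob_space_gap) auto
  qed
  then show ?thesis
    by (auto simp: AE_all_countable intro!: AE_finite_allI)
qed

section \<open>Words with time stamps, and measurability of functions of histories\<close>

definition stamp :: "(nat \<Rightarrow> real) \<Rightarrow> 'i list \<Rightarrow> (real \<times> 'i) list" where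
  "stamp \<tau> \<iota> = map (\<lambda>k. (\<tau> k, \<iota> ! k)) [0..<length \<iota>]"

lemma length_stamp [simp]: "length (stamp \<tau> \<iota>) = length \<iota>"
  by (simp add: stamp_def)

lemma map_snd_stamp [simp]: "map snd (stamp \<tau> \<iota>) = \<iota>"
  by (simp add: stamp_def o_def map_nth)

lemma stamp_snoc: "stamp \<tau> \<iota> @ [(s, i)] = stamp (\<tau>(length \<iota> := s)) (\<iota> @ [i])"
  by (auto simp: stamp_def nth_append)

lemma stamp_eqI: "length h = length \<iota> \<Longrightarrow> (\<And>k. k < length \<iota> \<Longrightarrow> h ! k = (\<tau> k, \<iota> ! k)) \<Longrightarrow> h = stamp \<tau> \<iota>"
  by (auto simp: stamp_def intro!: nth_equalityI)

text \<open>Fixing the type word turns a function of lists into a function of a real sequence, so no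
  sigma-algebra on lists has to be chosen. The sequences range over all of \<open>nat\<close>, which
  gives words of every length the same domain.\<close>

definition history_measurable :: "((real \<times> 'i) list \<Rightarrow> ennreal) \<Rightarrow> bool" where
  "history_measurable F \<longleftrightarrow>
     (\<forall>\<iota>. set \<iota> \<subseteq> online G \<longrightarrow> (\<lambda>\<tau>. F (stamp \<tau> \<iota>)) \<in> borel_measurable (\<Pi>\<^sub>M k\<in>UNIV. borel))"

text \<open>
  The arrivals after time \<open>t\<close> have the types \<open>\<iota>\<close>, where \<open>a i\<close> is the time of the last arrival of
  type \<open>i\<close> before and \<open>\<omega> (i, c i)\<close> the waiting time for the next one.
\<close>

primrec realizes :: "real \<Rightarrow> ('i \<Rightarrow> real) \<Rightarrow> ('i \<Rightarrow> nat) \<Rightarrow> ('i \<times> nat \<Rightarrow> real) \<Rightarrow> 'i list \<Rightarrow> bool" where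
  "realizes t a c \<omega> [] \<longleftrightarrow> (\<forall>i\<in>online G. 1 - a i < \<omega> (i, c i))"
| "realizes t a c \<omega> (i # \<iota>) \<longleftrightarrow> t < a i + \<omega> (i, c i) \<and> a i + \<omega> (i, c i) \<le> 1 \<and>
     realizes (a i + \<omega> (i, c i)) (a(i := a i + \<omega> (i, c i))) (c(i := Suc (c i))) \<omega> \<iota>"

primrec timeline :: "('i \<Rightarrow> real) \<Rightarrow> ('i \<Rightarrow> nat) \<Rightarrow> ('i \<times> nat \<Rightarrow> real) \<Rightarrow> 'i list \<Rightarrow> (real \<times> 'i) list" where
  "timeline a c \<omega> [] = []"
| "timeline a c \<omega> (i # \<iota>) = (a i + \<omega> (i, c i), i) #
     timeline (a(i := a i + \<omega> (i, c i))) (c(i := Suc (c i))) \<omega> \<iota>"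

lemma map_snd_timeline [simp]: "map snd (timeline a c \<omega> \<iota>) = \<iota>"
  by (induction \<iota> arbitrary: a c) auto

lemma length_timeline [simp]: "length (timeline a c \<omega> \<iota>) = length \<iota>"
  by (induction \<iota> arbitrary: a c) auto

text \<open>Gaps with index below \<open>c i\<close> are already spent. Overwriting the gap
  \<open>(i, c i)\<close> therefore cannot change what follows the arrival that it times, and this
  lets the gaps be integrated out one after the other.\<close>

lemma realizes_timeline_cong:
  assumes "\<And>i k. c i \<le> k \<Longrightarrow> \<omega> (i, k) = \<omega>' (i, k)"
  shows "realizes t a c \<omega> \<iota> = realizes t a c \<omega>' \<iota> \<and> timeline a c \<omega> \<iota> = timeline a c \<omega>' \<iota>"
  using assms
proof (induction \<iota> arbitrary: t a c)
  case (Cons i \<iota>)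
  have IH: "realizes t' a' (c(i := Suc (c i))) \<omega> \<iota> = realizes t' a' (c(i := Suc (c i))) \<omega>' \<iota> \<and>
      timeline a' (c(i := Suc (c i))) \<omega> \<iota> = timeline a' (c(i := Suc (c i))) \<omega>' \<iota>" for t' a'
    by (rule Cons.IH) (use Cons.prems in \<open>simp split: if_splits\<close>)
  have "\<omega> (i, c i) = \<omega>' (i, c i)"
    using Cons.prems by simp
  then show ?case
    using IH by simp
qed auto

text \<open>\<open>t\<close> and \<open>a\<close> may depend on \<omega> because the recursion
  replaces them by the random time \<open>a i + \<omega> (i, c i)\<close>.\<close>

lemma realizes_measurable:
  assumes "\<And>i. i \<in> online G \<Longrightarrow> (\<lambda>\<omega>. a \<omega> i) \<in> borel_measurable (arrival_space G)"
    "t \<in> borel_measurable (arrival_space G)" "set \<iota> \<subseteq> online G"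
  shows "Measurable.pred (arrival_space G) (\<lambda>\<omega>. realizes (t \<omega>) (a \<omega>) c \<omega> \<iota>)"
  using assms
proof (induction \<iota> arbitrary: t a c)
  case Nil
  have [measurable]: "(\<lambda>\<omega>. a \<omega> i) \<in> borel_measurable (arrival_space G)" if "i \<in> online G" for i
    using Nil(1) that .
  show ?case
    unfolding realizes.simps by (intro pred_intros_finite) (auto, measurable)
next
  case (Cons i \<iota>)
  have i: "i \<in> online G" using Cons.prems by simp
  have [measurable]: "(\<lambda>\<omega>. a \<omega> i) \<in> borel_measurable (arrival_space G)"
    "t \<in> borel_measurable (arrival_space G)" "(\<lambda>\<omega>. \<omega> (i, c i)) \<in> borel_measurable (arrival_space G)"
    using Cons.prems i by (auto intro: measurable_gap_component)
  have [measurable]: "Measurable.pred (arrival_space G) (\<lambda>\<omega>. realizes (a \<omega> i + \<omega> (i, c i))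
      ((a \<omega>)(i := a \<omega> i + \<omega> (i, c i))) (c(i := Suc (c i))) \<omega> \<iota>)"
  proof (rule Cons.IH)
    fix i' assume "i' \<in> online G"
    then show "(\<lambda>\<omega>. ((a \<omega>)(i := a \<omega> i + \<omega> (i, c i))) i') \<in> borel_measurable (arrival_space G)"
      using Cons.prems by (cases "i' = i") auto
  qed (use Cons.prems in auto)
  show ?case
    unfolding realizes.simps by measurable
qed

lemma timeline_measurable:
  assumes "\<And>i. i \<in> online G \<Longrightarrow> (\<lambda>\<omega>. a \<omega> i) \<in> borel_measurable (arrival_space G)"
    "set \<iota> \<subseteq> online G" "k < length \<iota>"
  shows "(\<lambda>\<omega>. fst (timeline (a \<omega>) c \<omega> \<iota> ! k)) \<in> borel_measurable (arrival_space G)"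
  using assms
proof (induction \<iota> arbitrary: a c k)
  case (Cons i \<iota>)
  have i: "i \<in> online G" using Cons.prems by simp
  have [measurable]: "(\<lambda>\<omega>. a \<omega> i) \<in> borel_measurable (arrival_space G)"
    "(\<lambda>\<omega>. \<omega> (i, c i)) \<in> borel_measurable (arrival_space G)"
    using Cons.prems i by (auto intro: measurable_gap_component)
  show ?case
  proof (cases k)
    case 0
    then show ?thesis by simp
  next
    case (Suc k')
    have "(\<lambda>\<omega>. fst (timeline ((a \<omega>)(i := a \<omega> i + \<omega> (i, c i))) (c(i := Suc (c i))) \<omega> \<iota> ! k'))
        \<in> borel_measurable (arrival_space G)"
    proof (rule Cons.IH)
      fix i' assume "i' \<in> online G"
      then show "(\<lambda>\<omega>. ((a \<omega>)(i := a \<omega> i + \<omega> (i, c i))) i') \<in> borel_measurable (arrival_space G)"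
        using Cons.prems by (cases "i' = i") auto
    qed (use Cons.prems Suc in auto)
    then show ?thesis
      by (simp add: Suc)
  qed
qed simp

lemma append_timeline_measurable:
  assumes F: "history_measurable F" and "set (map snd h) \<subseteq> online G" "set \<iota> \<subseteq> online G"
  shows "(\<lambda>\<omega>. F (h @ timeline a c \<omega> \<iota>)) \<in> borel_measurable (arrival_space G)"
proof -
  let ?n = "length h"
  \<comment> \<open>The padding with 0 beyond the last arrival is never read by
    \<open>stamp\<close>.\<close>
  define \<tau> where "\<tau> \<omega> k = (if k < ?n then fst (h ! k)
     else if k < ?n + length \<iota> then fst (timeline a c \<omega> \<iota> ! (k - ?n)) else 0)" for \<omega> k
  have snd_nth: "snd (timeline a c \<omega> \<iota> ! k) = \<iota> ! k" if "k < length \<iota>" for \<omega> k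
    using that nth_map[of k "timeline a c \<omega> \<iota>" snd] by simp
  have eq: "h @ timeline a c \<omega> \<iota> = stamp (\<tau> \<omega>) (map snd h @ \<iota>)" for \<omega>
    by (rule stamp_eqI) (auto simp: nth_append \<tau>_def snd_nth prod_eq_iff)
  have "\<tau> \<in> arrival_space G \<rightarrow>\<^sub>M (\<Pi>\<^sub>M k\<in>UNIV. borel)"
  proof (rule measurable_PiM_single')
    fix k :: nat
    show "(\<lambda>\<omega>. \<tau> \<omega> k) \<in> borel_measurable (arrival_space G)"
    proof (cases "?n \<le> k \<and> k < ?n + length \<iota>")
      case True
      then have "(\<lambda>\<omega>. fst (timeline a c \<omega> \<iota> ! (k - ?n))) \<in> borel_measurable (arrival_space G)"
        using timeline_measurable[of "\<lambda>_. a" \<iota> "k - ?n" c] assms by auto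
      then show ?thesis
        using True by (simp add: \<tau>_def)
    next
      case False
      then have "(\<lambda>\<omega>. \<tau> \<omega> k) = (\<lambda>\<omega>. if k < ?n then fst (h ! k) else 0)"
        by (auto simp: \<tau>_def)
      then show ?thesis by simp
    qed
  qed auto
  moreover have "(\<lambda>\<tau>. F (stamp \<tau> (map snd h @ \<iota>))) \<in> borel_measurable (\<Pi>\<^sub>M k\<in>UNIV. borel)"
    using F assms by (auto simp: history_measurable_def)
  ultimately show ?thesis
    unfolding eq by (rule measurable_compose)
qed

text \<open>Integration over increasing times of the remaining arrivals. Only the rates appear: the
  exponential factors of the gap densities multiply to a constant, which
  \<open>nn_integral_realizes\<close> splits off.\<close>

primrec iterated :: "((real \<times> 'i) list \<Rightarrow> ennreal) \<Rightarrow> real \<Rightarrow> (real \<times> 'i) list \<Rightarrow> 'i list \<Rightarrow> ennreal" where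
  "iterated F t h [] = F h"
| "iterated F t h (i # \<iota>) = (\<integral>\<^sup>+ s. ennreal (rate G i) * indicator {t<..1} s * iterated F s (h @ [(s, i)]) \<iota> \<partial>lborel)"

lemma iterated_measurable:
  assumes F: "history_measurable F" and "set \<iota>' \<subseteq> online G" "set \<iota> \<subseteq> online G"
  shows "(\<lambda>(\<tau>, t). iterated F t (stamp \<tau> \<iota>') \<iota>) \<in> borel_measurable ((\<Pi>\<^sub>M k\<in>UNIV. borel) \<Otimes>\<^sub>M borel)"
  using assms(2,3)
proof (induction \<iota> arbitrary: \<iota>')
  case Nil
  then have [measurable]: "(\<lambda>\<tau>. F (stamp \<tau> \<iota>')) \<in> borel_measurable (\<Pi>\<^sub>M k\<in>UNIV. borel)"
    using F by (simp add: history_measurable_def)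
  show ?case by simp
next
  case (Cons i \<iota>)
  let ?\<tau> = "\<Pi>\<^sub>M k\<in>UNIV. (borel :: real measure)"
  let ?n = "length \<iota>'"
  have "(\<lambda>(\<tau>, t). iterated F t (stamp \<tau> (\<iota>' @ [i])) \<iota>) \<in> borel_measurable (?\<tau> \<Otimes>\<^sub>M borel)"
    using Cons.prems by (intro Cons.IH) auto
  \<comment> \<open>The new time goes into coordinate \<open>?n\<close>, the first one not read by
    the old word, and also becomes the new lower limit; the induction hypothesis then covers the
    longer word.\<close>
  moreover have "(\<lambda>(p, s). ((fst p)(?n := s), s)) \<in> (?\<tau> \<Otimes>\<^sub>M borel) \<Otimes>\<^sub>M borel \<rightarrow>\<^sub>M ?\<tau> \<Otimes>\<^sub>M borel"
    unfolding split_beta'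
    by (intro measurable_Pair measurable_fun_upd[where J = UNIV]) auto
  ultimately have "(\<lambda>p. (\<lambda>(\<tau>, t). iterated F t (stamp \<tau> (\<iota>' @ [i])) \<iota>) ((\<lambda>(p, s). ((fst p)(?n := s), s)) p))
      \<in> borel_measurable ((?\<tau> \<Otimes>\<^sub>M borel) \<Otimes>\<^sub>M borel)"
    by (rule measurable_compose[rotated])
  then have [measurable]: "(\<lambda>p. iterated F (snd p) (stamp ((fst (fst p))(?n := snd p)) (\<iota>' @ [i])) \<iota>)
      \<in> borel_measurable ((?\<tau> \<Otimes>\<^sub>M borel) \<Otimes>\<^sub>M borel)"
    by (simp add: split_beta')
  have "(\<lambda>q. \<integral>\<^sup>+ s. (if snd q < s \<and> s \<le> 1 then ennreal (rate G i) * iterated F s (stamp ((fst q)(?n := s)) (\<iota>' @ [i])) \<iota> else 0) \<partial>lborel)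
      \<in> borel_measurable (?\<tau> \<Otimes>\<^sub>M borel)"
    by (intro lborel.borel_measurable_nn_integral) (simp add: split_beta', measurable)
  also have "(\<lambda>q. \<integral>\<^sup>+ s. (if snd q < s \<and> s \<le> 1 then ennreal (rate G i) * iterated F s (stamp ((fst q)(?n := s)) (\<iota>' @ [i])) \<iota> else 0) \<partial>lborel)
      = (\<lambda>(\<tau>, t). iterated F t (stamp \<tau> \<iota>') (i # \<iota>))"
    by (auto simp: fun_eq_iff stamp_snoc intro!: nn_integral_cong)
  finally show ?case .
qed

lemma iterated_snoc_measurable:
  assumes F: "history_measurable F" and h: "set (map snd h) \<subseteq> online G" "set \<iota> \<subseteq> online G" "i \<in> online G"
  shows "(\<lambda>s. iterated F s (h @ [(s, i)]) \<iota>) \<in> borel_measurable borel"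
proof -
  have h: "h = stamp (\<lambda>k. fst (h ! k)) (map snd h)"
    by (rule stamp_eqI) auto
  have "(\<lambda>s. ((\<lambda>k. fst (h ! k))(length h := s), s)) \<in> borel \<rightarrow>\<^sub>M (\<Pi>\<^sub>M k\<in>UNIV. borel) \<Otimes>\<^sub>M (borel :: real measure)"
    by (intro measurable_Pair measurable_fun_upd[where J = UNIV]) (auto simp: space_PiM)
  from measurable_compose[OF this iterated_measurable[OF F, of "map snd h @ [i]" \<iota>]] assms
  have "(\<lambda>s. iterated F s (stamp ((\<lambda>k. fst (h ! k))(length h := s)) (map snd h @ [i])) \<iota>) \<in> borel_measurable borel"
    by simp
  then show ?thesis
    by (subst h) (simp add: stamp_snoc)
qed


section \<open>Integrating out the gaps\<close>

lemma nn_integral_Ioc_eq_Icc: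
  "(\<integral>\<^sup>+ s. indicator {t<..1} s * f s \<partial>lborel) = (\<integral>\<^sup>+ s. indicator {t..1} s * f s \<partial>lborel)"
  for t :: real
  by (intro nn_integral_cong_AE, use AE_lborel_singleton[of t] in eventually_elim)
     (auto simp: indicator_def)

text \<open>One coordinate of a product measure may be resampled independently. Since
  \<open>(i, k)\<close> already belongs to the index set, inserting it changes nothing, and a fresh
  gap together with an old sample is mapped back to the same product measure.\<close>

lemma nn_integral_renew:
  assumes f: "f \<in> borel_measurable (arrival_space G)" and i: "i \<in> online G"
  shows "(\<integral>\<^sup>+ \<omega>. f \<omega> \<partial>arrival_space G) =
    (\<integral>\<^sup>+ u. \<integral>\<^sup>+ \<omega>. f (fun_upd \<omega> (i, k) u) \<partial>arrival_space G \<partial>gap i)"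
proof -
  let ?I = "online G \<times> (UNIV :: nat set)"
  interpret A: prob_space "arrival_space G" by (rule prob_space_arrival_space)
  have ins: "insert (i, k) ?I = ?I"
    using i by auto
  have distr: "distr (gap i \<Otimes>\<^sub>M arrival_space G) (arrival_space G) (\<lambda>(u, \<omega>). fun_upd \<omega> (i, k) u) = arrival_space G"
    using distr_pair_PiM_eq_PiM[of ?I "\<lambda>z. gap (fst z)" "(i, k)"] prob_space_gap
    by (simp add: ins arrival_space_eq)
  have "(\<lambda>p. fun_upd (snd p) (i, k) (fst p)) \<in> gap i \<Otimes>\<^sub>M arrival_space G \<rightarrow>\<^sub>M arrival_space G"
    unfolding arrival_space_eq
    by (rule measurable_fun_upd[where J = ?I]) (auto simp: i)
  then have m: "(\<lambda>(u, \<omega>). fun_upd \<omega> (i, k) u) \<in> gap i \<Otimes>\<^sub>M arrival_space G \<rightarrow>\<^sub>M arrival_space G"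
    by (simp add: split_beta')
  have "(\<integral>\<^sup>+ \<omega>. f \<omega> \<partial>arrival_space G) =
      (\<integral>\<^sup>+ p. f ((\<lambda>(u, \<omega>). fun_upd \<omega> (i, k) u) p) \<partial>(gap i \<Otimes>\<^sub>M arrival_space G))"
    using nn_integral_distr[OF m, of f] f by (simp add: distr)
  also have "\<dots> = (\<integral>\<^sup>+ u. \<integral>\<^sup>+ \<omega>. f (fun_upd \<omega> (i, k) u) \<partial>arrival_space G \<partial>gap i)"
    by (subst A.nn_integral_fst[symmetric]) (use measurable_compose[OF m f] in \<open>auto simp: split_beta'\<close>)
  finally show ?thesis .
qed

text \<open>The event reads one gap per type, \<open>(i, c i)\<close>, so it is a finite cylinder
  and its probability is a product of exponential tails; their formula needs the thresholds
  \<open>1 - a i\<close> to be nonnegative.\<close>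

lemma nn_integral_realizes_Nil:
  assumes "\<And>i. i \<in> online G \<Longrightarrow> a i \<le> 1"
  shows "(\<integral>\<^sup>+ \<omega>. (if realizes t a c \<omega> [] then b else 0) \<partial>arrival_space G) =
    ennreal (\<Prod>i\<in>online G. exp (- rate G i * (1 - a i))) * b"
proof -
  let ?I = "online G \<times> (UNIV :: nat set)"
  define J where "J = (\<lambda>i. (i, c i)) ` online G"
  define X where "X z = {1 - a (fst z)<..}" for z :: "'i \<times> nat"
  let ?A = "{\<omega> \<in> space (arrival_space G). \<forall>z\<in>J. \<omega> z \<in> X z}"
  have J: "J \<subseteq> ?I" "finite J"
    by (auto simp: J_def)
  have "?A \<in> sets (arrival_space G)"
    using realizes_measurable[of "\<lambda>_. a" "\<lambda>_. t" "[]" c] by (auto simp: J_def X_def pred_def)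
  then have "(\<integral>\<^sup>+ \<omega>. (if realizes t a c \<omega> [] then b else 0) \<partial>arrival_space G) = b * emeasure (arrival_space G) ?A"
    by (subst nn_integral_cmult_indicator[symmetric])
       (auto intro!: nn_integral_cong simp: J_def X_def indicator_def)
  also have "emeasure (arrival_space G) ?A = (\<Prod>z\<in>J. emeasure (gap (fst z)) (X z))"
    unfolding arrival_space_eq by (rule emeasure_PiM_Collect) (use J in \<open>auto simp: X_def\<close>)
  also have "\<dots> = (\<Prod>i\<in>online G. emeasure (gap i) {1 - a i<..})"
    unfolding J_def by (subst prod.reindex) (auto simp: inj_on_def X_def)
  also have "\<dots> = (\<Prod>i\<in>online G. ennreal (exp (- rate G i * (1 - a i))))"
    using assms by (intro prod.cong refl emeasure_gap_greaterThan) auto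
  finally show ?thesis
    by (simp add: prod_ennreal mult.commute)
qed

text \<open>
  The product is the probability that no type arrives again before time \<open>1\<close>. An arrival of type \<open>i\<close> at
  time \<open>s\<close> has density \<open>rate G i * exp (- rate G i * (s - a i))\<close>, which restores the factor lost
  when \<open>a i\<close> becomes \<open>s\<close>.
\<close>

lemma nn_integral_realizes:
  assumes F: "history_measurable F"
    and "\<And>i. i \<in> online G \<Longrightarrow> a i \<le> t" "t \<le> 1" "set \<iota> \<subseteq> online G" "set (map snd h) \<subseteq> online G"
  shows "(\<integral>\<^sup>+ \<omega>. (if realizes t a c \<omega> \<iota> then F (h @ timeline a c \<omega> \<iota>) else 0) \<partial>arrival_space G) =
    ennreal (\<Prod>i\<in>online G. exp (- rate G i * (1 - a i))) * iterated F t h \<iota>"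
  using assms(2-)
proof (induction \<iota> arbitrary: t a c h)
  case Nil
  have "a i \<le> 1" if "i \<in> online G" for i
    using Nil that by force
  from nn_integral_realizes_Nil[of a t c "F h", OF this] show ?case
    unfolding timeline.simps append_Nil2 iterated.simps .
next
  case (Cons i \<iota>)
  let ?P = "arrival_space G"
  have i: "i \<in> online G" and \<iota>: "set \<iota> \<subseteq> online G"
    using Cons.prems by auto
  define pr where "pr a = (\<Prod>i\<in>online G. exp (- rate G i * (1 - a i)))" for a :: "'i \<Rightarrow> real"
  have pr0: "0 \<le> pr a" for a
    unfolding pr_def by (intro prod_nonneg) auto
  have pr_upd: "exp (- rate G i * (1 - a i)) * pr (a(i := s)) = exp (- rate G i * (1 - s)) * pr a" for s
    using i unfolding pr_def by (subst (1 2) prod.remove[of _ i]) (auto intro!: prod.cong)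
  let ?K = "\<lambda>s. iterated F s (h @ [(s, i)]) \<iota>"
  have K[measurable]: "?K \<in> borel_measurable borel"
    using F Cons.prems i by (intro iterated_snoc_measurable) auto
  have pr_meas [measurable]: "(\<lambda>s. pr (a(i := s))) \<in> borel_measurable borel"
  proof -
    have "(\<lambda>s. pr (a(i := s))) = (\<lambda>s. exp (- rate G i * (1 - s)) * pr a / exp (- rate G i * (1 - a i)))"
      using pr_upd by (auto simp: field_simps)
    then show ?thesis by simp
  qed
  let ?f = "\<lambda>\<omega>. if realizes t a c \<omega> (i # \<iota>) then F (h @ timeline a c \<omega> (i # \<iota>)) else 0"
  have "(\<integral>\<^sup>+ \<omega>. ?f \<omega> \<partial>?P) = (\<integral>\<^sup>+ u. \<integral>\<^sup>+ \<omega>. ?f (fun_upd \<omega> (i, c i) u) \<partial>?P \<partial>gap i)"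
  proof (rule nn_integral_renew[OF _ i])
    have "Measurable.pred ?P (\<lambda>\<omega>. realizes t a c \<omega> (i # \<iota>))"
      using Cons.prems by (intro realizes_measurable) auto
    moreover have "(\<lambda>\<omega>. F (h @ timeline a c \<omega> (i # \<iota>))) \<in> borel_measurable ?P"
      using F Cons.prems by (intro append_timeline_measurable) auto
    ultimately show "?f \<in> borel_measurable ?P"
      by measurable
  qed
  also have "\<dots> = (\<integral>\<^sup>+ u. (if t < a i + u \<and> a i + u \<le> 1 then ennreal (pr (a(i := a i + u))) * ?K (a i + u) else 0) \<partial>gap i)"
  proof (intro nn_integral_cong)
    fix u
    define s where "s = a i + u"
    define a' c' where "a' = a(i := s)" and "c' = c(i := Suc (c i))"
    have *: "realizes s a' c' (fun_upd \<omega> (i, c i) u) \<iota> = realizes s a' c' \<omega> \<iota>"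
      "timeline a' c' (fun_upd \<omega> (i, c i) u) \<iota> = timeline a' c' \<omega> \<iota>" for \<omega>
      using realizes_timeline_cong[of c' "fun_upd \<omega> (i, c i) u" \<omega> s a' \<iota>] by (auto simp: c'_def split: if_splits)
    have f: "?f (fun_upd \<omega> (i, c i) u) = (if t < s \<and> s \<le> 1 then
        (if realizes s a' c' \<omega> \<iota> then F ((h @ [(s, i)]) @ timeline a' c' \<omega> \<iota>) else 0) else 0)" for \<omega>
      using * by (auto simp: s_def a'_def c'_def)
    show "(\<integral>\<^sup>+ \<omega>. ?f (fun_upd \<omega> (i, c i) u) \<partial>?P) =
        (if t < a i + u \<and> a i + u \<le> 1 then ennreal (pr (a(i := a i + u))) * ?K (a i + u) else 0)"
    proof (cases "t < s \<and> s \<le> 1")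
      case True
      have "(\<integral>\<^sup>+ \<omega>. (if realizes s a' c' \<omega> \<iota> then F ((h @ [(s, i)]) @ timeline a' c' \<omega> \<iota>) else 0) \<partial>?P) =
          ennreal (\<Prod>i\<in>online G. exp (- rate G i * (1 - a' i))) * ?K s"
      proof (rule Cons.IH)
        fix i' assume "i' \<in> online G"
        then show "a' i' \<le> s"
          using Cons.prems(1)[of i'] True by (auto simp: a'_def)
      qed (use True Cons.prems in auto)
      then show ?thesis
        unfolding f using True by (simp add: s_def a'_def pr_def)
    qed (unfold f, auto simp: s_def)
  qed
  also have "\<dots> = (\<integral>\<^sup>+ u. ennreal (exponential_density (rate G i) u) *
      (if t < a i + u \<and> a i + u \<le> 1 then ennreal (pr (a(i := a i + u))) * ?K (a i + u) else 0) \<partial>lborel)"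
    using i by (simp add: gap_def nn_integral_density)
  also have "\<dots> = (\<integral>\<^sup>+ s. ennreal (exponential_density (rate G i) (s - a i)) *
      (if t < s \<and> s \<le> 1 then ennreal (pr (a(i := s))) * ?K s else 0) \<partial>lborel)"
    by (subst nn_integral_real_affine[where c = 1 and t = "- a i"]) (auto intro!: nn_integral_cong)
  also have "\<dots> = (\<integral>\<^sup>+ s. ennreal (pr a) * (ennreal (rate G i) * indicator {t<..1} s * ?K s) \<partial>lborel)"
  proof (intro nn_integral_cong)
    fix s
    show "ennreal (exponential_density (rate G i) (s - a i)) * (if t < s \<and> s \<le> 1 then ennreal (pr (a(i := s))) * ?K s else 0)
       = ennreal (pr a) * (ennreal (rate G i) * indicator {t<..1} s * ?K s)"
    proof (cases "t < s \<and> s \<le> 1")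
      case True
      \<comment> \<open>\<open>a i \<le> t < s\<close> puts the waiting time in the range where the
        exponential density has its exponential form.\<close>
      then have "0 \<le> s - a i"
        using Cons.prems(1)[OF i] by auto
      then have "exponential_density (rate G i) (s - a i) * pr (a(i := s)) =
          rate G i * (exp (- rate G i * (s - a i)) * pr (a(i := s)))"
        by (simp add: exponential_density_def algebra_simps)
      also have "exp (- rate G i * (s - a i)) = exp (- rate G i * (1 - a i)) / exp (- rate G i * (1 - s))"
        by (simp add: algebra_simps flip: exp_diff)
      also have "rate G i * (exp (- rate G i * (1 - a i)) / exp (- rate G i * (1 - s)) * pr (a(i := s))) = rate G i * pr a"
        using pr_upd[of s] by (simp add: field_simps)
      finally have *: "exponential_density (rate G i) (s - a i) * pr (a(i := s)) = rate G i * pr a" .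
      have "ennreal (exponential_density (rate G i) (s - a i)) * ennreal (pr (a(i := s))) = ennreal (rate G i) * ennreal (pr a)"
        using * rate_pos[OF i] pr0 by (simp add: exponential_density_nonneg flip: ennreal_mult)
      then show ?thesis
        using True by (simp add: ac_simps) (simp add: mult.assoc[symmetric])
    qed auto
  qed
  also have "\<dots> = ennreal (pr a) * (\<integral>\<^sup>+ s. ennreal (rate G i) * indicator {t<..1} s * ?K s \<partial>lborel)"
    by (rule nn_integral_cmult) measurable
  finally show ?case
    by (simp add: pr_def)
qed

end

section \<open>Identifying \<open>arrivals\<close> with the timeline of the realized word\<close>

lemma (in linorder) sorted_key_list_of_set_eqI:
  assumes "inj_on f A" "finite A" "sorted_wrt (<) (map f l)" "set l = A" "length l = card A"
  shows "sorted_key_list_of_set f A = l"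
proof -
  interpret folding_insort_key "(\<le>)" "(<)" A f
    using assms(1) by unfold_locales
  show ?thesis
    using sorted_key_list_of_set_unique[of A l] assms by simp
qed

context type_graph_instance begin

abbreviation initial_realizes :: "('i \<times> nat \<Rightarrow> real) \<Rightarrow> 'i list \<Rightarrow> bool" where
  "initial_realizes \<equiv> realizes 0 (\<lambda>_. 0) (\<lambda>_. 0)"

abbreviation initial_timeline :: "('i \<times> nat \<Rightarrow> real) \<Rightarrow> 'i list \<Rightarrow> (real \<times> 'i) list" where
  "initial_timeline \<equiv> timeline (\<lambda>_. 0) (\<lambda>_. 0)"

lemma arrival_time_mono:
  assumes "\<And>k. 0 < \<omega> (i, k)" "k \<le> l"
  shows "arrival_time \<omega> i k \<le> arrival_time \<omega> i l"
  unfolding arrival_time_def using assms by (intro sum_mono2) (auto intro: less_imp_le)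

text \<open>The last hypothesis is the invariant that \<open>a i\<close> is the sum of the gaps of
  type \<open>i\<close> spent so far. When the word ends, positive gaps make the arrival times of
  each type increasing, so the condition on the next gap excludes all later arrivals as
  well.\<close>

lemma timeline_props:
  assumes pos: "\<And>i k. i \<in> online G \<Longrightarrow> 0 < \<omega> (i, k)"
    and "realizes t a c \<omega> \<iota>" "set \<iota> \<subseteq> online G"
    and "\<And>i. i \<in> online G \<Longrightarrow> a i + \<omega> (i, c i) = arrival_time \<omega> i (c i)"
  shows "sorted_wrt (<) (map fst (timeline a c \<omega> \<iota>)) \<and>
     (\<forall>p\<in>set (timeline a c \<omega> \<iota>). t < fst p) \<and>
     set (timeline a c \<omega> \<iota>) = {(arrival_time \<omega> i k, i) | i k. i \<in> online G \<and> c i \<le> k \<and> arrival_time \<omega> i k \<le> 1}"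
  using assms(2-)
proof (induction \<iota> arbitrary: t a c)
  case Nil
  have "\<not> arrival_time \<omega> i k \<le> 1" if "i \<in> online G" "c i \<le> k" for i k
  proof -
    have "1 < arrival_time \<omega> i (c i)"
    proof -
      have "1 - a i < \<omega> (i, c i)"
        using Nil(1) that(1) by simp
      then show ?thesis
        using Nil(3)[OF that(1)] by linarith
    qed
    also have "\<dots> \<le> arrival_time \<omega> i k"
      using pos that by (intro arrival_time_mono) auto
    finally show ?thesis by simp
  qed
  then show ?case by auto
next
  case (Cons i \<iota>)
  define s where "s = a i + \<omega> (i, c i)"
  have i: "i \<in> online G" using Cons.prems by simp
  have s: "s = arrival_time \<omega> i (c i)" "t < s" "s \<le> 1"
    using Cons.prems i by (auto simp: s_def)
  let ?c = "c(i := Suc (c i))" and ?a = "a(i := s)"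
  have IH: "sorted_wrt (<) (map fst (timeline ?a ?c \<omega> \<iota>)) \<and>
     (\<forall>p\<in>set (timeline ?a ?c \<omega> \<iota>). s < fst p) \<and>
     set (timeline ?a ?c \<omega> \<iota>) = {(arrival_time \<omega> i' k, i') | i' k. i' \<in> online G \<and> ?c i' \<le> k \<and> arrival_time \<omega> i' k \<le> 1}"
  proof (rule Cons.IH)
    show "realizes s ?a ?c \<omega> \<iota>"
      using Cons.prems by (simp flip: s_def)
    fix i' assume "i' \<in> online G"
    then show "?a i' + \<omega> (i', ?c i') = arrival_time \<omega> i' (?c i')"
      using Cons.prems by (auto simp: s arrival_time_def)
  qed (use Cons.prems in \<open>simp_all flip: s_def\<close>)
  have split: "{(arrival_time \<omega> i' k, i') | i' k. i' \<in> online G \<and> c i' \<le> k \<and> arrival_time \<omega> i' k \<le> 1} =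
      insert (s, i) {(arrival_time \<omega> i' k, i') | i' k. i' \<in> online G \<and> ?c i' \<le> k \<and> arrival_time \<omega> i' k \<le> 1}"
    (is "?L = ?R")
  proof
    show "?L \<subseteq> ?R"
    proof (rule subsetI)
      fix p assume "p \<in> ?L"
      then obtain i' k where p: "p = (arrival_time \<omega> i' k, i')" "i' \<in> online G" "c i' \<le> k" "arrival_time \<omega> i' k \<le> 1"
        by blast
      show "p \<in> ?R"
      proof (cases "?c i' \<le> k")
        case True
        then show ?thesis using p by blast
      next
        case False
        then have "i' = i" "k = c i"
          using p(3) by (auto split: if_splits)
        then show ?thesis by (simp add: p(1) s(1))
      qed
    qed
    show "?R \<subseteq> ?L"
      using i s by (fastforce split: if_splits)
  qed
  define T where "T = timeline ?a ?c \<omega> \<iota>"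
  have T: "timeline a c \<omega> (i # \<iota>) = (s, i) # T"
    by (simp add: s_def T_def)
  have IH': "sorted_wrt (<) (map fst T)" "\<And>p. p \<in> set T \<Longrightarrow> s < fst p"
    using IH by (simp_all add: T_def)
  have "sorted_wrt (<) (map fst ((s, i) # T))"
    using IH' by simp
  moreover have "\<forall>p\<in>set ((s, i) # T). t < fst p"
    using IH'(2) s(2) by force
  moreover have "set ((s, i) # T) = insert (s, i) {(arrival_time \<omega> i' k, i') | i' k. i' \<in> online G \<and> ?c i' \<le> k \<and> arrival_time \<omega> i' k \<le> 1}"
    using IH unfolding T_def[symmetric] list.set by (elim conjE) (simp only:)
  ultimately show ?case
    unfolding T split by (intro conjI)
qed

text \<open>Strict increase of the times makes \<open>fst\<close> injective on the set of arrivals,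
  the condition under which sorting by time determines the list.\<close>

lemma arrivals_eq_timeline:
  assumes pos: "\<forall>i\<in>online G. \<forall>k. 0 < \<omega> (i, k)" and r: "initial_realizes \<omega> \<iota>" "set \<iota> \<subseteq> online G"
  shows "arrivals G \<omega> = initial_timeline \<omega> \<iota>"
proof -
  let ?S = "{(arrival_time \<omega> i k, i) | i k. i \<in> online G \<and> arrival_time \<omega> i k \<le> 1}"
  let ?l = "initial_timeline \<omega> \<iota>"
  have *: "sorted_wrt (<) (map fst ?l)" "set ?l = ?S"
    using timeline_props[OF _ r] pos by (auto simp: arrival_time_def)
  have d: "distinct (map fst ?l)"
    using *(1) by (simp add: strict_sorted_iff)
  then have "inj_on fst ?S"
    unfolding *(2)[symmetric] by (simp add: distinct_map)
  moreover have "length ?l = card (set ?l)"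
    using d by (simp add: distinct_card distinct_map)
  moreover have "finite ?S"
    unfolding *(2)[symmetric] by simp
  ultimately have "sorted_key_list_of_set fst ?S = ?l"
    using * by (intro sorted_key_list_of_set_eqI) simp_all
  then show ?thesis
    by (simp add: arrivals_def)
qed

section \<open>Words of types and their rates\<close>

definition words :: "nat \<Rightarrow> 'i list set" where
  "words n = {\<iota>. set \<iota> \<subseteq> online G \<and> length \<iota> = n}"

lemma finite_words [simp, intro]: "finite (words n)"
  unfolding words_def by (rule finite_lists_length_eq) auto

lemma words_0 [simp]: "words 0 = {[]}"
  by (auto simp: words_def)

lemma sum_words_Suc: "(\<Sum>\<iota>\<in>words (Suc n). f \<iota>) = (\<Sum>i\<in>online G. \<Sum>\<iota>\<in>words n. f (i # \<iota>))"
proof -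
  have "words (Suc n) = (\<lambda>(i, \<iota>). i # \<iota>) ` (online G \<times> words n)"
    by (auto simp: words_def image_iff length_Suc_conv)
  then have "(\<Sum>\<iota>\<in>words (Suc n). f \<iota>) = (\<Sum>(i, \<iota>)\<in>online G \<times> words n. f (i # \<iota>))"
    by (simp add: sum.reindex inj_on_def split_beta')
  then show ?thesis
    by (simp add: sum.cartesian_product)
qed

definition total_rate :: real where
  "total_rate = (\<Sum>i\<in>online G. rate G i)"

definition word_rate :: "'i list \<Rightarrow> real" where
  "word_rate \<iota> = prod_list (map (rate G) \<iota>)"

lemma word_rate_nonneg: "\<iota> \<in> words n \<Longrightarrow> 0 \<le> word_rate \<iota>"
  by (auto simp: word_rate_def words_def intro!: prod_list_nonneg less_imp_le[OF rate_pos])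

lemma sum_word_rate: "(\<Sum>\<iota>\<in>words n. word_rate \<iota>) = total_rate ^ n"
  by (induction n)
     (auto simp: sum_words_Suc word_rate_def total_rate_def simp flip: sum_distrib_left sum_distrib_right)

lemma nn_integral_power_fact:
  fixes t :: real
  assumes "t \<le> 1"
  shows "(\<integral>\<^sup>+ s. ennreal ((1 - s) ^ n / fact n) * indicator {t..1} s \<partial>lborel) = ennreal ((1 - t) ^ Suc n / fact (Suc n))"
proof -
  have "(\<integral>\<^sup>+ s. ennreal ((1 - s) ^ n / fact n) * indicator {t..1} s \<partial>lborel) =
     ennreal (- ((1 - 1) ^ Suc n / fact (Suc n)) - - ((1 - t) ^ Suc n / fact (Suc n)))"
  proof (rule nn_integral_FTC_Icc[where F = "\<lambda>s. - ((1 - s) ^ Suc n / fact (Suc n))"])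
    fix s :: real
    have "((\<lambda>s. - ((1 - s) ^ Suc n / fact (Suc n))) has_real_derivative
        real (Suc n) * (1 - s) ^ n / fact (Suc n)) (at s)"
      by (auto intro!: derivative_eq_intros simp del: power_Suc fact_Suc)
    also have "real (Suc n) * (1 - s) ^ n / fact (Suc n) = (1 - s) ^ n / fact n"
      by (simp del: of_nat_Suc)
    finally show "((\<lambda>s. - ((1 - s) ^ Suc n / fact (Suc n))) has_real_derivative (1 - s) ^ n / fact n) (at s)" .
  qed (use assms in auto)
  then show ?thesis by simp
qed

text \<open>An integrand that reads only the types is constant in the times; what remains of the
  integral is the volume \<open>(1 - t) ^ n / fact n\<close> of the simplex of increasing
  times.\<close>

lemma iterated_type_fun:
  assumes "t \<le> 1" "set \<iota> \<subseteq> online G"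
  shows "iterated (\<lambda>h. g (map snd h)) t h \<iota> =
    ennreal (word_rate \<iota>) * ennreal ((1 - t) ^ length \<iota> / fact (length \<iota>)) * g (map snd h @ \<iota>)"
  using assms
proof (induction \<iota> arbitrary: t h)
  case Nil
  then show ?case by (simp add: word_rate_def)
next
  case (Cons i \<iota>)
  let ?n = "length \<iota>" and ?g = "g (map snd h @ i # \<iota>)"
  have nn: "0 \<le> word_rate \<iota>" "0 \<le> rate G i"
    using Cons.prems word_rate_nonneg[of \<iota> ?n] rate_pos[of i] by (auto simp: words_def)
  have "iterated (\<lambda>h. g (map snd h)) t h (i # \<iota>) =
     (\<integral>\<^sup>+ s. indicator {t<..1} s * (ennreal (rate G i) * ennreal (word_rate \<iota>) * ?g * ennreal ((1 - s) ^ ?n / fact ?n)) \<partial>lborel)"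
    unfolding iterated.simps
    by (intro nn_integral_cong) (use Cons in \<open>auto simp: indicator_def ac_simps\<close>)
  also have "\<dots> = (\<integral>\<^sup>+ s. (ennreal (rate G i) * ennreal (word_rate \<iota>) * ?g) * (ennreal ((1 - s) ^ ?n / fact ?n) * indicator {t..1} s) \<partial>lborel)"
    unfolding nn_integral_Ioc_eq_Icc by (simp add: ac_simps)
  also have "\<dots> = (ennreal (rate G i) * ennreal (word_rate \<iota>) * ?g) * ennreal ((1 - t) ^ Suc ?n / fact (Suc ?n))"
    using Cons.prems by (subst nn_integral_cmult) (auto simp: nn_integral_power_fact simp del: power_Suc fact_Suc)
  also have "\<dots> = ennreal (word_rate (i # \<iota>)) * ennreal ((1 - t) ^ length (i # \<iota>) / fact (length (i # \<iota>))) * ?g"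
    using nn by (simp add: word_rate_def ennreal_mult ac_simps del: power_Suc fact_Suc)
  finally show ?case .
qed

lemma history_measurable_type_fun: "history_measurable (\<lambda>h. g (map snd h))"
  by (simp add: history_measurable_def)

lemma suminf_exp: "0 \<le> b \<Longrightarrow> (\<Sum>n. ennreal (b ^ n / fact n)) = ennreal (exp b)"
  using exp_converges[of b] by (intro suminf_ennreal_eq) (auto simp: divide_inverse mult.commute)

text \<open>A realized word is the list of types in \<open>arrivals G \<omega>\<close>, so it is
  unique and at most one term of the double sum survives.\<close>

lemma suminf_realizes:
  assumes pos: "\<forall>i\<in>online G. \<forall>k. 0 < \<omega> (i, k)"
    and r: "initial_realizes \<omega> \<iota>" "set \<iota> \<subseteq> online G"
  shows "(\<Sum>n. \<Sum>\<iota>\<in>words n. if initial_realizes \<omega> \<iota> then F (initial_timeline \<omega> \<iota>) else (0 :: ennreal)) =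
    F (arrivals G \<omega>)"
proof -
  have uniq: "\<iota>' = \<iota>" if "initial_realizes \<omega> \<iota>'" "set \<iota>' \<subseteq> online G" for \<iota>'
  proof -
    have "map snd (initial_timeline \<omega> \<iota>') = map snd (initial_timeline \<omega> \<iota>)"
      using arrivals_eq_timeline[OF pos r] arrivals_eq_timeline[OF pos that] by simp
    then show ?thesis by simp
  qed
  have "(\<Sum>\<iota>'\<in>words n. if initial_realizes \<omega> \<iota>' then F (initial_timeline \<omega> \<iota>') else 0) =
      (if n = length \<iota> then F (arrivals G \<omega>) else 0)" for n
  proof -
    have "(\<Sum>\<iota>'\<in>words n. if initial_realizes \<omega> \<iota>' then F (initial_timeline \<omega> \<iota>') else 0) =
       (\<Sum>\<iota>'\<in>words n. if \<iota>' = \<iota> then F (arrivals G \<omega>) else 0)"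
    proof (intro sum.cong refl)
      fix \<iota>' assume "\<iota>' \<in> words n"
      then have "set \<iota>' \<subseteq> online G"
        by (simp add: words_def)
      then show "(if initial_realizes \<omega> \<iota>' then F (initial_timeline \<omega> \<iota>') else 0) =
          (if \<iota>' = \<iota> then F (arrivals G \<omega>) else 0)"
      proof (cases "initial_realizes \<omega> \<iota>'")
        case True
        with \<open>set \<iota>' \<subseteq> online G\<close> have "\<iota>' = \<iota>"
          by (intro uniq)
        then show ?thesis
          using r(1) by (simp add: arrivals_eq_timeline[OF pos r])
      next
        case False
        then have "\<iota>' \<noteq> \<iota>"
          using r(1) by blast
        with False show ?thesis by simp
      qed
    qed
    also have "\<dots> = (if n = length \<iota> then F (arrivals G \<omega>) else 0)"
    proof -
      have "\<iota> \<in> words n \<longleftrightarrow> n = length \<iota>"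
        using r by (auto simp: words_def)
      then show ?thesis by simp
    qed
    finally show ?thesis .
  qed
  then show ?thesis
    using sums_single[of "length \<iota>" "\<lambda>_. F (arrivals G \<omega>)"] by (simp add: sums_iff)
qed

lemma nn_integral_suminf_realizes:
  assumes F: "history_measurable F"
  shows "(\<integral>\<^sup>+ \<omega>. (\<Sum>n. \<Sum>\<iota>\<in>words n. if initial_realizes \<omega> \<iota> then F (initial_timeline \<omega> \<iota>) else 0) \<partial>arrival_space G) =
    ennreal (exp (- total_rate)) * (\<Sum>n. \<Sum>\<iota>\<in>words n. iterated F 0 [] \<iota>)"
proof -
  have [measurable]: "(\<lambda>\<omega>. if initial_realizes \<omega> \<iota> then F (initial_timeline \<omega> \<iota>) else 0) \<in> borel_measurable (arrival_space G)"
    if "\<iota> \<in> words n" for \<iota> n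
  proof -
    have [measurable]: "Measurable.pred (arrival_space G) (\<lambda>\<omega>. initial_realizes \<omega> \<iota>)"
      using that by (intro realizes_measurable) (auto simp: words_def)
    have [measurable]: "(\<lambda>\<omega>. F (initial_timeline \<omega> \<iota>)) \<in> borel_measurable (arrival_space G)"
      using append_timeline_measurable[OF F, of "[]" \<iota>] that by (auto simp: words_def)
    show ?thesis by measurable
  qed
  have eq: "(\<integral>\<^sup>+ \<omega>. (if initial_realizes \<omega> \<iota> then F (initial_timeline \<omega> \<iota>) else 0) \<partial>arrival_space G) =
      ennreal (exp (- total_rate)) * iterated F 0 [] \<iota>" if "\<iota> \<in> words n" for \<iota> n
    using nn_integral_realizes[OF F, of "\<lambda>_. 0" 0 \<iota> "[]" "\<lambda>_. 0", unfolded append_Nil] that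
    by (simp add: words_def total_rate_def exp_sum sum_negf flip: exp_sum)
  have "(\<integral>\<^sup>+ \<omega>. (\<Sum>n. \<Sum>\<iota>\<in>words n. if initial_realizes \<omega> \<iota> then F (initial_timeline \<omega> \<iota>) else 0) \<partial>arrival_space G) =
     (\<Sum>n. \<Sum>\<iota>\<in>words n. \<integral>\<^sup>+ \<omega>. (if initial_realizes \<omega> \<iota> then F (initial_timeline \<omega> \<iota>) else 0) \<partial>arrival_space G)"
    by (subst nn_integral_suminf) (auto simp: nn_integral_sum)
  also have "\<dots> = (\<Sum>n. ennreal (exp (- total_rate)) * (\<Sum>\<iota>\<in>words n. iterated F 0 [] \<iota>))"
    by (intro suminf_cong) (simp add: eq sum_distrib_left)
  finally show ?thesis
    by simp
qed

lemma total_rate_nonneg: "0 \<le> total_rate"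
  unfolding total_rate_def by (intro sum_nonneg) (auto intro: less_imp_le rate_pos)

text \<open>The probabilities of the disjoint events \<open>initial_realizes \<omega> \<iota>\<close> sum up to \<open>1\<close>.\<close>

lemma AE_realizes: "AE \<omega> in arrival_space G. \<exists>\<iota>. set \<iota> \<subseteq> online G \<and> initial_realizes \<omega> \<iota>"
proof -
  interpret A: prob_space "arrival_space G" by (rule prob_space_arrival_space)
  define W where "W = {\<omega> \<in> space (arrival_space G). \<exists>\<iota>\<in>{\<iota>. set \<iota> \<subseteq> online G}. initial_realizes \<omega> \<iota>}"
  have "countable {\<iota>. set \<iota> \<subseteq> online G}"
    using countable_lists[OF countable_finite[OF finite_online]] by (simp add: lists_eq_set)
  moreover have "{\<omega> \<in> space (arrival_space G). initial_realizes \<omega> \<iota>} \<in> sets (arrival_space G)"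
    if "set \<iota> \<subseteq> online G" for \<iota>
    using realizes_measurable[of "\<lambda>_ _. 0" "\<lambda>_. 0" \<iota> "\<lambda>_. 0"] that by (simp add: pred_def)
  moreover have "W = (\<Union>\<iota>\<in>{\<iota>. set \<iota> \<subseteq> online G}. {\<omega> \<in> space (arrival_space G). initial_realizes \<omega> \<iota>})"
    by (auto simp: W_def)
  ultimately have W: "W \<in> sets (arrival_space G)"
    by (auto intro!: sets.countable_UN'')
  have "emeasure (arrival_space G) W = (\<integral>\<^sup>+ \<omega>. indicator W \<omega> \<partial>arrival_space G)"
    using W by simp
  also have "\<dots> = (\<integral>\<^sup>+ \<omega>. (\<Sum>n. \<Sum>\<iota>\<in>words n. if initial_realizes \<omega> \<iota> then (\<lambda>_. 1) (initial_timeline \<omega> \<iota>) else 0) \<partial>arrival_space G)"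
  proof (rule nn_integral_cong_AE)
    show "AE \<omega> in arrival_space G. indicator W \<omega> = (\<Sum>n. \<Sum>\<iota>\<in>words n. if initial_realizes \<omega> \<iota> then (\<lambda>_. 1 :: ennreal) (initial_timeline \<omega> \<iota>) else 0)"
      using AE_gaps_pos AE_space
    proof eventually_elim
      case (elim \<omega>)
      show ?case
      proof (cases "\<exists>\<iota>. set \<iota> \<subseteq> online G \<and> initial_realizes \<omega> \<iota>")
        case True
        then obtain \<iota> where \<iota>: "set \<iota> \<subseteq> online G" "initial_realizes \<omega> \<iota>" by blast
        then have "\<omega> \<in> W"
          using elim(2) by (auto simp: W_def)
        with suminf_realizes[OF elim(1) \<iota>(2,1), of "\<lambda>_. 1"] show ?thesis
          by simp
      next
        case False
        then have "(\<Sum>\<iota>\<in>words n. if initial_realizes \<omega> \<iota> then 1 else (0::ennreal)) = 0" for n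
          by (intro sum.neutral) (auto simp: words_def)
        moreover have "\<omega> \<notin> W"
          using False by (auto simp: W_def)
        ultimately show ?thesis
          by simp
      qed
    qed
  qed
  also have "\<dots> = ennreal (exp (- total_rate)) * (\<Sum>n. \<Sum>\<iota>\<in>words n. iterated (\<lambda>_. 1) 0 [] \<iota>)"
    by (rule nn_integral_suminf_realizes) (simp add: history_measurable_def)
  also have "(\<Sum>n. \<Sum>\<iota>\<in>words n. iterated (\<lambda>_. 1) 0 [] \<iota>) = (\<Sum>n. ennreal (total_rate ^ n / fact n))"
  proof (intro suminf_cong)
    fix n
    have "(\<Sum>\<iota>\<in>words n. iterated (\<lambda>_. 1) 0 [] \<iota>) = (\<Sum>\<iota>\<in>words n. ennreal (word_rate \<iota> * (1 / fact n)))"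
    proof (intro sum.cong refl)
      fix \<iota> assume \<iota>: "\<iota> \<in> words n"
      show "iterated (\<lambda>_. 1) 0 [] \<iota> = ennreal (word_rate \<iota> * (1 / fact n))"
        using iterated_type_fun[of 0 \<iota> "\<lambda>_. 1" "[]"] \<iota> word_rate_nonneg[OF \<iota>]
        by (simp add: words_def flip: ennreal_mult')
    qed
    also have "\<dots> = ennreal ((\<Sum>\<iota>\<in>words n. word_rate \<iota>) * (1 / fact n))"
      unfolding sum_distrib_right by (intro sum_ennreal) (auto intro!: divide_nonneg_pos word_rate_nonneg)
    finally show "(\<Sum>\<iota>\<in>words n. iterated (\<lambda>_. 1) 0 [] \<iota>) = ennreal (total_rate ^ n / fact n)"
      by (simp add: sum_word_rate)
  qed
  also have "\<dots> = ennreal (exp total_rate)"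
    using total_rate_nonneg by (rule suminf_exp)
  also have "ennreal (exp (- total_rate)) * \<dots> = 1"
    by (simp add: exp_minus flip: ennreal_mult)
  finally have "A.prob W = 1"
    by (simp add: A.emeasure_eq_measure)
  then have "AE \<omega> in arrival_space G. \<omega> \<in> W"
    using W A.AE_in_set_eq_1 by blast
  then show ?thesis
    by eventually_elim (auto simp: W_def)
qed

theorem nn_integral_arrivals:
  assumes F: "history_measurable F"
  shows "(\<integral>\<^sup>+ \<omega>. F (arrivals G \<omega>) \<partial>arrival_space G) =
    ennreal (exp (- total_rate)) * (\<Sum>n. \<Sum>\<iota>\<in>words n. iterated F 0 [] \<iota>)"
proof -
  have "(\<integral>\<^sup>+ \<omega>. F (arrivals G \<omega>) \<partial>arrival_space G) =
    (\<integral>\<^sup>+ \<omega>. (\<Sum>n. \<Sum>\<iota>\<in>words n. if initial_realizes \<omega> \<iota> then F (initial_timeline \<omega> \<iota>) else 0) \<partial>arrival_space G)"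
  proof (rule nn_integral_cong_AE)
    show "AE \<omega> in arrival_space G. F (arrivals G \<omega>) =
        (\<Sum>n. \<Sum>\<iota>\<in>words n. if initial_realizes \<omega> \<iota> then F (initial_timeline \<omega> \<iota>) else 0)"
      using AE_gaps_pos AE_realizes
    proof eventually_elim
      case (elim \<omega>)
      then obtain \<iota> where "set \<iota> \<subseteq> online G" "initial_realizes \<omega> \<iota>" by blast
      from suminf_realizes[OF elim(1) this(2,1), of F] show ?case by simp
    qed
  qed
  then show ?thesis
    using nn_integral_suminf_realizes[OF F] by simp
qed

end

section \<open>The linear program bounds the offline optimum\<close>

lemma sum_power_fact_le_exp:
  assumes "0 \<le> (b::real)"
  shows "(\<Sum>n<N. b ^ n / fact n) \<le> exp b"
proof -
  have "(\<lambda>n. b ^ n / fact n) sums exp b"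
    using exp_converges[of b] by (simp add: divide_inverse mult.commute)
  then show ?thesis
    using assms sum_le_suminf[of "\<lambda>n. b ^ n / fact n" "{..<N}"] by (auto simp: sums_iff)
qed

lemma sum_power_diff_fact_le_exp_diff:
  assumes "0 \<le> (a::real)" "a \<le> b"
  shows "(\<Sum>n<N. (b ^ n - a ^ n) / fact n) \<le> exp b - exp a"
proof -
  have "(\<lambda>n. b ^ n / fact n - a ^ n / fact n) sums (exp b - exp a)"
    using exp_converges[of b] exp_converges[of a]
    by (intro sums_diff) (simp_all add: divide_inverse mult.commute)
  moreover have "0 \<le> b ^ n / fact n - a ^ n / fact n" for n
    using assms by (simp add: divide_right_mono power_mono)
  ultimately show ?thesis
    using sum_le_suminf[of "\<lambda>n. b ^ n / fact n - a ^ n / fact n" "{..<N}"]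
    by (simp add: sums_iff diff_divide_distrib)
qed

lemma opt_cong:
  assumes "map snd h = map snd h'"
  shows "opt G h = opt G h'"
proof -
  have len: "length h = length h'"
    using assms by (rule map_eq_imp_length_eq)
  have nth: "snd (h ! n) = snd (h' ! n)" if "n < length h" for n
    using assms len that by (metis nth_map)
  have om: "offline_matching G h m = offline_matching G h' m" for m
  proof -
    have "{(n, j). n < length h \<and> (snd (h ! n), j) \<in> edges G} = {(n, j). n < length h' \<and> (snd (h' ! n), j) \<in> edges G}"
      using len nth by auto
    then show ?thesis
      by (simp add: offline_matching_def)
  qed
  have "(\<Sum>(n, j)\<in>m. weight G (snd (h ! n)) j) = (\<Sum>(n, j)\<in>m. weight G (snd (h' ! n)) j)"
    if "offline_matching G h m" for m
    using that nth by (intro sum.cong refl) (auto simp: offline_matching_def)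
  then have "{(\<Sum>(n, j)\<in>m. weight G (snd (h ! n)) j) | m. offline_matching G h m} =
      {(\<Sum>(n, j)\<in>m. weight G (snd (h' ! n)) j) | m. offline_matching G h' m}"
    unfolding om by (metis (lifting))
  then show ?thesis
    by (simp add: opt_def)
qed

context type_graph_instance begin

section \<open>Offline matchings and their expected usage as an LP solution\<close>

lemma finite_edges [simp, intro]: "finite (edges G)"
  using type_graph finite_subset[of "edges G" "online G \<times> offline G"] by (auto simp: type_graph_def)

text \<open>The time 0 is a dummy: by \<open>opt_cong\<close> the optimum depends on the types
  only.\<close>

definition word_opt :: "'i list \<Rightarrow> real" where
  "word_opt \<iota> = opt G (map (Pair 0) \<iota>)"

definition word_matching :: "'i list \<Rightarrow> (nat \<times> 'j) set \<Rightarrow> bool" where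
  "word_matching \<iota> m \<longleftrightarrow> offline_matching G (map (Pair 0) \<iota>) m"

lemma word_matchingD:
  assumes "word_matching \<iota> m"
  shows "finite m" "inj_on fst m" "inj_on snd m"
    "\<And>n j. (n, j) \<in> m \<Longrightarrow> n < length \<iota>" "\<And>n j. (n, j) \<in> m \<Longrightarrow> (\<iota> ! n, j) \<in> edges G"
proof -
  show *: "inj_on fst m" "inj_on snd m"
    "\<And>n j. (n, j) \<in> m \<Longrightarrow> n < length \<iota>" "\<And>n j. (n, j) \<in> m \<Longrightarrow> (\<iota> ! n, j) \<in> edges G"
    using assms by (auto simp: word_matching_def offline_matching_def)
  have "fst ` m \<subseteq> {..<length \<iota>}"
    using *(3) by auto
  then show "finite m"
    using *(1) finite_imageD finite_subset by blast
qed

lemma word_opt_attained: "\<exists>m. word_matching \<iota> m \<and> word_opt \<iota> = (\<Sum>(n, j)\<in>m. weight G (\<iota> ! n) j)"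
proof -
  let ?h = "map (Pair (0::real)) \<iota>"
  let ?V = "{(\<Sum>(n, j)\<in>m. weight G (snd (?h ! n)) j) | m. offline_matching G ?h m}"
  have "{m. offline_matching G ?h m} \<subseteq> Pow ({..<length \<iota>} \<times> snd ` edges G)"
    by (force simp: offline_matching_def)
  then have "finite {m. offline_matching G ?h m}"
    by (rule finite_subset) auto
  then have "finite ?V"
    by auto
  moreover have "offline_matching G ?h {}"
    by (simp add: offline_matching_def)
  then have "?V \<noteq> {}"
    by blast
  ultimately have "Max ?V \<in> ?V"
    by (rule Max_in)
  then obtain m where m: "offline_matching G ?h m" "word_opt \<iota> = (\<Sum>(n, j)\<in>m. weight G (snd (?h ! n)) j)"
    unfolding word_opt_def opt_def by blast
  have "(\<Sum>(n, j)\<in>m. weight G (snd (?h ! n)) j) = (\<Sum>(n, j)\<in>m. weight G (\<iota> ! n) j)"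
    using m(1) by (intro sum.cong refl) (auto simp: offline_matching_def)
  then show ?thesis
    using m by (auto simp: word_matching_def)
qed

definition usage :: "'i list \<Rightarrow> (nat \<times> 'j) set \<Rightarrow> 'i \<Rightarrow> 'j \<Rightarrow> real" where
  "usage \<iota> m i j = real (card {p\<in>m. \<iota> ! fst p = i \<and> snd p = j})"

lemma matching_value_eq_usage:
  assumes "word_matching \<iota> m"
  shows "(\<Sum>(n, j)\<in>m. weight G (\<iota> ! n) j) = (\<Sum>(i, j)\<in>edges G. weight G i j * usage \<iota> m i j)"
proof -
  let ?g = "\<lambda>p. (\<iota> ! fst p, snd p)"
  have "(\<Sum>(n, j)\<in>m. weight G (\<iota> ! n) j) = (\<Sum>e\<in>edges G. \<Sum>p\<in>{p\<in>m. ?g p = e}. weight G (\<iota> ! fst p) (snd p))"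
    using word_matchingD[OF assms] by (subst sum.group) (auto simp: split_beta')
  also have "\<dots> = (\<Sum>e\<in>edges G. weight G (fst e) (snd e) * usage \<iota> m (fst e) (snd e))"
  proof (intro sum.cong refl)
    fix e
    have "(\<Sum>p\<in>{p\<in>m. ?g p = e}. weight G (\<iota> ! fst p) (snd p)) = (\<Sum>p\<in>{p\<in>m. ?g p = e}. weight G (fst e) (snd e))"
      by (intro sum.cong refl) auto
    moreover have "{p\<in>m. ?g p = e} = {p\<in>m. \<iota> ! fst p = fst e \<and> snd p = snd e}"
      by auto
    ultimately show "(\<Sum>p\<in>{p\<in>m. ?g p = e}. weight G (\<iota> ! fst p) (snd p)) = weight G (fst e) (snd e) * usage \<iota> m (fst e) (snd e)"
      by (simp add: usage_def)
  qed
  finally show ?thesis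
    by (simp add: split_beta')
qed

lemma sum_usage_online_le:
  assumes m: "word_matching \<iota> m"
  shows "(\<Sum>j\<in>off_nbrs G i. usage \<iota> m i j) \<le> real (count_list \<iota> i)"
proof -
  note fin = word_matchingD(1)[OF m]
  have "(\<Sum>j\<in>off_nbrs G i. usage \<iota> m i j) = real (\<Sum>j\<in>off_nbrs G i. card {p\<in>m. \<iota> ! fst p = i \<and> snd p = j})"
    by (simp add: usage_def)
  also have "(\<Sum>j\<in>off_nbrs G i. card {p\<in>m. \<iota> ! fst p = i \<and> snd p = j}) = card (\<Union>j\<in>off_nbrs G i. {p\<in>m. \<iota> ! fst p = i \<and> snd p = j})"
    using fin by (subst card_UN_disjoint) auto
  also have "\<dots> = card (fst ` (\<Union>j\<in>off_nbrs G i. {p\<in>m. \<iota> ! fst p = i \<and> snd p = j}))"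
    using word_matchingD(2)[OF m] by (intro card_image[symmetric]) (auto elim: inj_on_subset)
  also have "\<dots> \<le> card {k. k < length \<iota> \<and> i = \<iota> ! k}"
    using word_matchingD(4)[OF m] by (intro card_mono) auto
  also have "\<dots> = count_list \<iota> i"
    by (simp add: count_list_eq_length_filter length_filter_conv_card)
  finally show ?thesis by simp
qed

text \<open>\<open>j\<close> is matched at most once, and by a vertex with type in \<open>S\<close>
  only if such a type has arrived. The probability of that event is
  \<open>1 - exp (- (\<Sum>i\<in>S. rate G i))\<close>, the right-hand side of the LP
  constraint.\<close>

lemma sum_usage_offline_le:
  assumes m: "word_matching \<iota> m" and S: "finite S"
  shows "(\<Sum>i\<in>S. usage \<iota> m i j) \<le> of_bool (set \<iota> \<inter> S \<noteq> {})"
proof -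
  note fin = word_matchingD(1)[OF m]
  let ?A = "\<Union>i\<in>S. {p\<in>m. \<iota> ! fst p = i \<and> snd p = j}"
  have "(\<Sum>i\<in>S. usage \<iota> m i j) = real (card ?A)"
    unfolding usage_def of_nat_sum[symmetric] using fin S by (subst card_UN_disjoint) auto
  moreover have "card ?A \<le> 1"
  proof -
    have "finite ?A"
      using fin S by auto
    moreover have "\<forall>p\<in>?A. \<forall>p'\<in>?A. p = p'"
      using inj_onD[OF word_matchingD(3)[OF m]] by fastforce
    ultimately show ?thesis
      using card_le_Suc0_iff_eq[of ?A] by simp
  qed
  moreover have "card ?A = 0" if "set \<iota> \<inter> S = {}"
  proof -
    have "?A = {}"
      using that word_matchingD(4)[OF m] nth_mem by fastforce
    then show ?thesis by (simp only: card.empty)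
  qed
  ultimately show ?thesis
    by (auto simp: of_bool_def)
qed

text \<open>Each of the \<open>Suc n\<close> positions contributes
  \<open>rate G i * total_rate ^ n\<close>. After division by \<open>fact (Suc n)\<close> the factor
  \<open>Suc n\<close> cancels, which leaves an exponential series again.\<close>

lemma sum_word_rate_count:
  assumes "i \<in> online G"
  shows "(\<Sum>\<iota>\<in>words (Suc n). word_rate \<iota> * real (count_list \<iota> i)) = real (Suc n) * rate G i * total_rate ^ n"
proof (induction n)
  case 0
  have "(\<Sum>k\<in>online G. rate G k * of_bool (k = i)) = rate G i"
    using assms by (simp add: of_bool_def if_distrib cong: if_cong)
  then show ?case
    by (simp add: sum_words_Suc word_rate_def of_bool_def if_distrib cong: if_cong)
next
  case (Suc n)
  have "(\<Sum>\<iota>\<in>words (Suc (Suc n)). word_rate \<iota> * real (count_list \<iota> i)) =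
     (\<Sum>k\<in>online G. rate G k * (\<Sum>\<iota>\<in>words (Suc n). word_rate \<iota> * real (count_list \<iota> i)) +
        rate G k * of_bool (k = i) * (\<Sum>\<iota>\<in>words (Suc n). word_rate \<iota>))"
    unfolding sum_words_Suc[of _ "Suc n"] sum_distrib_left sum.distrib[symmetric]
    by (intro sum.cong refl) (auto simp: word_rate_def algebra_simps)
  also have "\<dots> = total_rate * (\<Sum>\<iota>\<in>words (Suc n). word_rate \<iota> * real (count_list \<iota> i)) +
      (\<Sum>k\<in>online G. rate G k * of_bool (k = i)) * total_rate ^ Suc n"
    by (simp only: sum.distrib sum_distrib_right[symmetric] sum_word_rate total_rate_def[symmetric])
  also have "(\<Sum>k\<in>online G. rate G k * of_bool (k = i)) = rate G i"
    using assms by (simp add: of_bool_def if_distrib cong: if_cong)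
  finally show ?case
    unfolding Suc by (simp add: algebra_simps)
qed

lemma sum_word_rate_avoid:
  "(\<Sum>\<iota>\<in>words n. word_rate \<iota> * of_bool (set \<iota> \<inter> S = {})) = (\<Sum>i\<in>online G - S. rate G i) ^ n"
proof (induction n)
  case 0
  then show ?case by (simp add: word_rate_def)
next
  case (Suc n)
  have "(\<Sum>\<iota>\<in>words (Suc n). word_rate \<iota> * of_bool (set \<iota> \<inter> S = {})) =
     (\<Sum>k\<in>online G. rate G k * of_bool (k \<notin> S) * (\<Sum>\<iota>\<in>words n. word_rate \<iota> * of_bool (set \<iota> \<inter> S = {})))"
    unfolding sum_words_Suc sum_distrib_left
    by (intro sum.cong refl) (auto simp: word_rate_def)
  also have "\<dots> = (\<Sum>k\<in>online G. rate G k * of_bool (k \<notin> S)) * (\<Sum>i\<in>online G - S. rate G i) ^ n"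
    unfolding Suc by (simp only: sum_distrib_right)
  also have "(\<Sum>k\<in>online G. rate G k * of_bool (k \<notin> S)) = (\<Sum>i\<in>online G - S. rate G i)"
    by (intro sum.mono_neutral_cong_right) auto
  finally show ?case by simp
qed

text \<open>
  Expected usage of the edges by an offline algorithm that takes the matching \<open>M\<close> if there are fewer
  than \<open>N\<close> arrivals and nothing otherwise; the truncation keeps the sum finite.
\<close>

definition truncated_usage :: "('i list \<Rightarrow> (nat \<times> 'j) set) \<Rightarrow> nat \<Rightarrow> 'i \<Rightarrow> 'j \<Rightarrow> real" where
  "truncated_usage M N i j =
     exp (- total_rate) * (\<Sum>n<N. (\<Sum>\<iota>\<in>words n. word_rate \<iota> * usage \<iota> (M \<iota>) i j) / fact n)"

lemma truncated_usage_sum: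
  "(\<Sum>a\<in>A. truncated_usage M N (f a) (g a)) =
     exp (- total_rate) * (\<Sum>n<N. (\<Sum>\<iota>\<in>words n. word_rate \<iota> * (\<Sum>a\<in>A. usage \<iota> (M \<iota>) (f a) (g a))) / fact n)"
proof -
  have "(\<Sum>a\<in>A. truncated_usage M N (f a) (g a)) =
     exp (- total_rate) * (\<Sum>n<N. \<Sum>a\<in>A. (\<Sum>\<iota>\<in>words n. word_rate \<iota> * usage \<iota> (M \<iota>) (f a) (g a)) / fact n)"
    unfolding truncated_usage_def by (simp add: sum.swap[of _ A] flip: sum_distrib_left)
  also have "(\<lambda>n. \<Sum>a\<in>A. (\<Sum>\<iota>\<in>words n. word_rate \<iota> * usage \<iota> (M \<iota>) (f a) (g a)) / fact n) =
     (\<lambda>n. (\<Sum>\<iota>\<in>words n. word_rate \<iota> * (\<Sum>a\<in>A. usage \<iota> (M \<iota>) (f a) (g a))) / fact n)"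
  proof
    fix n
    show "(\<Sum>a\<in>A. (\<Sum>\<iota>\<in>words n. word_rate \<iota> * usage \<iota> (M \<iota>) (f a) (g a)) / fact n) =
        (\<Sum>\<iota>\<in>words n. word_rate \<iota> * (\<Sum>a\<in>A. usage \<iota> (M \<iota>) (f a) (g a))) / fact n"
      unfolding sum_divide_distrib[symmetric] by (subst sum.swap) (simp add: sum_distrib_left)
  qed
  finally show ?thesis .
qed

text \<open>The two families of constraints are expectations of the two counting bounds for a single
  matching. Truncation only drops nonnegative terms, also in the second family, where
  \<open>total_rate ^ n - (total_rate - L) ^ n\<close> is nonnegative.\<close>

lemma truncated_usage_feasible:
  assumes M: "\<And>\<iota>. word_matching \<iota> (M \<iota>)"
  shows "lp_feasible G (truncated_usage M (Suc N))"
  unfolding lp_feasible_def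
proof (intro conjI ballI allI impI)
  fix i assume i: "i \<in> online G"
  have "(\<Sum>j\<in>off_nbrs G i. truncated_usage M (Suc N) i j) \<le>
      exp (- total_rate) * (\<Sum>n<Suc N. (\<Sum>\<iota>\<in>words n. word_rate \<iota> * real (count_list \<iota> i)) / fact n)"
    unfolding truncated_usage_sum[of M "Suc N" "\<lambda>_. i" "\<lambda>j. j"]
    by (intro mult_left_mono sum_mono divide_right_mono sum_usage_online_le M) (auto intro: word_rate_nonneg)
  \<comment> \<open>The empty word contains no \<open>i\<close>; dropping it shifts the index by
    one, hence the cut at \<open>Suc N\<close>.\<close>
  also have "(\<Sum>n<Suc N. (\<Sum>\<iota>\<in>words n. word_rate \<iota> * real (count_list \<iota> i)) / fact n) =
      rate G i * (\<Sum>n<N. total_rate ^ n / fact n)"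
    unfolding sum.lessThan_Suc_shift sum_word_rate_count[OF i] sum_distrib_left
    by (simp del: of_nat_Suc)
  also have "\<dots> \<le> rate G i * exp total_rate"
    using rate_pos[OF i] total_rate_nonneg by (intro mult_left_mono sum_power_fact_le_exp) auto
  finally show "(\<Sum>j\<in>off_nbrs G i. truncated_usage M (Suc N) i j) \<le> rate G i"
    by (simp add: exp_minus field_simps)
next
  fix j S assume S: "S \<subseteq> on_nbrs G j"
  have finS: "finite S"
    using S by (rule finite_subset) auto
  have SI: "S \<subseteq> online G"
    using S on_nbrsD by blast
  define L where "L = (\<Sum>i\<in>S. rate G i)"
  have D: "(\<Sum>i\<in>online G - S. rate G i) = total_rate - L"
    unfolding total_rate_def L_def using SI by (simp add: sum_diff)
  have L: "0 \<le> L"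
    unfolding L_def using SI by (intro sum_nonneg less_imp_le rate_pos) auto
  have L': "0 \<le> total_rate - L"
    unfolding D[symmetric] by (intro sum_nonneg less_imp_le rate_pos) auto
  have W: "(\<Sum>\<iota>\<in>words n. word_rate \<iota> * of_bool (set \<iota> \<inter> S \<noteq> {})) = total_rate ^ n - (total_rate - L) ^ n" for n
  proof -
    have "(\<Sum>\<iota>\<in>words n. word_rate \<iota> * of_bool (set \<iota> \<inter> S \<noteq> {})) =
        (\<Sum>\<iota>\<in>words n. word_rate \<iota> - word_rate \<iota> * of_bool (set \<iota> \<inter> S = {}))"
      by (intro sum.cong refl) auto
    then show ?thesis
      by (simp add: sum_subtractf sum_word_rate sum_word_rate_avoid D)
  qed
  have "(\<Sum>i\<in>S. truncated_usage M (Suc N) i j) \<le>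
      exp (- total_rate) * (\<Sum>n<Suc N. (\<Sum>\<iota>\<in>words n. word_rate \<iota> * of_bool (set \<iota> \<inter> S \<noteq> {})) / fact n)"
    unfolding truncated_usage_sum[of M "Suc N" "\<lambda>i. i" "\<lambda>_. j"]
    by (intro mult_left_mono sum_mono divide_right_mono sum_usage_offline_le M finS) (auto intro: word_rate_nonneg)
  also have "\<dots> = exp (- total_rate) * (\<Sum>n<Suc N. (total_rate ^ n - (total_rate - L) ^ n) / fact n)"
    by (simp only: W)
  also have "\<dots> \<le>
      exp (- total_rate) * (exp total_rate - exp (total_rate - L))"
    using L L' by (intro mult_left_mono sum_power_diff_fact_le_exp_diff) auto
  also have "\<dots> = 1 - exp (- L)"
    by (simp add: right_diff_distrib flip: exp_add)
  finally show "(\<Sum>i\<in>S. truncated_usage M (Suc N) i j) \<le> 1 - exp (- (\<Sum>i\<in>S. rate G i))"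
    by (simp add: L_def)
next
  fix e assume "e \<in> edges G"
  then show "case e of (i, j) \<Rightarrow> 0 \<le> truncated_usage M (Suc N) i j"
    by (auto simp: truncated_usage_def usage_def intro!: mult_nonneg_nonneg sum_nonneg divide_nonneg_pos word_rate_nonneg
        simp del: sum.lessThan_Suc)
qed

lemma word_opt_nonneg: "0 \<le> word_opt \<iota>"
proof -
  obtain m where m: "word_matching \<iota> m" "word_opt \<iota> = (\<Sum>(n, j)\<in>m. weight G (\<iota> ! n) j)"
    using word_opt_attained by blast
  have "0 \<le> weight G (\<iota> ! n) j" if "(n, j) \<in> m" for n j
    using word_matchingD(5)[OF m(1) that] type_graph by (auto simp: type_graph_def intro: less_imp_le)
  then show ?thesis
    unfolding m(2) by (intro sum_nonneg) auto
qed

lemma truncated_opt_le: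
  assumes x: "lp_optimal G x"
  shows "exp (- total_rate) * (\<Sum>n<N. (\<Sum>\<iota>\<in>words n. word_rate \<iota> * word_opt \<iota>) / fact n) \<le> lp_value G x"
proof -
  obtain M where M: "\<And>\<iota>. word_matching \<iota> (M \<iota>)" "\<And>\<iota>. word_opt \<iota> = (\<Sum>(n, j)\<in>M \<iota>. weight G (\<iota> ! n) j)"
    using word_opt_attained by metis
  have opt: "word_opt \<iota> = (\<Sum>(i, j)\<in>edges G. weight G i j * usage \<iota> (M \<iota>) i j)" for \<iota>
    using M matching_value_eq_usage by simp
  \<comment> \<open>Passing to \<open>Suc N\<close>, the form in which feasibility is available,
    adds one nonnegative summand.\<close>
  have "exp (- total_rate) * (\<Sum>n<N. (\<Sum>\<iota>\<in>words n. word_rate \<iota> * word_opt \<iota>) / fact n) \<le>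
     exp (- total_rate) * (\<Sum>n<Suc N. (\<Sum>\<iota>\<in>words n. word_rate \<iota> * word_opt \<iota>) / fact n)"
    by (auto intro!: divide_nonneg_pos sum_nonneg mult_nonneg_nonneg word_rate_nonneg word_opt_nonneg)
  also have "\<dots> = lp_value G (truncated_usage M (Suc N))"
  proof -
    have "lp_value G (truncated_usage M (Suc N)) =
        (\<Sum>e\<in>edges G. exp (- total_rate) * (\<Sum>n<Suc N. (\<Sum>\<iota>\<in>words n. word_rate \<iota> *
           (weight G (fst e) (snd e) * usage \<iota> (M \<iota>) (fst e) (snd e))) / fact n))"
      unfolding lp_value_def truncated_usage_def
      by (intro sum.cong refl) (simp add: split_beta' sum_distrib_left sum_divide_distrib ac_simps del: sum.lessThan_Suc)
    also have "\<dots> = exp (- total_rate) * (\<Sum>n<Suc N. \<Sum>e\<in>edges G. (\<Sum>\<iota>\<in>words n. word_rate \<iota> *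
           (weight G (fst e) (snd e) * usage \<iota> (M \<iota>) (fst e) (snd e))) / fact n)"
      unfolding sum_distrib_left[symmetric] by (subst sum.swap) (rule refl)
    also have "\<dots> = exp (- total_rate) * (\<Sum>n<Suc N. (\<Sum>\<iota>\<in>words n. word_rate \<iota> * word_opt \<iota>) / fact n)"
    proof (intro arg_cong2[where f = "(*)"] sum.cong refl)
      fix n
      show "(\<Sum>e\<in>edges G. (\<Sum>\<iota>\<in>words n. word_rate \<iota> * (weight G (fst e) (snd e) * usage \<iota> (M \<iota>) (fst e) (snd e))) / fact n) =
          (\<Sum>\<iota>\<in>words n. word_rate \<iota> * word_opt \<iota>) / fact n"
        unfolding sum_divide_distrib[symmetric]
        by (subst sum.swap) (simp add: opt sum_distrib_left split_beta')
    qed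
    finally show ?thesis by simp
  qed
  also have "\<dots> \<le> lp_value G x"
    using x truncated_usage_feasible[of M N] M(1) by (auto simp: lp_optimal_def is_arg_max_def not_less)
  finally show ?thesis .
qed

lemma expected_opt_le_lp_value:
  assumes x: "lp_optimal G x"
  shows "expected_opt G \<le> ennreal (lp_value G x)"
proof -
  let ?F = "\<lambda>h. ennreal (word_opt (map snd h))"
  have opt: "opt G h = word_opt (map snd h)" for h :: "(real \<times> 'i) list"
    unfolding word_opt_def by (rule opt_cong) (simp add: o_def)
  have "expected_opt G = (\<integral>\<^sup>+ \<omega>. ?F (arrivals G \<omega>) \<partial>arrival_space G)"
    by (simp add: expected_opt_def opt)
  also have "\<dots> = ennreal (exp (- total_rate)) * (\<Sum>n. \<Sum>\<iota>\<in>words n. iterated ?F 0 [] \<iota>)"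
    by (rule nn_integral_arrivals) (rule history_measurable_type_fun)
  also have "(\<Sum>n. \<Sum>\<iota>\<in>words n. iterated ?F 0 [] \<iota>) = (\<Sum>n. ennreal ((\<Sum>\<iota>\<in>words n. word_rate \<iota> * word_opt \<iota>) / fact n))"
  proof (intro suminf_cong)
    fix n
    have "(\<Sum>\<iota>\<in>words n. iterated ?F 0 [] \<iota>) = (\<Sum>\<iota>\<in>words n. ennreal (word_rate \<iota> * word_opt \<iota> / fact n))"
    proof (intro sum.cong refl)
      fix \<iota> assume \<iota>: "\<iota> \<in> words n"
      have "iterated ?F 0 [] \<iota> = ennreal (word_rate \<iota>) * ennreal (1 / fact n) * ennreal (word_opt \<iota>)"
        using iterated_type_fun[of 0 \<iota> "\<lambda>w. ennreal (word_opt w)" "[]"] \<iota> by (simp add: words_def)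
      also have "\<dots> = ennreal (word_rate \<iota> * (1 / fact n) * word_opt \<iota>)"
        using word_rate_nonneg[OF \<iota>] word_opt_nonneg[of \<iota>] by (simp only: ennreal_mult ennreal_mult' divide_nonneg_pos zero_le_one fact_gt_zero mult_nonneg_nonneg)
      finally show "iterated ?F 0 [] \<iota> = ennreal (word_rate \<iota> * word_opt \<iota> / fact n)"
        by simp
    qed
    also have "\<dots> = ennreal (\<Sum>\<iota>\<in>words n. word_rate \<iota> * word_opt \<iota> / fact n)"
      by (intro sum_ennreal) (auto intro!: divide_nonneg_pos mult_nonneg_nonneg word_rate_nonneg word_opt_nonneg)
    finally show "(\<Sum>\<iota>\<in>words n. iterated ?F 0 [] \<iota>) = ennreal ((\<Sum>\<iota>\<in>words n. word_rate \<iota> * word_opt \<iota>) / fact n)"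
      by (simp add: sum_divide_distrib)
  qed
  also have "ennreal (exp (- total_rate)) * \<dots> =
      (SUP N. ennreal (exp (- total_rate)) * (\<Sum>n<N. ennreal ((\<Sum>\<iota>\<in>words n. word_rate \<iota> * word_opt \<iota>) / fact n)))"
    by (simp add: suminf_eq_SUP SUP_mult_left_ennreal)
  also have "\<dots> \<le> ennreal (lp_value G x)"
  proof (rule SUP_least)
    fix N
    have "(\<Sum>n<N. ennreal ((\<Sum>\<iota>\<in>words n. word_rate \<iota> * word_opt \<iota>) / fact n)) =
        ennreal (\<Sum>n<N. (\<Sum>\<iota>\<in>words n. word_rate \<iota> * word_opt \<iota>) / fact n)"
      by (intro sum_ennreal) (auto intro!: divide_nonneg_pos sum_nonneg mult_nonneg_nonneg word_rate_nonneg word_opt_nonneg)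
    then show "ennreal (exp (- total_rate)) * (\<Sum>n<N. ennreal ((\<Sum>\<iota>\<in>words n. word_rate \<iota> * word_opt \<iota>) / fact n)) \<le> ennreal (lp_value G x)"
      using ennreal_leI[OF truncated_opt_le[OF x, of N]] by (simp add: ennreal_mult')
  qed
  finally show ?thesis .
qed

end

section \<open>Subsolutions bound the expected objective\<close>

lemma finite_level_set:
  "finite {weight G (snd (h ! n)) j | n. n < length h \<and> A (take n h) (h ! n) = Some j}"
  by auto

lemma level_Nil [simp]: "level G A [] j = 0"
  by (simp add: level_def)

lemma level_nonneg: "0 \<le> level G A h j"
  unfolding level_def by (rule Max_ge) (auto simp: finite_level_set)

lemma level_snoc:
  "level G A (h @ [p]) j =
     (if A h p = Some j then max (level G A h j) (weight G (snd p) j) else level G A h j)"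
proof -
  let ?S = "{weight G (snd (h ! n)) j | n. n < length h \<and> A (take n h) (h ! n) = Some j}"
  define R where "R n w \<longleftrightarrow> A (take n (h @ [p])) ((h @ [p]) ! n) = Some j \<and> w = weight G (snd ((h @ [p]) ! n)) j" for n w
  have "{weight G (snd ((h @ [p]) ! n)) j | n. n < length (h @ [p]) \<and> A (take n (h @ [p])) ((h @ [p]) ! n) = Some j} =
      {w. \<exists>n<Suc (length h). R n w}"
    by (auto simp: R_def simp del: take_append)
  also have "\<dots> = {w. \<exists>n<length h. R n w} \<union> {w. R (length h) w}"
    by (auto simp: less_Suc_eq)
  also have "{w. \<exists>n<length h. R n w} = ?S"
    by (auto simp: R_def nth_append)
  also have "{w. R (length h) w} = (if A h p = Some j then {weight G (snd p) j} else {})"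
    by (auto simp: R_def)
  finally have "level G A (h @ [p]) j = Max (insert 0 (?S \<union> (if A h p = Some j then {weight G (snd p) j} else {})))"
    unfolding level_def by (simp only:)
  also have "\<dots> = (if A h p = Some j then Max (insert (weight G (snd p) j) (insert 0 ?S)) else Max (insert 0 ?S))"
    by (auto simp: insert_commute)
  also have "Max (insert (weight G (snd p) j) (insert 0 ?S)) = max (Max (insert 0 ?S)) (weight G (snd p) j)"
    by (subst Max_insert) (auto simp: max.commute)
  finally show ?thesis
    unfolding level_def .
qed

context type_graph_instance begin

lemma level_measurable:
  assumes A: "online_policy G A" and "set \<iota> \<subseteq> online G"
  shows "(\<lambda>\<tau>. level G A (stamp \<tau> \<iota>) j) \<in> borel_measurable (\<Pi>\<^sub>M k\<in>UNIV. borel)"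
  using assms(2)
proof (induction \<iota> rule: rev_induct)
  case Nil
  then show ?case by (simp add: stamp_def)
next
  case (snoc i \<iota>)
  let ?M = "\<Pi>\<^sub>M k\<in>(UNIV :: nat set). (borel :: real measure)"
  let ?n = "length \<iota>"
  let ?w = "\<lambda>k. (\<iota> @ [i]) ! k"
  have "\<forall>k\<le>?n. ?w k \<in> online G"
    using snoc.prems by (auto simp: nth_append subset_iff)
  then have "(\<lambda>\<tau>. A (map (\<lambda>k. (\<tau> k, ?w k)) [0..<?n]) (\<tau> ?n, ?w ?n)) \<in> (\<Pi>\<^sub>M k\<in>{..?n}. borel) \<rightarrow>\<^sub>M count_space UNIV"
    using A unfolding online_policy_def by blast
  \<comment> \<open>\<open>online_policy\<close> speaks about the first \<open>?n + 1\<close>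
    coordinates only; restriction transports its measurability to full sequences.\<close>
  from measurable_compose[OF measurable_restrict_subset[OF subset_UNIV] this]
  have "(\<lambda>\<tau>. A (map (\<lambda>k. (restrict \<tau> {..?n} k, ?w k)) [0..<?n]) (restrict \<tau> {..?n} ?n, ?w ?n)) \<in> ?M \<rightarrow>\<^sub>M count_space UNIV" .
  also have "(\<lambda>\<tau>. A (map (\<lambda>k. (restrict \<tau> {..?n} k, ?w k)) [0..<?n]) (restrict \<tau> {..?n} ?n, ?w ?n)) =
      (\<lambda>\<tau>. A (stamp \<tau> \<iota>) (\<tau> ?n, i))"
  proof
    fix \<tau> :: "nat \<Rightarrow> real"
    have "map (\<lambda>k. (restrict \<tau> {..?n} k, ?w k)) [0..<?n] = stamp \<tau> \<iota>"
      by (auto simp: stamp_def nth_append)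
    then show "A (map (\<lambda>k. (restrict \<tau> {..?n} k, ?w k)) [0..<?n]) (restrict \<tau> {..?n} ?n, ?w ?n) = A (stamp \<tau> \<iota>) (\<tau> ?n, i)"
      by simp
  qed
  finally have *: "(\<lambda>\<tau>. A (stamp \<tau> \<iota>) (\<tau> ?n, i)) \<in> ?M \<rightarrow>\<^sub>M count_space UNIV" .
  have [measurable]: "Measurable.pred ?M (\<lambda>\<tau>. A (stamp \<tau> \<iota>) (\<tau> ?n, i) = Some j)"
    using measurable_sets[OF *, of "{Some j}"] by (simp add: pred_def vimage_def Int_def conj_commute)
  have [measurable]: "(\<lambda>\<tau>. level G A (stamp \<tau> \<iota>) j) \<in> borel_measurable ?M"
    using snoc by simp
  have st: "stamp \<tau> (\<iota> @ [i]) = stamp \<tau> \<iota> @ [(\<tau> ?n, i)]" for \<tau>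
    by (simp add: stamp_snoc)
  show ?case
    unfolding st level_snoc snd_conv by measurable
qed

lemma objective_measurable:
  assumes "online_policy G A"
  shows "history_measurable (\<lambda>h. ennreal (objective G A h))"
  unfolding history_measurable_def objective_def
  using level_measurable[OF assms] by auto

text \<open>Up to the factor \<open>exp (- total_rate * (1 - t))\<close>, this is the contribution
  to the expectation of exactly \<open>n\<close> further arrivals after time \<open>t\<close>, given
  the history \<open>h\<close>.\<close>

definition layer :: "((real \<times> 'i) list \<Rightarrow> ennreal) \<Rightarrow> nat \<Rightarrow> real \<Rightarrow> (real \<times> 'i) list \<Rightarrow> ennreal" where
  "layer F n t h = (\<Sum>\<iota>\<in>words n. iterated F t h \<iota>)"

lemma layer_0 [simp]: "layer F 0 t h = F h"
  by (simp add: layer_def)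

lemma layer_snoc_measurable:
  assumes "history_measurable F" "set (map snd h) \<subseteq> online G" "i \<in> online G"
  shows "(\<lambda>s. layer F n s (h @ [(s, i)])) \<in> borel_measurable borel"
  unfolding layer_def using assms
  by (intro borel_measurable_sum iterated_snoc_measurable) (auto simp: words_def)

lemma layer_Suc:
  assumes F: "history_measurable F" "set (map snd h) \<subseteq> online G"
  shows "layer F (Suc n) t h =
    (\<Sum>i\<in>online G. \<integral>\<^sup>+ s. ennreal (rate G i) * indicator {t<..1} s * layer F n s (h @ [(s, i)]) \<partial>lborel)"
  unfolding layer_def sum_words_Suc
proof (intro sum.cong refl)
  fix i assume i: "i \<in> online G"
  have "(\<lambda>s. iterated F s (h @ [(s, i)]) \<iota>) \<in> borel_measurable borel" if "\<iota> \<in> words n" for \<iota>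
    using F i that by (intro iterated_snoc_measurable) (auto simp: words_def)
  then show "(\<Sum>\<iota>\<in>words n. iterated F t h (i # \<iota>)) =
      (\<integral>\<^sup>+ s. ennreal (rate G i) * indicator {t<..1} s * (\<Sum>\<iota>\<in>words n. iterated F s (h @ [(s, i)]) \<iota>) \<partial>lborel)"
    by (simp add: sum_distrib_left nn_integral_sum)
qed

definition layers :: "((real \<times> 'i) list \<Rightarrow> ennreal) \<Rightarrow> nat \<Rightarrow> real \<Rightarrow> (real \<times> 'i) list \<Rightarrow> ennreal" where
  "layers F N t h = (\<Sum>n<N. layer F n t h)"

lemma layers_snoc_measurable:
  assumes "history_measurable F" "set (map snd h) \<subseteq> online G" "i \<in> online G"
  shows "(\<lambda>s. layers F N s (h @ [(s, i)])) \<in> borel_measurable borel"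
  unfolding layers_def using assms by (intro borel_measurable_sum layer_snoc_measurable)

lemma layers_Suc:
  assumes F: "history_measurable F" "set (map snd h) \<subseteq> online G"
  shows "layers F (Suc N) t h = F h +
    (\<Sum>i\<in>online G. \<integral>\<^sup>+ s. ennreal (rate G i) * indicator {t<..1} s * layers F N s (h @ [(s, i)]) \<partial>lborel)"
proof -
  have "layers F (Suc N) t h = F h + (\<Sum>i\<in>online G. \<Sum>n<N. \<integral>\<^sup>+ s. ennreal (rate G i) * indicator {t<..1} s * layer F n s (h @ [(s, i)]) \<partial>lborel)"
    unfolding layers_def sum.lessThan_Suc_shift layer_0 layer_Suc[OF F] by (subst sum.swap) (rule refl)
  also have "\<dots> = F h + (\<Sum>i\<in>online G. \<integral>\<^sup>+ s. ennreal (rate G i) * indicator {t<..1} s * layers F N s (h @ [(s, i)]) \<partial>lborel)"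
  proof (intro arg_cong2[where f = "(+)"] sum.cong refl)
    fix i assume "i \<in> online G"
    then show "(\<Sum>n<N. \<integral>\<^sup>+ s. ennreal (rate G i) * indicator {t<..1} s * layer F n s (h @ [(s, i)]) \<partial>lborel) =
        (\<integral>\<^sup>+ s. ennreal (rate G i) * indicator {t<..1} s * layers F N s (h @ [(s, i)]) \<partial>lborel)"
      using layer_snoc_measurable[OF F]
      by (subst nn_integral_sum[symmetric]) (auto simp: layers_def sum_distrib_left)
  qed
  finally show ?thesis .
qed

text \<open>
  \<open>\<Phi>\<close> is a subsolution of the integral equation \<open>V(t, h) = F(h) + (\<Sum>i. \<integral> rate i * V(s, h @ [(s, i)]) ds)\<close>,
  which the sum of all layers solves; iterating \<open>N\<close> times leaves an error of order \<open>1 / N!\<close>.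
\<close>

lemma subsolution_le_layers:
  fixes \<Phi> :: "real \<Rightarrow> (real \<times> 'i) list \<Rightarrow> real"
  assumes F: "history_measurable F"
    and C: "0 \<le> C" "\<And>t h. t \<in> {0..1} \<Longrightarrow> set (map snd h) \<subseteq> online G \<Longrightarrow> \<Phi> t h \<le> C"
    and final: "\<And>h. set (map snd h) \<subseteq> online G \<Longrightarrow> ennreal (\<Phi> 1 h) \<le> F h"
    and deriv: "\<And>t h. t \<in> {0..1} \<Longrightarrow> set (map snd h) \<subseteq> online G \<Longrightarrow>
       ((\<lambda>t. \<Phi> t h) has_real_derivative - \<phi> t h) (at t)"
    and cont: "\<And>t h. t \<in> {0..1} \<Longrightarrow> set (map snd h) \<subseteq> online G \<Longrightarrow> isCont (\<lambda>t. \<phi> t h) t"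
    and drift: "\<And>t h. t \<in> {0..1} \<Longrightarrow> set (map snd h) \<subseteq> online G \<Longrightarrow>
       \<phi> t h \<le> (\<Sum>i\<in>online G. rate G i * \<Phi> t (h @ [(t, i)]))"
    and th: "t \<in> {0..1}" "set (map snd h) \<subseteq> online G"
  shows "ennreal (\<Phi> t h) \<le> layers F N t h + ennreal (C * (total_rate ^ N * ((1 - t) ^ N / fact N)))"
  using th
proof (induction N arbitrary: t h)
  case 0
  then show ?case
    using C by (simp add: layers_def ennreal_leI)
next
  case (Suc N)
  note t = Suc.prems(1) and h = Suc.prems(2)
  let ?R = "\<lambda>s. C * (total_rate ^ N * ((1 - s) ^ N / fact N))"
  have FTC: "has_bochner_integral lborel (\<lambda>s. - \<phi> s h * indicator {t..1} s) (\<Phi> 1 h - \<Phi> t h)"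
    using t h by (intro has_bochner_integral_FTC_Icc_real deriv continuous_intros cont) auto
  then have int: "integrable lborel (\<lambda>s. \<phi> s h * indicator {t..1} s)"
    using has_bochner_integral_minus[OF FTC] by (auto simp: has_bochner_integral_iff)
  have eq: "(LINT s|lborel. \<phi> s h * indicator {t..1} s) = \<Phi> t h - \<Phi> 1 h"
    using has_bochner_integral_minus[OF FTC] by (auto simp: has_bochner_integral_iff)
  \<comment> \<open>\<open>\<phi>\<close> may be negative while \<open>ennreal\<close> cuts at 0.
    The cut only enlarges the integral, so one inequality survives.\<close>
  have "ennreal (\<Phi> t h - \<Phi> 1 h) \<le> (\<integral>\<^sup>+ s. ennreal (\<phi> s h * indicator {t..1} s) \<partial>lborel)"
  proof -
    let ?I = "\<integral>\<^sup>+ s. ennreal (\<phi> s h * indicator {t..1} s) \<partial>lborel"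
    have "\<Phi> t h - \<Phi> 1 h \<le> enn2real ?I"
      unfolding eq[symmetric] real_lebesgue_integral_def[OF int] by simp
    then have "ennreal (\<Phi> t h - \<Phi> 1 h) \<le> ennreal (enn2real ?I)"
      by (rule ennreal_leI)
    also have "\<dots> \<le> ?I"
      by (simp add: ennreal_enn2real_if)
    finally show ?thesis .
  qed
  also have "\<dots> \<le> (\<integral>\<^sup>+ s. indicator {t..1} s * (\<Sum>i\<in>online G. ennreal (rate G i) * (layers F N s (h @ [(s, i)]) + ennreal (?R s))) \<partial>lborel)"
  proof (intro nn_integral_mono)
    fix s
    show "ennreal (\<phi> s h * indicator {t..1} s) \<le> indicator {t..1} s * (\<Sum>i\<in>online G. ennreal (rate G i) * (layers F N s (h @ [(s, i)]) + ennreal (?R s)))"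
    proof (cases "s \<in> {t..1}")
      case True
      then have s: "s \<in> {0..1}"
        using t by auto
      have "ennreal (\<phi> s h) \<le> ennreal (\<Sum>i\<in>online G. rate G i * max 0 (\<Phi> s (h @ [(s, i)])))"
        using drift[OF s h] by (intro ennreal_leI) (auto intro!: order_trans[OF drift[OF s h]] sum_mono mult_left_mono less_imp_le[OF rate_pos])
      also have "\<dots> = (\<Sum>i\<in>online G. ennreal (rate G i * max 0 (\<Phi> s (h @ [(s, i)]))))"
        by (intro sum_ennreal[symmetric] mult_nonneg_nonneg less_imp_le[OF rate_pos]) auto
      also have "\<dots> = (\<Sum>i\<in>online G. ennreal (rate G i) * ennreal (\<Phi> s (h @ [(s, i)])))"
        by (intro sum.cong refl) (simp add: ennreal_mult' less_imp_le[OF rate_pos] ennreal_max_0)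
      \<comment> \<open>The induction hypothesis is applied pointwise in \<open>s\<close>, before
        integrating: from here on the integrals over the next arrival involve only
        \<open>layers\<close>, which is measurable.\<close>
      also have "\<dots> \<le> (\<Sum>i\<in>online G. ennreal (rate G i) * (layers F N s (h @ [(s, i)]) + ennreal (?R s)))"
        using s h by (intro sum_mono mult_left_mono Suc.IH) auto
      finally show ?thesis
        using True by simp
    qed simp
  qed
  also have "\<dots> = (\<integral>\<^sup>+ s. (\<Sum>i\<in>online G. ennreal (rate G i) * indicator {t<..1} s * layers F N s (h @ [(s, i)])) +
      ennreal (C * total_rate ^ Suc N) * (ennreal ((1 - s) ^ N / fact N) * indicator {t..1} s) \<partial>lborel)"
  proof (intro nn_integral_cong_AE, use AE_lborel_singleton[of t] in eventually_elim)
    fix s assume s: "s \<noteq> t"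
    show "indicator {t..1} s * (\<Sum>i\<in>online G. ennreal (rate G i) * (layers F N s (h @ [(s, i)]) + ennreal (?R s))) =
      (\<Sum>i\<in>online G. ennreal (rate G i) * indicator {t<..1} s * layers F N s (h @ [(s, i)])) +
      ennreal (C * total_rate ^ Suc N) * (ennreal ((1 - s) ^ N / fact N) * indicator {t..1} s)"
    proof (cases "s \<in> {t..1}")
      case True
      have "(\<Sum>i\<in>online G. ennreal (rate G i) * ennreal (?R s)) = ennreal total_rate * ennreal (?R s)"
        unfolding sum_distrib_right[symmetric] total_rate_def
        by (simp add: sum_ennreal less_imp_le[OF rate_pos])
      also have "\<dots> = ennreal (C * total_rate ^ Suc N) * ennreal ((1 - s) ^ N / fact N)"
        using True total_rate_nonneg C(1) by (simp add: ac_simps flip: ennreal_mult')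
      finally show ?thesis
        using True s by (simp add: distrib_left sum.distrib)
    qed (use s in auto)
  qed
  also have "\<dots> = (\<Sum>i\<in>online G. \<integral>\<^sup>+ s. ennreal (rate G i) * indicator {t<..1} s * layers F N s (h @ [(s, i)]) \<partial>lborel) +
      ennreal (C * (total_rate ^ Suc N * ((1 - t) ^ Suc N / fact (Suc N))))"
  proof -
    have [measurable]: "(\<lambda>s. layers F N s (h @ [(s, i)])) \<in> borel_measurable borel" if "i \<in> online G" for i
      using F h that by (rule layers_snoc_measurable)
    have "(\<integral>\<^sup>+ s. ennreal (C * total_rate ^ Suc N) * (ennreal ((1 - s) ^ N / fact N) * indicator {t..1} s) \<partial>lborel) =
        ennreal (C * total_rate ^ Suc N) * ennreal ((1 - t) ^ Suc N / fact (Suc N))"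
      using t by (subst nn_integral_cmult) (auto simp: nn_integral_power_fact simp del: power_Suc fact_Suc)
    also have "\<dots> = ennreal (C * (total_rate ^ Suc N * ((1 - t) ^ Suc N / fact (Suc N))))"
      using C(1) total_rate_nonneg by (subst ennreal_mult'[symmetric]) (simp_all add: mult.assoc del: power_Suc fact_Suc)
    finally show ?thesis
      by (subst nn_integral_add) (auto simp: nn_integral_sum simp del: power_Suc fact_Suc)
  qed
  finally have "ennreal (\<Phi> t h - \<Phi> 1 h) \<le>
     (\<Sum>i\<in>online G. \<integral>\<^sup>+ s. ennreal (rate G i) * indicator {t<..1} s * layers F N s (h @ [(s, i)]) \<partial>lborel) +
      ennreal (C * (total_rate ^ Suc N * ((1 - t) ^ Suc N / fact (Suc N))))" (is "_ \<le> ?S + ?E") .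
  have "ennreal (\<Phi> t h) \<le> ennreal (max 0 (\<Phi> 1 h) + max 0 (\<Phi> t h - \<Phi> 1 h))"
    by (intro ennreal_leI) auto
  also have "\<dots> = ennreal (\<Phi> 1 h) + ennreal (\<Phi> t h - \<Phi> 1 h)"
    by (subst ennreal_plus) (simp_all add: ennreal_max_0)
  also have "\<dots> \<le> F h + (?S + ?E)"
    by (intro add_mono final h) fact
  also have "\<dots> = layers F (Suc N) t h + ?E"
    unfolding layers_Suc[OF F h] by (simp only: add.assoc)
  finally show ?case .
qed

text \<open>At time 0 the error is \<open>C * total_rate ^ N / fact N\<close>, which tends to 0
  because the exponential series converges.\<close>

lemma subsolution_le_expectation:
  fixes \<Phi> :: "real \<Rightarrow> (real \<times> 'i) list \<Rightarrow> real"
  assumes F: "history_measurable F"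
    and "0 \<le> C" "\<And>t h. t \<in> {0..1} \<Longrightarrow> set (map snd h) \<subseteq> online G \<Longrightarrow> \<Phi> t h \<le> C"
    and "\<And>h. set (map snd h) \<subseteq> online G \<Longrightarrow> ennreal (\<Phi> 1 h) \<le> F h"
    and "\<And>t h. t \<in> {0..1} \<Longrightarrow> set (map snd h) \<subseteq> online G \<Longrightarrow>
       ((\<lambda>t. \<Phi> t h) has_real_derivative - \<phi> t h) (at t)"
    and "\<And>t h. t \<in> {0..1} \<Longrightarrow> set (map snd h) \<subseteq> online G \<Longrightarrow> isCont (\<lambda>t. \<phi> t h) t"
    and "\<And>t h. t \<in> {0..1} \<Longrightarrow> set (map snd h) \<subseteq> online G \<Longrightarrow>
       \<phi> t h \<le> (\<Sum>i\<in>online G. rate G i * \<Phi> t (h @ [(t, i)]))"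
  shows "ennreal (exp (- total_rate)) * ennreal (\<Phi> 0 []) \<le> (\<integral>\<^sup>+ \<omega>. F (arrivals G \<omega>) \<partial>arrival_space G)"
proof -
  let ?S = "\<Sum>n. layer F n 0 []"
  have "ennreal (\<Phi> 0 []) \<le> ?S + ennreal (C * (total_rate ^ N / fact N))" for N
  proof -
    have "ennreal (\<Phi> 0 []) \<le> layers F N 0 [] + ennreal (C * (total_rate ^ N * ((1 - 0) ^ N / fact N)))"
      by (rule subsolution_le_layers[where \<phi> = \<phi>]) (use assms in auto)
    also have "layers F N 0 [] \<le> ?S"
      unfolding layers_def by (rule sum_le_suminf) auto
    finally show ?thesis by simp
  qed
  moreover have "(\<lambda>N. ?S + ennreal (C * (total_rate ^ N / fact N))) \<longlonglongrightarrow> ?S + ennreal (C * 0)"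
  proof (intro tendsto_add tendsto_ennrealI tendsto_mult tendsto_const)
    show "(\<lambda>N. total_rate ^ N / fact N) \<longlonglongrightarrow> 0"
      using summable_LIMSEQ_zero[OF summable_exp[of total_rate]] by (simp add: divide_inverse mult.commute)
  qed
  ultimately have "ennreal (\<Phi> 0 []) \<le> ?S"
    using LIMSEQ_le_const[of _ "?S + ennreal (C * 0)" "ennreal (\<Phi> 0 [])"] by auto
  then show ?thesis
    unfolding nn_integral_arrivals[OF F] layer_def by (intro mult_left_mono) auto
qed

end

section \<open>The coefficient functions\<close>

lemma \<alpha>_fun_alt: "\<alpha>_fun t = 1 - 1 / (exp 1 * (1 - ln 2)) * (2 * exp 1) powr t
               + (1 + ln 2) * (1 / ((exp 1)\<^sup>2 * (1 - ln 2))) * exp (2 * t)"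
  by (simp add: \<alpha>_fun_def)

lemma \<beta>_fun_alt: "\<beta>_fun t = 1 / (exp 1 * (1 - ln 2)) / 2 * (2 * exp 1) powr t
               - 1 / ((exp 1)\<^sup>2 * (1 - ln 2)) * exp (2 * t)"
  by (simp add: \<beta>_fun_def)

lemma has_derivative_powr_2e:
  "((\<lambda>t. (2 * exp 1) powr t) has_real_derivative (1 + ln 2) * (2 * exp 1) powr t) (at t)"
  for t :: real
proof -
  have "ln (2 * exp (1::real)) = 1 + ln 2"
    by (simp add: ln_mult)
  then show ?thesis
    by (auto intro!: derivative_eq_intros)
qed

lemma DERIV_\<alpha>_fun: "(\<alpha>_fun has_real_derivative - 2 * (1 + ln 2) * \<beta>_fun t) (at t)"
proof -
  define c d where "c = 1 / (exp 1 * (1 - ln 2 :: real))" and "d = 1 / ((exp 1)\<^sup>2 * (1 - ln 2 :: real))"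
  define X where "X = (2 * exp (1::real)) powr t"
  have \<alpha>: "\<alpha>_fun = (\<lambda>t. 1 - c * (2 * exp 1) powr t + (1 + ln 2) * d * exp (2 * t))"
    and \<beta>: "\<beta>_fun t = c / 2 * X - d * exp (2 * t)"
    by (auto simp: \<alpha>_fun_alt[abs_def] \<beta>_fun_alt c_def d_def X_def)
  have "((\<lambda>t. 1 - c * (2 * exp 1) powr t + (1 + ln 2) * d * exp (2 * t)) has_real_derivative
           0 - c * ((1 + ln 2) * X) + (1 + ln 2) * d * (exp (2 * t) * 2)) (at t)"
    unfolding X_def by (rule derivative_eq_intros has_derivative_powr_2e refl)+ simp
  moreover have "0 - c * ((1 + ln 2) * X) + (1 + ln 2) * d * (exp (2 * t) * 2) =
      - 2 * (1 + ln 2) * (c / 2 * X - d * exp (2 * t))"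
    by (simp add: algebra_simps)
  ultimately show ?thesis
    unfolding \<alpha> \<beta> by simp
qed

lemma DERIV_\<beta>_fun: "(\<beta>_fun has_real_derivative \<alpha>_fun t + (3 + ln 2) * \<beta>_fun t - 1) (at t)"
proof -
  define c d where "c = 1 / (exp 1 * (1 - ln 2 :: real))" and "d = 1 / ((exp 1)\<^sup>2 * (1 - ln 2 :: real))"
  define X where "X = (2 * exp (1::real)) powr t"
  have \<beta>: "\<beta>_fun = (\<lambda>t. c / 2 * (2 * exp 1) powr t - d * exp (2 * t))"
    and \<alpha>: "\<alpha>_fun t = 1 - c * X + (1 + ln 2) * d * exp (2 * t)"
    by (auto simp: \<alpha>_fun_alt \<beta>_fun_alt[abs_def] c_def d_def X_def)
  have "((\<lambda>t. c / 2 * (2 * exp 1) powr t - d * exp (2 * t)) has_real_derivative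
           c / 2 * ((1 + ln 2) * X) - d * (exp (2 * t) * 2)) (at t)"
    unfolding X_def by (rule derivative_eq_intros has_derivative_powr_2e refl)+ simp
  moreover have "c / 2 * ((1 + ln 2) * X) - d * (exp (2 * t) * 2) =
      \<alpha>_fun t + (3 + ln 2) * (c / 2 * X - d * exp (2 * t)) - 1"
    unfolding \<alpha> by (simp add: algebra_simps)
  ultimately show ?thesis
    unfolding \<beta> X_def by simp
qed

lemma ln2_bounds: "0.69314 \<le> ln (2::real)" "ln (2::real) \<le> 0.69315"
  using ln_approx_bounds[of 2 5] by (auto simp: eval_nat_numeral)

lemma ln2_less_1: "ln 2 < (1::real)"
  using ln_less_self[of 2] ln_2_less_1 by simp

lemma \<alpha>_\<beta>_fun_1: "\<alpha>_fun 1 = 0" "\<beta>_fun 1 = 0"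
proof -
  have "exp 2 = (exp (1::real))\<^sup>2"
    by (simp flip: exp_double)
  moreover have "1 - ln (2::real) \<noteq> 0"
    using ln2_less_1 by simp
  ultimately show "\<alpha>_fun 1 = 0" "\<beta>_fun 1 = 0"
    by (auto simp: \<alpha>_fun_def \<beta>_fun_def divide_simps)
qed

text \<open>The terms with \<open>(2 * exp 1) powr t\<close> cancel. The weights 1 and 2 are those
  of the losses: a match costs at most its gain in the fractional part and at most twice its gain in
  the sampled part.\<close>

lemma \<alpha>_plus_2_\<beta>_fun: "\<alpha>_fun t + 2 * \<beta>_fun t = 1 - exp (2 * t - 2)"
proof -
  define c d where "c = 1 / (exp 1 * (1 - ln 2 :: real))" and "d = 1 / ((exp 1)\<^sup>2 * (1 - ln 2 :: real))"
  have *: "exp (2 * t - 2) = exp (2 * t) / (exp 1)\<^sup>2"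
    by (simp add: exp_diff flip: exp_double)
  have "\<alpha>_fun t + 2 * \<beta>_fun t = 1 - (1 - ln 2) * d * exp (2 * t)"
    unfolding \<alpha>_fun_alt \<beta>_fun_alt c_def[symmetric] d_def[symmetric]
    by (simp add: algebra_simps)
  also have "\<dots> = 1 - exp (2 * t - 2)"
    using ln2_less_1 by (simp add: * d_def)
  finally show ?thesis .
qed

text \<open>Divide both exponentials by their values at 1. The exponents then both vanish at t = 1,
  and before that the one with slope 2 lies below the one with slope 1 + ln 2.\<close>

lemma \<beta>_fun_nonneg:
  assumes "t \<le> 1"
  shows "\<beta>_fun t \<ge> 0"
proof -
  have 1: "(2 * exp 1) powr t = exp ((1 + ln 2) * t)"
    by (simp add: powr_def ln_mult algebra_simps)
  have "exp (2 * t) / exp 2 \<le> exp ((1 + ln 2) * t) / exp (1 + ln 2)"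
  proof -
    have "(1 - ln 2) * (t - 1) \<le> 0"
      using assms ln2_less_1 by (intro mult_nonneg_nonpos) auto
    then have "2 * t - 2 \<le> (1 + ln 2) * t - (1 + ln 2)"
      by (simp add: algebra_simps)
    then show ?thesis
      by (simp flip: exp_diff)
  qed
  then have "exp (2 * t) / exp 2 \<le> (2 * exp 1) powr t / (2 * exp 1)"
    by (simp only: 1 exp_add) (simp add: mult.commute)
  moreover have "\<beta>_fun t = ((2 * exp 1) powr t / (2 * exp 1) - exp (2 * t) / exp 2) / (1 - ln 2)"
    by (simp add: \<beta>_fun_def diff_divide_distrib flip: exp_double)
  ultimately show ?thesis
    using ln2_less_1 by simp
qed

text \<open>The derivative is a negative multiple of \<beta>, so \<alpha> decreases to its value 0
  at t = 1.\<close>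

lemma \<alpha>_fun_nonneg:
  assumes "t \<le> 1"
  shows "\<alpha>_fun t \<ge> 0"
proof -
  have "\<alpha>_fun 1 \<le> \<alpha>_fun t"
  proof (rule DERIV_nonpos_imp_nonincreasing[OF assms])
    fix s :: real assume "t \<le> s" "s \<le> 1"
    then show "\<exists>y. (\<alpha>_fun has_real_derivative y) (at s) \<and> y \<le> 0"
      using \<beta>_fun_nonneg[of s] ln2_bounds
      by (intro exI[of _ "- 2 * (1 + ln 2) * \<beta>_fun s"] conjI DERIV_\<alpha>_fun)
         (auto intro!: mult_nonpos_nonneg)
  qed
  then show ?thesis by (simp add: \<alpha>_\<beta>_fun_1)
qed

lemma e_bounds: "2.71828 \<le> exp (1::real)" "exp (1::real) \<le> 2.71829"
proof -
  obtain t :: real where t: "\<bar>t\<bar> \<le> \<bar>1\<bar>" "exp (1::real) = (\<Sum>m<10. 1 ^ m / fact m) + exp t / fact 10 * 1 ^ 10"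
    using Maclaurin_exp_le[of 1 10] by blast
  have "exp t \<le> exp 1"
    using t(1) by simp
  \<comment> \<open>The remainder is thus at most 3 / 10!, below 10^(-6).\<close>
  then have "exp t \<le> 3"
    using exp_le by linarith
  moreover define r where "r = exp t"
  ultimately have "0 \<le> r" "r \<le> 3" and e: "exp (1::real) = (\<Sum>m<10. 1 ^ m / fact m) + r / fact 10 * 1 ^ 10"
    using t(2) by auto
  then show "2.71828 \<le> exp (1::real)" "exp (1::real) \<le> 2.71829"
    unfolding e by (simp_all add: eval_nat_numeral)
qed

text \<open>The exact value is 1 - (e/2 - ln 2) / (e^2 (1 - ln 2)), about 0.7063, so the five-digit
  bounds on e and ln 2 leave enough room.\<close>

lemma \<alpha>_plus_\<beta>_fun_0_ge: "\<alpha>_fun 0 + \<beta>_fun 0 \<ge> 0.706"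
proof -
  define e where "e = exp (1::real)"
  define L where "L = ln (2::real)"
  have e: "2.71828 \<le> e" "e \<le> 2.71829" and L: "0.69314 \<le> L" "L \<le> 0.69315"
    using e_bounds ln2_bounds by (auto simp: e_def L_def)
  have pos: "0 < e" "0 < 1 - L"
    using e L by auto
  define d where "d = 1 / (e\<^sup>2 * (1 - L))"
  have d: "1 / (e * (1 - L)) = e * d"
    using pos by (simp add: d_def power2_eq_square)
  have "\<alpha>_fun 0 + \<beta>_fun 0 = 1 - (e / 2 - L) * d"
    using pos unfolding \<alpha>_fun_alt \<beta>_fun_alt e_def[symmetric] L_def[symmetric] d d_def[symmetric]
    by (simp add: algebra_simps)
  moreover have "(e / 2 - L) * d \<le> 0.294"
  proof -
    have "e / 2 - L \<le> 2.71829 / 2 - 0.69314"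
      using e L by simp
    also have "\<dots> \<le> 0.294 * (2.71828\<^sup>2 * (1 - 0.69315))"
      by (simp add: power2_eq_square)
    also have "\<dots> \<le> 0.294 * (e\<^sup>2 * (1 - L))"
      using e L by (intro mult_left_mono mult_mono power_mono) auto
    finally show ?thesis
      using pos by (simp add: d_def pos_divide_le_eq)
  qed
  ultimately show ?thesis by simp
qed

section \<open>Splitting and marginals\<close>

lemma p_fun_0 [simp]: "p_fun 0 = 0"
  by (simp add: p_fun_def)

text \<open>\<open>p_fun\<close> is concave, so for given \<open>s\<close> the marginal is smallest
  at \<rho> = 1, where it equals \<open>max (2 * s - 1) 0\<close>. Slope 2 and cap 1 give the upper
  bound.\<close>

lemma p_fun_marginal_bounds:
  assumes "0 \<le> s" "s \<le> \<rho>" "\<rho> \<le> 1"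
  shows "max (2 * s - 1) 0 \<le> p_fun \<rho> - p_fun (\<rho> - s)" "p_fun \<rho> - p_fun (\<rho> - s) \<le> min (2 * s) 1"
  using assms by (auto simp: p_fun_def)

text \<open>Elements are inserted in order of decreasing \<open>g\<close>, and each receives the
  increment of \<open>p_fun\<close> at the partial sum; the increments telescope. A threshold set
  that contains the last element is the whole set, so one \<open>q\<close> serves all thresholds at
  once.\<close>

lemma half_greedy_fractions:
  fixes r g :: "'b \<Rightarrow> real"
  assumes "finite J" "\<And>j. j \<in> J \<Longrightarrow> 0 \<le> r j"
  shows "\<exists>q. (\<forall>j\<in>J. 0 \<le> q j \<and> q j \<le> min (2 * r j) 1) \<and>
             (\<forall>w. (\<Sum>j\<in>{j\<in>J. w \<le> g j}. q j) = p_fun (\<Sum>j\<in>{j\<in>J. w \<le> g j}. r j))"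
  using assms
proof (induction J rule: finite_ranking_induct[where f = "\<lambda>j. - g j"])
  case empty
  then show ?case by simp
next
  case (insert x S)
  show ?case
  proof (cases "x \<in> S")
    case True
    then show ?thesis using insert by (simp add: insert_absorb)
  next
    case False
    have "\<exists>q. (\<forall>j\<in>S. 0 \<le> q j \<and> q j \<le> min (2 * r j) 1) \<and>
             (\<forall>w. (\<Sum>j\<in>{j\<in>S. w \<le> g j}. q j) = p_fun (\<Sum>j\<in>{j\<in>S. w \<le> g j}. r j))"
      by (rule insert.IH) (simp add: insert.prems)
    then obtain q where
      q: "\<And>j. j \<in> S \<Longrightarrow> 0 \<le> q j \<and> q j \<le> min (2 * r j) 1"
        "\<And>w. (\<Sum>j\<in>{j\<in>S. w \<le> g j}. q j) = p_fun (\<Sum>j\<in>{j\<in>S. w \<le> g j}. r j)"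
      by blast
    define R where "R = sum r S"
    have S: "{j\<in>S. w \<le> g j} = S" if "w \<le> g x" for w
      using insert.hyps(2) that by force
    have sumq: "sum q S = p_fun R"
      using q(2)[of "g x"] S[of "g x"] by (simp add: R_def)
    have nn: "0 \<le> R" "0 \<le> r x"
      using insert.prems by (auto simp: R_def intro!: sum_nonneg)
    define q' where "q' = q(x := p_fun (r x + R) - p_fun R)"
    have q'S: "sum q' A = sum q A" if "A \<subseteq> S" for A
      using False that by (intro sum.cong) (auto simp: q'_def)
    have "0 \<le> q' j \<and> q' j \<le> min (2 * r j) 1" if "j \<in> insert x S" for j
    proof (cases "j = x")
      case True
      then show ?thesis using nn by (auto simp: q'_def p_fun_def)
    next
      case False
      then show ?thesis using q(1)[of j] that by (auto simp: q'_def)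
    qed
    moreover have "(\<Sum>j\<in>{j\<in>insert x S. w \<le> g j}. q' j) = p_fun (\<Sum>j\<in>{j\<in>insert x S. w \<le> g j}. r j)" for w
    proof (cases "w \<le> g x")
      case True
      then have "{j\<in>insert x S. w \<le> g j} = insert x S"
        using S[of w] by auto
      then show ?thesis
        using False insert.hyps(1) q'S[of S] by (simp add: sumq) (simp add: q'_def R_def)
    next
      case False
      then have "{j\<in>insert x S. w \<le> g j} = {j\<in>S. w \<le> g j}"
        by auto
      then show ?thesis
        using q(2)[of w] q'S[of "{j\<in>S. w \<le> g j}"] by auto
    qed
    ultimately show ?thesis by blast
  qed
qed

text \<open>Below the cap the marginals are \<open>2 * r j\<close> and the right side is
  \<open>2 * \<rho>\<close>. Beyond it, with \<open>c = 2 * \<rho> - 1\<close>, a summand can be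
  positive only if \<open>2 * r j > c\<close>, and then it is at most both
  \<open>2 * r j - c\<close> and \<open>1 - c\<close>. One such element gives \<open>1 - c\<close>
  directly; two or more pay \<open>c\<close> at least twice, and
  \<open>2 * \<rho> - 2 * c = 1 - c\<close>.\<close>

lemma sum_p_fun_marginals_le:
  fixes r :: "'b \<Rightarrow> real"
  assumes "finite J" and r: "\<And>j. j \<in> J \<Longrightarrow> 0 \<le> r j" and "sum r J \<le> 1"
  defines "\<rho> \<equiv> sum r J"
  shows "(\<Sum>j\<in>J. p_fun \<rho> - p_fun (\<rho> - r j) - max (2 * r j - 1) 0) \<le> 2 * p_fun \<rho> - 2 * \<rho>"
proof (cases "2 * \<rho> \<le> 1")
  case True
  have "(\<Sum>j\<in>J. p_fun \<rho> - p_fun (\<rho> - r j) - max (2 * r j - 1) 0) \<le> (\<Sum>j\<in>J. 2 * r j)"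
    using True by (intro sum_mono) (auto simp: p_fun_def dest!: r)
  also have "\<dots> = 2 * \<rho>"
    by (simp add: \<rho>_def sum_distrib_left)
  finally show ?thesis
    using True by (simp add: p_fun_def)
next
  case False
  define c where "c = 2 * \<rho> - 1"
  have c: "0 < c" "c \<le> 1"
    using False assms by (auto simp: c_def \<rho>_def)
  define T where "T = {j\<in>J. c < 2 * r j}"
  define \<phi> where "\<phi> j = p_fun \<rho> - p_fun (\<rho> - r j) - max (2 * r j - 1) 0" for j
  have T: "T \<subseteq> J" "finite T"
    using \<open>finite J\<close> by (auto simp: T_def)
  have \<phi>0: "\<phi> j = 0" if "j \<in> J - T" for j
    using that c False by (auto simp: T_def \<phi>_def p_fun_def c_def min_def)
  have \<phi>: "\<phi> j \<le> 2 * r j - c" "\<phi> j \<le> 1 - c" if "j \<in> T" for j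
    using that c False by (auto simp: T_def \<phi>_def p_fun_def c_def min_def max_def)
  have eq: "sum \<phi> J = sum \<phi> T"
    using T \<phi>0 \<open>finite J\<close> by (intro sum.mono_neutral_right) auto
  have "sum \<phi> T \<le> 1 - c"
  proof (cases "2 \<le> card T")
    case True
    have "sum \<phi> T \<le> (\<Sum>j\<in>T. 2 * r j - c)"
      using \<phi> by (intro sum_mono) auto
    also have "\<dots> = 2 * sum r T - real (card T) * c"
      by (simp add: sum_subtractf sum_distrib_left)
    also have "\<dots> \<le> 2 * \<rho> - 2 * c"
    proof -
      have "sum r T \<le> \<rho>"
        unfolding \<rho>_def using T r \<open>finite J\<close> by (intro sum_mono2) auto
      moreover have "2 * c \<le> real (card T) * c"
        using True c by (intro mult_right_mono) auto
      ultimately show ?thesis by linarith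
    qed
    also have "\<dots> = 1 - c"
      by (simp add: c_def)
    finally show ?thesis .
  next
    case False
    then have "card T = 0 \<or> card T = 1"
      by linarith
    then consider "T = {}" | j where "T = {j}"
      using T by (auto simp: card_Suc_eq)
    then show ?thesis
      using c \<phi>(2) by cases auto
  qed
  also have "1 - c = 2 * p_fun \<rho> - 2 * \<rho>"
    using False by (simp add: c_def p_fun_def)
  finally show ?thesis
    using eq by (simp add: \<phi>_def)
qed

text \<open>Apply the hypothesis to the elements with positive excess: with y =
  \<open>sum l S'\<close> the sum is at most 2 (1 - e^(-y)) - y, which is maximal at y = ln 2. The
  tangent bound 1 + z \<le> e^z at z = ln 2 - y yields the maximum.\<close>

lemma excess_le_one_minus_ln2:
  fixes x l :: "'a \<Rightarrow> real"
  assumes "finite S" and x: "\<And>S'. S' \<subseteq> S \<Longrightarrow> sum x S' \<le> 1 - exp (- sum l S')"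
  shows "(\<Sum>i\<in>S. max (2 * x i - l i) 0) \<le> 1 - ln 2"
proof -
  define S' where "S' = {i\<in>S. l i < 2 * x i}"
  have "(\<Sum>i\<in>S. max (2 * x i - l i) 0) = (\<Sum>i\<in>S'. 2 * x i - l i)"
    using \<open>finite S\<close> by (intro sum.mono_neutral_cong_right) (auto simp: S'_def max_def)
  also have "\<dots> = 2 * sum x S' - sum l S'"
    by (simp add: sum_subtractf sum_distrib_left)
  also have "\<dots> \<le> 2 * (1 - exp (- sum l S')) - sum l S'"
    using x[of S'] by (auto simp: S'_def)
  also have "\<dots> \<le> 1 - ln 2"
  proof -
    have "1 + (ln 2 - sum l S') \<le> exp (ln 2 - sum l S')"
      by (rule exp_ge_add_one_self)
    also have "\<dots> = 2 * exp (- sum l S')"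
      by (simp add: exp_diff exp_minus field_simps)
    finally show ?thesis by simp
  qed
  finally show ?thesis .
qed

text \<open>Linearises a product. If \<open>D \<le> k\<close>, replacing \<open>D\<close> by
  \<open>k\<close> is enough. Otherwise \<open>Q\<close> has a positive coefficient after moving
  \<open>k * Q\<close> to the left and may be replaced by \<open>2 - E\<close>; the remaining
  difference \<open>(k - E) * (D - 2)\<close> is not positive.\<close>

lemma product_bound:
  fixes Q D E k :: real
  assumes "0 \<le> Q" "Q \<le> 2 - E" "E \<le> D" "D \<le> 2" "E \<le> k" "k \<le> 2"
  shows "Q * D \<le> k * Q + (2 - k) * (D - E)"
proof (cases "D \<le> k")
  case True
  have "Q * D \<le> Q * k" "0 \<le> (2 - k) * (D - E)"
    using assms True by (auto intro: mult_left_mono)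
  then show ?thesis by (simp add: mult.commute)
next
  case False
  have "Q * (D - k) \<le> (2 - E) * (D - k)"
    using assms False by (intro mult_right_mono) auto
  also have "\<dots> = (2 - k) * (D - E) + (k - E) * (D - 2)"
    by (simp add: algebra_simps)
  also have "\<dots> \<le> (2 - k) * (D - E)"
    using assms by (simp add: mult_nonneg_nonpos)
  finally show ?thesis by (simp add: algebra_simps)
qed

section \<open>Gains and losses\<close>

lemma integrable_bounded_support:
  fixes f :: "real \<Rightarrow> real"
  assumes "f \<in> borel_measurable lborel" "\<And>w. \<bar>f w\<bar> \<le> C * indicator {0..M} w"
  shows "integrable lborel f"
proof (rule Bochner_Integration.integrable_bound)
  show "integrable lborel (\<lambda>w. C * indicator {0..M} w :: real)"
    by (intro integrable_mult_right integrable_real_indicator) (auto simp: emeasure_lborel_Icc_eq)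
  show "AE w in lborel. norm (f w) \<le> norm (C * indicator {0..M} w :: real)"
    using assms(2) by (intro AE_I2) (metis abs_ge_self order_trans real_norm_def)
qed fact

lemma lborel_integral_reflect:
  fixes f :: "real \<Rightarrow> real"
  shows "(LINT w|lborel. f w) = (LINT u|lborel. f (g - u))"
  using lborel_integral_real_affine[of "-1" f g] by simp

locale lp_instance = type_graph_instance G
  for G :: "('i, 'j) type_graph" +
  fixes x :: "'i \<Rightarrow> 'j \<Rightarrow> real"
  assumes feasible: "lp_feasible G x"
begin

lemma x_nonneg: "j \<in> off_nbrs G i \<Longrightarrow> 0 \<le> x i j"
  using feasible by (auto simp: lp_feasible_def off_nbrs_def)

lemma sum_x_le: "S \<subseteq> on_nbrs G j \<Longrightarrow> (\<Sum>i\<in>S. x i j) \<le> 1 - exp (- (\<Sum>i\<in>S. rate G i))"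
proof (cases "S = {}")
  case False
  assume "S \<subseteq> on_nbrs G j"
  with False have "j \<in> offline G"
    using mem_on_nbrs off_nbrsD(1) by blast
  then show ?thesis
    using feasible \<open>S \<subseteq> on_nbrs G j\<close> by (auto simp: lp_feasible_def)
qed simp

lemma sum_x_le_1: "S \<subseteq> on_nbrs G j \<Longrightarrow> (\<Sum>i\<in>S. x i j) \<le> 1"
  using sum_x_le[of S j] by (smt (verit) exp_gt_zero)

lemma gain_nonneg [simp]: "0 \<le> gain G v i j"
  by (simp add: gain_def)

lemma edge_ratio_measurable [measurable]: "(\<lambda>w. edge_ratio G x v w i j) \<in> borel_measurable borel"
  unfolding edge_ratio_def by measurable

lemma type_ratio_measurable [measurable]: "(\<lambda>w. type_ratio G x v w i) \<in> borel_measurable borel"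
  unfolding type_ratio_def by measurable

lemma p_fun_measurable [measurable]: "p_fun \<in> borel_measurable borel"
  unfolding p_fun_def by measurable

lemma edge_ratio_nonneg: "j \<in> off_nbrs G i \<Longrightarrow> 0 \<le> edge_ratio G x v w i j"
  using x_nonneg[of j i] rate_pos[of i] by (auto simp: edge_ratio_def dest: off_nbrsD)

lemma edge_ratio_le_type_ratio: "j \<in> off_nbrs G i \<Longrightarrow> edge_ratio G x v w i j \<le> type_ratio G x v w i"
  unfolding type_ratio_def by (intro member_le_sum) (auto intro: edge_ratio_nonneg)

lemma type_ratio_alt:
  "type_ratio G x v w i = (\<Sum>j\<in>{j\<in>off_nbrs G i. w \<le> gain G v i j}. x i j / rate G i)"
  unfolding type_ratio_def edge_ratio_def
  by (intro sum.mono_neutral_cong_right) auto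

lemma type_ratio_nonneg: "0 \<le> type_ratio G x v w i"
  unfolding type_ratio_def by (intro sum_nonneg edge_ratio_nonneg)

lemma type_ratio_le_1:
  assumes "i \<in> online G"
  shows "type_ratio G x v w i \<le> 1"
proof -
  have "type_ratio G x v w i \<le> (\<Sum>j\<in>off_nbrs G i. x i j / rate G i)"
    unfolding type_ratio_alt using rate_pos[OF assms]
    by (intro sum_mono2) (auto intro!: divide_nonneg_pos x_nonneg)
  also have "\<dots> = (\<Sum>j\<in>off_nbrs G i. x i j) / rate G i"
    by (simp add: sum_divide_distrib)
  also have "\<dots> \<le> 1"
    using feasible rate_pos[OF assms] assms by (auto simp: lp_feasible_def divide_le_eq_1)
  finally show ?thesis .
qed

text \<open>A crude common bound on the gains of \<open>i\<close>; the sum avoids a maximum over a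
  possibly empty set.\<close>

definition max_gain :: "('j \<Rightarrow> real) \<Rightarrow> 'i \<Rightarrow> real" where
  "max_gain v i = (\<Sum>j\<in>off_nbrs G i. gain G v i j)"

lemma gain_le_max_gain: "j \<in> off_nbrs G i \<Longrightarrow> gain G v i j \<le> max_gain v i"
  unfolding max_gain_def by (intro member_le_sum) auto

lemma type_ratio_eq_0: "max_gain v i < w \<Longrightarrow> type_ratio G x v w i = 0"
  using gain_le_max_gain[of _ i v] by (force simp: type_ratio_alt intro!: sum.neutral)

lemma integrable_type_ratio:
  assumes "i \<in> online G"
  shows "integrable lborel (\<lambda>w. indicator {0<..} w * type_ratio G x v w i)"
    "integrable lborel (\<lambda>w. indicator {0<..} w * p_fun (type_ratio G x v w i))"
proof -
  have "\<bar>indicator {0<..} w * type_ratio G x v w i\<bar> \<le> 1 * indicator {0..max_gain v i} w"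
    "\<bar>indicator {0<..} w * p_fun (type_ratio G x v w i)\<bar> \<le> 1 * indicator {0..max_gain v i} w" for w
    using type_ratio_eq_0[of v i w] type_ratio_nonneg[of v w i] type_ratio_le_1[OF assms, of v w]
    by (auto simp: indicator_def p_fun_def)
  then show "integrable lborel (\<lambda>w. indicator {0<..} w * type_ratio G x v w i)"
    "integrable lborel (\<lambda>w. indicator {0<..} w * p_fun (type_ratio G x v w i))"
    by (auto intro!: integrable_bounded_support[where C = 1 and M = "max_gain v i"])
qed

definition marginal :: "('j \<Rightarrow> real) \<Rightarrow> 'i \<Rightarrow> 'j \<Rightarrow> real \<Rightarrow> real" where
  "marginal v i j w = p_fun (type_ratio G x v w i) - p_fun (type_ratio G x v w i - edge_ratio G x v w i j)"

lemma marginal_measurable [measurable]: "marginal v i j \<in> borel_measurable borel"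
  unfolding marginal_def by measurable

lemma marginal_bounds:
  assumes "j \<in> off_nbrs G i"
  shows "max (2 * edge_ratio G x v w i j - 1) 0 \<le> marginal v i j w"
    "marginal v i j w \<le> min (2 * edge_ratio G x v w i j) 1"
  unfolding marginal_def
  by (intro p_fun_marginal_bounds edge_ratio_nonneg edge_ratio_le_type_ratio type_ratio_le_1
        off_nbrsD(2)[OF assms] assms)+

lemma integrable_marginal:
  assumes "j \<in> off_nbrs G i" "A \<in> sets borel" "A \<subseteq> {0..M}"
  shows "integrable lborel (\<lambda>w. indicator A w * marginal v i j w)"
proof (rule integrable_bounded_support)
  fix w show "\<bar>indicator A w * marginal v i j w\<bar> \<le> 1 * indicator {0..M} w"
    using marginal_bounds[OF assms(1), of v w] assms(3) by (auto simp: indicator_def)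
qed (use assms(2) in measurable)

lemma integrable_marginal_reflect:
  assumes "j \<in> off_nbrs G i"
  shows "integrable lborel (\<lambda>u. indicator {0..<gain G v i j} u * marginal v i j (gain G v i j - u))"
proof (rule integrable_bounded_support)
  fix u show "\<bar>indicator {0..<gain G v i j} u * marginal v i j (gain G v i j - u)\<bar>
      \<le> 1 * indicator {0..gain G v i j} u"
    using marginal_bounds[OF assms(1), of v "gain G v i j - u"] by (auto simp: indicator_def)
qed measurable

section \<open>The gains A and B, and the cost of raising one level\<close>

definition fractional_gain :: "('j \<Rightarrow> real) \<Rightarrow> real" where
  "fractional_gain v = (\<Sum>i\<in>online G. \<Sum>j\<in>off_nbrs G i. x i j * gain G v i j)"

text \<open>B in layer-cake form: \<open>p_fun (type_ratio G x v w i)\<close> is the probability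
  that sampling with doubled fractions, in order of decreasing gain and capped at one, yields a gain
  of at least \<open>w\<close>.\<close>

definition sampled_gain :: "('j \<Rightarrow> real) \<Rightarrow> real" where
  "sampled_gain v =
     (\<Sum>i\<in>online G. rate G i * (LINT w|lborel. indicator {0<..} w * p_fun (type_ratio G x v w i)))"

definition fractional_loss :: "('j \<Rightarrow> real) \<Rightarrow> 'i \<Rightarrow> 'j \<Rightarrow> real" where
  "fractional_loss v i j = (\<Sum>i'\<in>on_nbrs G j.
     (gain G v i' j - max (gain G v i' j - gain G v i j) 0) * x i' j)"

text \<open>The interval consists of the levels at which the edge \<open>(i', j)\<close> counts
  before \<open>j\<close> is raised and no longer afterwards. Leaving out its left end matches the
  levels \<open>w > 0\<close> of \<open>sampled_gain\<close>, so the integrands in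
  \<open>sampled_gain_raise\<close> agree pointwise.\<close>

definition sampled_loss :: "('j \<Rightarrow> real) \<Rightarrow> 'i \<Rightarrow> 'j \<Rightarrow> real" where
  "sampled_loss v i j = (\<Sum>i'\<in>on_nbrs G j. rate G i' * (LINT w|lborel.
     indicator {max (gain G v i' j - gain G v i j) 0<..gain G v i' j} w * marginal v i' j w))"

lemma integral_Icc_eq:
  fixes f :: "real \<Rightarrow> real"
  assumes "integrable lborel (\<lambda>w. indicator {a..b} w * f w)"
  shows "integral {a..b} f = (LINT w|lborel. indicator {a<..b} w * f w)"
proof -
  have "integral {a..b} f = (LINT w:{a..b}|lborel. f w)"
    using assms by (intro set_borel_integral_eq_integral(2)[symmetric]) (simp add: set_integrable_def)
  also have "\<dots> = (LINT w|lborel. indicator {a<..b} w * f w)"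
    unfolding set_lebesgue_integral_def real_scaleR_def
  proof (rule integral_cong_AE)
    show [measurable]: "(\<lambda>w. indicator {a..b} w * f w) \<in> borel_measurable lborel"
      using assms by (rule borel_measurable_integrable)
    have "(\<lambda>w. indicator {a<..b} w * (indicator {a..b} w * f w)) \<in> borel_measurable lborel"
      by measurable
    also have "(\<lambda>w. indicator {a<..b} w * (indicator {a..b} w * f w)) = (\<lambda>w. indicator {a<..b} w * f w)"
      by (auto simp: indicator_def)
    finally show "(\<lambda>w. indicator {a<..b} w * f w) \<in> borel_measurable lborel" .
    show "AE w in lborel. indicator {a..b} w * f w = indicator {a<..b} w * f w"
      using AE_lborel_singleton[of a] by eventually_elim (auto simp: indicator_def)
  qed
  finally show ?thesis .
qed

lemma regularizer_eq:
  assumes "j \<in> off_nbrs G i"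
  shows "regularizer G x v t i j = \<alpha>_fun t * fractional_loss v i j + \<beta>_fun t * sampled_loss v i j"
proof -
  have "integral {max (gain G v i' j - gain G v i j) 0..gain G v i' j}
          (\<lambda>w. rate G i' * (p_fun (type_ratio G x v w i')
                            - p_fun (type_ratio G x v w i' - edge_ratio G x v w i' j))) =
      rate G i' * (LINT w|lborel.
     indicator {max (gain G v i' j - gain G v i j) 0<..gain G v i' j} w * marginal v i' j w)"
    if "i' \<in> on_nbrs G j" for i'
  proof -
    have "j \<in> off_nbrs G i'"
      using that by (simp add: mem_on_nbrs)
    then have "integrable lborel (\<lambda>w. indicator {max (gain G v i' j - gain G v i j) 0..gain G v i' j} w * marginal v i' j w)"
      by (rule integrable_marginal[where M = "gain G v i' j"]) auto
    from integral_Icc_eq[OF this] show ?thesis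
      by (simp add: marginal_def)
  qed
  then show ?thesis
    unfolding regularizer_def fractional_loss_def sampled_loss_def
    by (intro arg_cong2[where f = "(+)"] arg_cong2[where f = "(*)"] sum.cong refl)
qed

lemma gain_raise:
  "0 \<le> \<delta> \<Longrightarrow> gain G (v(j := v j + \<delta>)) i j' = (if j' = j then max (gain G v i j - \<delta>) 0 else gain G v i j')"
  by (auto simp: gain_def)

lemma fractional_gain_raise:
  assumes "j \<in> offline G"
  shows "fractional_gain (v(j := v j + gain G v i j)) = fractional_gain v - fractional_loss v i j"
proof -
  let ?v = "v(j := v j + gain G v i j)"
  have "fractional_gain v - fractional_gain ?v =
      (\<Sum>k\<in>offline G. \<Sum>i'\<in>on_nbrs G k. x i' k * (gain G v i' k - gain G ?v i' k))"
    unfolding fractional_gain_def sum_online_swap by (simp add: sum_subtractf right_diff_distrib)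
  also have "\<dots> = (\<Sum>k\<in>offline G. if k = j then fractional_loss v i j else 0)"
    by (intro sum.cong refl) (auto simp: gain_raise fractional_loss_def mult.commute)
  finally show ?thesis
    using assms by simp
qed

lemma sampled_gain_raise:
  assumes "j \<in> offline G"
  shows "sampled_gain (v(j := v j + gain G v i j)) = sampled_gain v - sampled_loss v i j"
proof -
  let ?v = "v(j := v j + gain G v i j)"
  let ?A = "\<lambda>i'. {max (gain G v i' j - gain G v i j) 0<..gain G v i' j}"
  have eq: "indicator {0<..} w * p_fun (type_ratio G x v w i') - indicator {0<..} w * p_fun (type_ratio G x ?v w i') =
      (if i' \<in> on_nbrs G j then indicator (?A i') w * marginal v i' j w else 0)" if "i' \<in> online G" for i' w
  proof (cases "0 < w \<and> j \<in> off_nbrs G i'")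
    case False
    have "type_ratio G x ?v w i' = type_ratio G x v w i'" if "j \<notin> off_nbrs G i'"
      unfolding type_ratio_def edge_ratio_def using that
      by (intro sum.cong) (auto simp: gain_def)
    then show ?thesis
      using False by (auto simp: mem_on_nbrs)
  next
    case True
    have "edge_ratio G x ?v w i' k = edge_ratio G x v w i' k -
        (if k = j then indicator (?A i') w * edge_ratio G x v w i' j else 0)" for k
    proof -
      define m where "m = max (gain G v i' j - gain G v i j) 0"
      have "m \<le> gain G v i' j"
        by (simp add: m_def)
      then show ?thesis
        using True by (auto simp: edge_ratio_def gain_raise indicator_def simp flip: m_def)
    qed
    then have "type_ratio G x ?v w i' = type_ratio G x v w i' - indicator (?A i') w * edge_ratio G x v w i' j"
      using True by (simp add: type_ratio_def sum_subtractf)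
    then show ?thesis
      using True that by (auto simp: mem_on_nbrs marginal_def indicator_def)
  qed
  have "sampled_gain v - sampled_gain ?v = (\<Sum>i'\<in>online G. rate G i' *
      (LINT w|lborel. indicator {0<..} w * p_fun (type_ratio G x v w i') - indicator {0<..} w * p_fun (type_ratio G x ?v w i')))"
    unfolding sampled_gain_def
    by (simp add: sum_subtractf right_diff_distrib Bochner_Integration.integral_diff integrable_type_ratio)
  also have "\<dots> = (\<Sum>i'\<in>online G. if i' \<in> on_nbrs G j then rate G i' *
      (LINT w|lborel. indicator (?A i') w * marginal v i' j w) else 0)"
    by (intro sum.cong refl) (simp add: eq)
  also have "\<dots> = sampled_loss v i j"
    unfolding sampled_loss_def by (intro sum.mono_neutral_cong_right) (auto dest: on_nbrsD)
  finally show ?thesis by simp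
qed

text \<open>With \<open>u = gain G v i' j - w\<close>, the depth below the own top level, all
  intervals start at 0 and the integrand lives on \<open>u\<close> below both gains. The dependence
  on \<open>i\<close> and on \<open>i'\<close> then separates, which makes a weighted sum over
  \<open>i\<close> a product.\<close>

lemma sampled_loss_reflect:
  "sampled_loss v i j = (\<Sum>i'\<in>on_nbrs G j. rate G i' * (LINT u|lborel. indicator {0..<gain G v i j} u *
     (indicator {0..<gain G v i' j} u * marginal v i' j (gain G v i' j - u))))"
  unfolding sampled_loss_def
proof (intro sum.cong refl arg_cong2[where f = "(*)"])
  fix i'
  show "(LINT w|lborel. indicator {max (gain G v i' j - gain G v i j) 0<..gain G v i' j} w * marginal v i' j w) =
     (LINT u|lborel. indicator {0..<gain G v i j} u *
     (indicator {0..<gain G v i' j} u * marginal v i' j (gain G v i' j - u)))"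
    by (subst lborel_integral_reflect[of _ "gain G v i' j"])
       (intro Bochner_Integration.integral_cong refl, auto simp: indicator_def)
qed

lemma fractional_loss_le:
  assumes "j \<in> offline G"
  shows "fractional_loss v i j \<le> gain G v i j"
proof -
  have "fractional_loss v i j \<le> (\<Sum>i'\<in>on_nbrs G j. gain G v i j * x i' j)"
    unfolding fractional_loss_def
    by (intro sum_mono mult_right_mono) (auto simp: mem_on_nbrs intro: x_nonneg)
  also have "\<dots> = gain G v i j * (\<Sum>i'\<in>on_nbrs G j. x i' j)"
    by (simp add: sum_distrib_left)
  also have "\<dots> \<le> gain G v i j"
    using sum_x_le_1[of "on_nbrs G j" j] by (simp add: mult_left_le)
  finally show ?thesis .
qed

text \<open>A marginal is at most \<open>2 * x i' j / rate G i'\<close> and, after reflection, lives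
  on an interval of length at most \<open>gain G v i j\<close>; the \<open>x i' j\<close> sum to at
  most 1.\<close>

lemma sampled_loss_le:
  assumes "j \<in> offline G"
  shows "sampled_loss v i j \<le> 2 * gain G v i j"
proof -
  have "sampled_loss v i j \<le> (\<Sum>i'\<in>on_nbrs G j. rate G i' * (LINT u|lborel. indicator {0..<gain G v i j} u * (2 * x i' j / rate G i')))"
    unfolding sampled_loss_reflect
  proof (rule sum_mono, rule mult_left_mono, rule integral_mono)
    fix i' assume i': "i' \<in> on_nbrs G j"
    then have j: "j \<in> off_nbrs G i'"
      by (simp add: mem_on_nbrs)
    show "0 \<le> rate G i'"
      using i' rate_pos[of i'] by (auto dest: on_nbrsD)
    show "integrable lborel (\<lambda>u. indicator {0..<gain G v i j} u *
     (indicator {0..<gain G v i' j} u * marginal v i' j (gain G v i' j - u)))"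
      using integrable_mult_indicator[OF _ integrable_marginal_reflect[OF j], of "{0..<gain G v i j}" v]
      by simp
    show "integrable lborel (\<lambda>u. indicator {0..<gain G v i j} u * (2 * x i' j / rate G i'))"
      by (intro integrable_mult_left integrable_real_indicator) auto
    fix u
    show "indicator {0..<gain G v i j} u * (indicator {0..<gain G v i' j} u * marginal v i' j (gain G v i' j - u))
          \<le> indicator {0..<gain G v i j} u * (2 * x i' j / rate G i')"
      using marginal_bounds(2)[OF j, of v "gain G v i' j - u"] x_nonneg[OF j] \<open>0 \<le> rate G i'\<close>
      by (auto simp: indicator_def edge_ratio_def)
  qed
  also have "\<dots> = (\<Sum>i'\<in>on_nbrs G j. 2 * gain G v i j * x i' j)"
  proof (intro sum.cong refl)
    fix i' assume "i' \<in> on_nbrs G j"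
    then have "rate G i' \<noteq> 0"
      using rate_pos[of i'] by (auto dest: on_nbrsD)
    then show "rate G i' * (LINT u|lborel. indicator {0..<gain G v i j} u * (2 * x i' j / rate G i')) =
        2 * gain G v i j * x i' j"
      by simp
  qed
  also have "\<dots> = 2 * gain G v i j * (\<Sum>i'\<in>on_nbrs G j. x i' j)"
    by (simp add: sum_distrib_left)
  also have "\<dots> \<le> 2 * gain G v i j"
    using sum_x_le_1[of "on_nbrs G j" j] by (simp add: mult_left_le)
  finally show ?thesis .
qed

text \<open>Since \<alpha> + 2 \<beta> \<le> 1, every match has a nonnegative net value, so a greedy
  match never lowers the potential.\<close>

lemma regularizer_le_gain:
  assumes "j \<in> off_nbrs G i" "t \<le> 1"
  shows "regularizer G x v t i j \<le> gain G v i j"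
proof -
  have "regularizer G x v t i j \<le> \<alpha>_fun t * gain G v i j + \<beta>_fun t * (2 * gain G v i j)"
    unfolding regularizer_eq[OF assms(1)] using assms
    by (intro add_mono mult_left_mono fractional_loss_le sampled_loss_le \<alpha>_fun_nonneg \<beta>_fun_nonneg)
       (auto dest: off_nbrsD)
  also have "\<dots> = (1 - exp (2 * t - 2)) * gain G v i j"
    unfolding \<alpha>_plus_2_\<beta>_fun[symmetric] by (simp add: algebra_simps)
  also have "\<dots> \<le> gain G v i j"
    using mult_right_mono[of "1 - exp (2 * t - 2)" 1 "gain G v i j"] by simp
  finally show ?thesis .
qed

end

section \<open>Drift\<close>

context lp_instance begin

text \<open>
  Type \<open>i\<close> is matched with twice its LP fractions, in order of decreasing gain and up to a total of \<open>1\<close>.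
\<close>

definition half_split :: "('j \<Rightarrow> real) \<Rightarrow> ('i \<Rightarrow> 'j \<Rightarrow> real) \<Rightarrow> bool" where
  "half_split v q \<longleftrightarrow> (\<forall>i\<in>online G.
     (\<forall>j\<in>off_nbrs G i. 0 \<le> q i j \<and> rate G i * q i j \<le> min (2 * x i j) (rate G i)) \<and>
     (\<forall>w. (\<Sum>j\<in>{j\<in>off_nbrs G i. w \<le> gain G v i j}. q i j) = p_fun (type_ratio G x v w i)))"

lemma half_split_exists: "\<exists>q. half_split v q"
proof -
  have "\<exists>q. (\<forall>j\<in>off_nbrs G i. 0 \<le> q j \<and> rate G i * q j \<le> min (2 * x i j) (rate G i)) \<and>
     (\<forall>w. (\<Sum>j\<in>{j\<in>off_nbrs G i. w \<le> gain G v i j}. q j) = p_fun (type_ratio G x v w i))"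
    if i: "i \<in> online G" for i
  proof -
    have "\<exists>q. (\<forall>j\<in>off_nbrs G i. 0 \<le> q j \<and> q j \<le> min (2 * (x i j / rate G i)) 1) \<and>
             (\<forall>w. (\<Sum>j\<in>{j\<in>off_nbrs G i. w \<le> gain G v i j}. q j) =
                  p_fun (\<Sum>j\<in>{j\<in>off_nbrs G i. w \<le> gain G v i j}. x i j / rate G i))"
      using rate_pos[OF i] x_nonneg by (intro half_greedy_fractions) auto
    then obtain q where q: "\<And>j. j \<in> off_nbrs G i \<Longrightarrow> 0 \<le> q j \<and> q j \<le> min (2 * (x i j / rate G i)) 1"
      "\<And>w. (\<Sum>j\<in>{j\<in>off_nbrs G i. w \<le> gain G v i j}. q j) = p_fun (type_ratio G x v w i)"
      unfolding type_ratio_alt by blast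
    have "rate G i * q j \<le> min (2 * x i j) (rate G i)" if "j \<in> off_nbrs G i" for j
    proof -
      have "rate G i * q j \<le> rate G i * min (2 * (x i j / rate G i)) 1"
        using q(1)[OF that] rate_pos[OF i] by (intro mult_left_mono) auto
      also have "\<dots> = min (2 * x i j) (rate G i)"
        using rate_pos[OF i] by (simp add: min_mult_distrib_left)
      finally show ?thesis .
    qed
    then show ?thesis
      using q by blast
  qed
  then show ?thesis
    unfolding half_split_def by (intro bchoice ballI)
qed

text \<open>Layer-cake: each gain is the length of the interval of levels below it, and at a fixed
  level the active \<open>q i j\<close> sum to the capped ratio.\<close>

lemma half_split_gain:
  assumes q: "half_split v q" and i: "i \<in> online G"
  shows "(\<Sum>j\<in>off_nbrs G i. q i j * gain G v i j) =
    (LINT w|lborel. indicator {0<..} w * p_fun (type_ratio G x v w i))"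
proof -
  have "(\<Sum>j\<in>off_nbrs G i. q i j * gain G v i j) =
     (\<Sum>j\<in>off_nbrs G i. LINT w|lborel. q i j * indicator {0<..gain G v i j} w)"
    by simp
  also have "\<dots> = (LINT w|lborel. (\<Sum>j\<in>off_nbrs G i. q i j * indicator {0<..gain G v i j} w))"
    by (subst Bochner_Integration.integral_sum) auto
  also have "\<dots> = (LINT w|lborel. indicator {0<..} w * p_fun (type_ratio G x v w i))"
  proof (intro Bochner_Integration.integral_cong refl)
    fix w :: real
    have "(\<Sum>j\<in>off_nbrs G i. q i j * indicator {0<..gain G v i j} w) =
       indicator {0<..} w * (\<Sum>j\<in>{j\<in>off_nbrs G i. w \<le> gain G v i j}. q i j)"
      unfolding sum_distrib_left by (intro sum.mono_neutral_cong_right) (auto simp: indicator_def)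
    then show "(\<Sum>j\<in>off_nbrs G i. q i j * indicator {0<..gain G v i j} w) =
        indicator {0<..} w * p_fun (type_ratio G x v w i)"
      using q i by (simp add: half_split_def)
  qed
  finally show ?thesis .
qed

lemma fractional_gain_eq:
  "fractional_gain v =
     (\<Sum>i\<in>online G. rate G i * (LINT w|lborel. indicator {0<..} w * type_ratio G x v w i))"
  unfolding fractional_gain_def
proof (intro sum.cong refl)
  fix i assume i: "i \<in> online G"
  have "(LINT w|lborel. indicator {0<..} w * type_ratio G x v w i) =
      (LINT w|lborel. (\<Sum>j\<in>off_nbrs G i. x i j / rate G i * indicator {0<..gain G v i j} w))"
    unfolding type_ratio_def edge_ratio_def sum_distrib_left
    by (intro Bochner_Integration.integral_cong sum.cong refl) (auto simp: indicator_def)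
  also have "\<dots> = (\<Sum>j\<in>off_nbrs G i. x i j * gain G v i j) / rate G i"
    by (subst Bochner_Integration.integral_sum) (auto simp: sum_divide_distrib)
  finally show "(\<Sum>j\<in>off_nbrs G i. x i j * gain G v i j) =
      rate G i * (LINT w|lborel. indicator {0<..} w * type_ratio G x v w i)"
    using rate_pos[OF i] by simp
qed

lemma fractional_gain_le_sampled_gain: "fractional_gain v \<le> sampled_gain v"
  unfolding fractional_gain_eq sampled_gain_def
proof (rule sum_mono, rule mult_left_mono, rule integral_mono)
  fix i w assume "i \<in> online G"
  then show "indicator {0<..} w * type_ratio G x v w i \<le> indicator {0<..} w * p_fun (type_ratio G x v w i)"
    using type_ratio_nonneg[of v w i] type_ratio_le_1[of i v w] by (auto simp: p_fun_def indicator_def)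
qed (auto intro: rate_pos less_imp_le integrable_type_ratio)

text \<open>
  After reflecting the weight level at \<open>gain G v i j\<close>, the loss caused by \<open>j\<close> factors at every
  level \<open>u\<close> into the matching rate \<open>Q\<close> times the accumulated marginals \<open>D\<close>.
\<close>

lemma sampled_loss_bound:
  assumes q: "half_split v q"
  shows "(\<Sum>i\<in>online G. rate G i * (\<Sum>j\<in>off_nbrs G i. q i j * sampled_loss v i j)) \<le>
     (1 - ln 2) * sampled_gain v + (1 + ln 2) * (2 * sampled_gain v - 2 * fractional_gain v)"
proof -
  define I where "I i j u = (indicator {0..<gain G v i j} u :: real)" for i j u
  define m where "m i j u = I i j u * marginal v i j (gain G v i j - u)" for i j u
  define Q where "Q j u = (\<Sum>i\<in>on_nbrs G j. rate G i * q i j * I i j u)" for j u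
  define D where "D j u = (\<Sum>i\<in>on_nbrs G j. rate G i * m i j u)" for j u
  \<comment> \<open>\<open>E\<close> is the part of \<open>D\<close> forced by the lower bound in
    \<open>marginal_bounds\<close>. Splitting it off makes the rest \<open>D - E\<close> small
    enough to be charged to 2 B - 2 A.\<close>
  define E where "E j u = (\<Sum>i\<in>on_nbrs G j. max (2 * x i j - rate G i) 0 * I i j u)" for j u
  define E0 where "E0 i j = max (2 * (x i j / rate G i) - 1) 0" for i j
  have int_I [simp]: "integrable lborel (I i j)" "(LINT u|lborel. I i j u) = gain G v i j" for i j
    by (auto simp: I_def[abs_def])
  have int_m: "integrable lborel (m i j)" if "i \<in> on_nbrs G j" for i j
    using that integrable_marginal_reflect[of j i v] by (auto simp: m_def[abs_def] I_def mem_on_nbrs)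
  have int_Im: "integrable lborel (\<lambda>u. I i j u * m i' j u)" if "i' \<in> on_nbrs G j" for i i' j
    using integrable_mult_indicator[OF _ int_m[OF that], of "{0..<gain G v i j}"]
    by (simp add: I_def)
  have rate: "0 < rate G i" if "i \<in> on_nbrs G j" for i j
    using that by (auto dest: on_nbrsD rate_pos)
  have int_Q: "integrable lborel (Q j)" for j
    unfolding Q_def[abs_def] by auto
  have int_D: "integrable lborel (D j)" for j
    unfolding D_def[abs_def] by (auto intro!: int_m)
  have int_E: "integrable lborel (E j)" for j
    unfolding E_def[abs_def] by auto
  have QD: "Q j u * D j u = (\<Sum>i\<in>on_nbrs G j. rate G i * q i j * (\<Sum>i'\<in>on_nbrs G j. rate G i' * (I i j u * m i' j u)))"
    for j u
    unfolding Q_def D_def by (simp add: sum_distrib_left sum_distrib_right ac_simps)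
  have int_QD: "integrable lborel (\<lambda>u. Q j u * D j u)" for j
    unfolding QD by (intro Bochner_Integration.integrable_sum integrable_mult_right int_Im)

  \<comment> \<open>This is \<open>product_bound\<close> with k = 1 - ln 2; its hypotheses come from
    the constraints of \<open>j\<close> on the set of types whose gain exceeds the depth
    \<open>u\<close>.\<close>
  have bound: "Q j u * D j u \<le> (1 - ln 2) * Q j u + (2 - (1 - ln 2)) * (D j u - E j u)" for j u
  proof (cases "0 \<le> u")
    case False
    then have "I i j u = 0" for i
      by (simp add: I_def)
    then show ?thesis
      by (simp add: Q_def D_def E_def m_def)
  next
    case True
    define S where "S = {i\<in>on_nbrs G j. u < gain G v i j}"
    have S: "finite S" "S \<subseteq> on_nbrs G j"
      by (auto simp: S_def)
    have sumS: "(\<Sum>i\<in>on_nbrs G j. f i) = (\<Sum>i\<in>S. f i)" if "\<And>i. I i j u = 0 \<Longrightarrow> f i = 0" for f :: "'i \<Rightarrow> real"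
      using that by (intro sum.mono_neutral_right) (auto simp: S_def I_def)
    have I1: "I i j u = 1" if "i \<in> S" for i
      using that True by (auto simp: S_def I_def)
    have Q: "Q j u = (\<Sum>i\<in>S. rate G i * q i j)"
      unfolding Q_def by (subst sumS) (auto simp: I1)
    have E: "E j u = (\<Sum>i\<in>S. max (2 * x i j - rate G i) 0)"
      unfolding E_def by (subst sumS) (auto simp: I1)
    have D: "D j u = (\<Sum>i\<in>S. rate G i * marginal v i j (gain G v i j - u))"
      unfolding D_def m_def by (subst sumS) (auto simp: I1)
    have qi: "0 \<le> rate G i * q i j" "rate G i * q i j \<le> min (2 * x i j) (rate G i)" if "i \<in> S" for i
      using q S(2) that rate[of i j] by (auto simp: half_split_def mem_on_nbrs subset_iff)
    have marg: "max (2 * x i j - rate G i) 0 \<le> rate G i * marginal v i j (gain G v i j - u)"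
      "rate G i * marginal v i j (gain G v i j - u) \<le> 2 * x i j" if "i \<in> S" for i
    proof -
      have j: "j \<in> off_nbrs G i" and r: "0 < rate G i"
        using that S(2) rate[of i j] by (auto simp: mem_on_nbrs subset_iff)
      have er: "edge_ratio G x v (gain G v i j - u) i j = x i j / rate G i"
        using True by (simp add: edge_ratio_def)
      note b = marginal_bounds[OF j, of v "gain G v i j - u", unfolded er]
      have "max (2 * x i j - rate G i) 0 = rate G i * max (2 * (x i j / rate G i) - 1) 0"
        using r by (simp add: max_def field_simps)
      also have "\<dots> \<le> rate G i * marginal v i j (gain G v i j - u)"
        using b(1) r by (intro mult_left_mono) auto
      finally show "max (2 * x i j - rate G i) 0 \<le> rate G i * marginal v i j (gain G v i j - u)" .
      have "rate G i * marginal v i j (gain G v i j - u) \<le> rate G i * (2 * (x i j / rate G i))"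
        using b(2) r by (intro mult_left_mono) auto
      then show "rate G i * marginal v i j (gain G v i j - u) \<le> 2 * x i j"
        using r by simp
    qed
    have sx: "(\<Sum>i\<in>S. 2 * x i j) \<le> 2"
      using sum_x_le_1[OF S(2)] by (simp flip: sum_distrib_left)
    show ?thesis
    proof (rule product_bound)
      show "0 \<le> Q j u"
        unfolding Q by (intro sum_nonneg qi)
      \<comment> \<open>Since min(a, b) + max(a - b, 0) = a with a = \<open>2 * x i j\<close> and b
        = \<open>rate G i\<close>, the capped matching rate and the excess share the budget
        \<open>2 * x i j\<close>.\<close>
      have "Q j u + E j u \<le> (\<Sum>i\<in>S. 2 * x i j)"
        unfolding Q E sum.distrib[symmetric]
      proof (rule sum_mono)
        fix i assume i: "i \<in> S"
        show "rate G i * q i j + max (2 * x i j - rate G i) 0 \<le> 2 * x i j"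
          using qi[OF i] by linarith
      qed
      then show "Q j u \<le> 2 - E j u"
        using sx by linarith
      show "E j u \<le> D j u"
        unfolding D E by (intro sum_mono marg)
      have "D j u \<le> (\<Sum>i\<in>S. 2 * x i j)"
        unfolding D by (intro sum_mono marg)
      then show "D j u \<le> 2"
        using sx by linarith
      show "E j u \<le> 1 - ln 2"
        unfolding E using S by (intro excess_le_one_minus_ln2 sum_x_le) auto
      show "1 - ln 2 \<le> (2::real)"
        using ln2_bounds by simp
    qed
  qed

  have lhs: "(\<Sum>i\<in>online G. rate G i * (\<Sum>j\<in>off_nbrs G i. q i j * sampled_loss v i j)) =
      (\<Sum>j\<in>offline G. LINT u|lborel. Q j u * D j u)"
  proof -
    have "(\<Sum>i\<in>online G. rate G i * (\<Sum>j\<in>off_nbrs G i. q i j * sampled_loss v i j)) =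
       (\<Sum>j\<in>offline G. \<Sum>i\<in>on_nbrs G j. rate G i * q i j * sampled_loss v i j)"
      by (simp add: sum_distrib_left mult.assoc flip: sum_online_swap)
    also have "\<dots> = (\<Sum>j\<in>offline G. LINT u|lborel. Q j u * D j u)"
    proof (intro sum.cong refl)
      fix j
      have "(\<Sum>i\<in>on_nbrs G j. rate G i * q i j * sampled_loss v i j) =
         (\<Sum>i\<in>on_nbrs G j. rate G i * q i j * (\<Sum>i'\<in>on_nbrs G j. rate G i' * (LINT u|lborel. I i j u * m i' j u)))"
        by (simp add: sampled_loss_reflect I_def m_def)
      also have "\<dots> = (LINT u|lborel. Q j u * D j u)"
        unfolding QD by (simp add: int_Im Bochner_Integration.integral_sum)
      finally show "(\<Sum>i\<in>on_nbrs G j. rate G i * q i j * sampled_loss v i j) = (LINT u|lborel. Q j u * D j u)" .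
    qed
    finally show ?thesis .
  qed
  have sumQ: "(\<Sum>j\<in>offline G. LINT u|lborel. Q j u) = sampled_gain v"
  proof -
    have "(\<Sum>j\<in>offline G. LINT u|lborel. Q j u) = (\<Sum>j\<in>offline G. \<Sum>i\<in>on_nbrs G j. rate G i * q i j * gain G v i j)"
      unfolding Q_def[abs_def] by (simp add: Bochner_Integration.integral_sum)
    also have "\<dots> = sampled_gain v"
      unfolding sum_online_swap[symmetric] sampled_gain_def
      by (intro sum.cong refl) (simp add: sum_distrib_left mult.assoc flip: half_split_gain[OF q])
    finally show ?thesis .
  qed
  \<comment> \<open>The grouping changes here. \<open>D\<close> and \<open>E\<close> are collected
    per \<open>j\<close> at equal depth \<open>u\<close>; undoing the reflection collects them per
    type at equal level \<open>w\<close>, where \<open>sum_p_fun_marginals_le\<close>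
    applies.\<close>
  have sumDE: "(\<Sum>j\<in>offline G. (LINT u|lborel. D j u) - (LINT u|lborel. E j u)) \<le> 2 * sampled_gain v - 2 * fractional_gain v"
  proof -
    define m' where "m' i j w = indicator {0<..gain G v i j} w * (marginal v i j w - E0 i j)" for i j w
    have int_m': "integrable lborel (m' i j)" if "j \<in> off_nbrs G i" for i j
    proof -
      have "integrable lborel (\<lambda>w. indicator {0<..gain G v i j} w * marginal v i j w - E0 i j * indicator {0<..gain G v i j} w)"
        using that by (intro Bochner_Integration.integrable_diff integrable_marginal[where M = "gain G v i j"]) auto
      then show ?thesis
        by (simp add: m'_def[abs_def] right_diff_distrib mult.commute)
    qed
    have "(LINT u|lborel. D j u) - (LINT u|lborel. E j u) = (\<Sum>i\<in>on_nbrs G j. rate G i * (LINT w|lborel. m' i j w))" for j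
    proof -
      have "(LINT u|lborel. D j u) = (\<Sum>i\<in>on_nbrs G j. rate G i * (LINT u|lborel. m i j u))"
        unfolding D_def[abs_def] by (simp add: Bochner_Integration.integral_sum int_m)
      moreover have "(LINT u|lborel. E j u) = (\<Sum>i\<in>on_nbrs G j. rate G i * (LINT u|lborel. E0 i j * I i j u))"
      proof -
        have "(LINT u|lborel. E j u) = (\<Sum>i\<in>on_nbrs G j. max (2 * x i j - rate G i) 0 * gain G v i j)"
          unfolding E_def[abs_def] by (simp add: Bochner_Integration.integral_sum)
        also have "\<dots> = (\<Sum>i\<in>on_nbrs G j. rate G i * (LINT u|lborel. E0 i j * I i j u))"
        proof (intro sum.cong refl)
          fix i assume "i \<in> on_nbrs G j"
          then have "max (2 * x i j - rate G i) 0 = rate G i * E0 i j"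
            using rate[of i j] by (simp add: E0_def max_def field_simps)
          then show "max (2 * x i j - rate G i) 0 * gain G v i j = rate G i * (LINT u|lborel. E0 i j * I i j u)"
            by simp
        qed
        finally show ?thesis .
      qed
      moreover have "(LINT u|lborel. m i j u) - (LINT u|lborel. E0 i j * I i j u) = (LINT w|lborel. m' i j w)"
        if "i \<in> on_nbrs G j" for i
      proof -
        have "(LINT u|lborel. m i j u) - (LINT u|lborel. E0 i j * I i j u) = (LINT u|lborel. m i j u - E0 i j * I i j u)"
          by (rule Bochner_Integration.integral_diff[symmetric]) (auto intro: int_m that)
        also have "\<dots> = (LINT w|lborel. m' i j w)"
          by (subst (2) lborel_integral_reflect[of _ "gain G v i j"])
             (intro Bochner_Integration.integral_cong refl, auto simp: m_def m'_def I_def indicator_def)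
        finally show ?thesis .
      qed
      ultimately show ?thesis
        by (simp add: sum_subtractf[symmetric] right_diff_distrib[symmetric])
    qed
    then have "(\<Sum>j\<in>offline G. (LINT u|lborel. D j u) - (LINT u|lborel. E j u)) =
        (\<Sum>i\<in>online G. \<Sum>j\<in>off_nbrs G i. rate G i * (LINT w|lborel. m' i j w))"
      by (simp add: sum_online_swap)
    also have "\<dots> = (\<Sum>i\<in>online G. rate G i * (LINT w|lborel. (\<Sum>j\<in>off_nbrs G i. m' i j w)))"
      by (simp add: int_m' Bochner_Integration.integral_sum sum_distrib_left)
    also have "\<dots> \<le> (\<Sum>i\<in>online G. rate G i * (LINT w|lborel.
        2 * (indicator {0<..} w * p_fun (type_ratio G x v w i)) - 2 * (indicator {0<..} w * type_ratio G x v w i)))"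
    proof (rule sum_mono, rule mult_left_mono, rule integral_mono)
      fix i assume i: "i \<in> online G"
      show "0 \<le> rate G i"
        using rate_pos[OF i] by simp
      show "integrable lborel (\<lambda>w. \<Sum>j\<in>off_nbrs G i. m' i j w)"
        by (auto intro!: int_m')
      show "integrable lborel (\<lambda>w. 2 * (indicator {0<..} w * p_fun (type_ratio G x v w i)) - 2 * (indicator {0<..} w * type_ratio G x v w i))"
        using integrable_type_ratio[OF i] by auto
      fix w :: real
      show "(\<Sum>j\<in>off_nbrs G i. m' i j w) \<le>
         2 * (indicator {0<..} w * p_fun (type_ratio G x v w i)) - 2 * (indicator {0<..} w * type_ratio G x v w i)"
      proof (cases "0 < w")
        case False
        then show ?thesis by (simp add: m'_def)
      next
        case True
        let ?J = "{j\<in>off_nbrs G i. w \<le> gain G v i j}"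
        let ?r = "\<lambda>j. x i j / rate G i"
        have tr: "type_ratio G x v w i = sum ?r ?J"
          by (simp add: type_ratio_alt)
        have "(\<Sum>j\<in>off_nbrs G i. m' i j w) = (\<Sum>j\<in>?J. marginal v i j w - E0 i j)"
          using True by (intro sum.mono_neutral_cong_right) (auto simp: m'_def)
        also have "\<dots> = (\<Sum>j\<in>?J. p_fun (sum ?r ?J) - p_fun (sum ?r ?J - ?r j) - max (2 * ?r j - 1) 0)"
          by (intro sum.cong refl) (auto simp: marginal_def tr edge_ratio_def E0_def)
        also have "\<dots> \<le> 2 * p_fun (sum ?r ?J) - 2 * sum ?r ?J"
          using rate_pos[OF i] type_ratio_le_1[OF i, of v w]
          by (intro sum_p_fun_marginals_le) (auto intro!: divide_nonneg_pos x_nonneg simp: tr)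
        finally show ?thesis
          using True by (simp add: tr)
      qed
    qed
    also have "\<dots> = 2 * sampled_gain v - 2 * fractional_gain v"
      unfolding sampled_gain_def fractional_gain_eq sum_distrib_left sum_subtractf[symmetric]
      by (intro sum.cong refl) (simp add: integrable_type_ratio algebra_simps)
    finally show ?thesis .
  qed
  have "(\<Sum>j\<in>offline G. LINT u|lborel. Q j u * D j u) \<le>
      (\<Sum>j\<in>offline G. LINT u|lborel. (1 - ln 2) * Q j u + (2 - (1 - ln 2)) * (D j u - E j u))"
    by (intro sum_mono integral_mono bound int_QD Bochner_Integration.integrable_add integrable_mult_right
          Bochner_Integration.integrable_diff int_Q int_D int_E)
  also have "\<dots> = (1 - ln 2) * (\<Sum>j\<in>offline G. LINT u|lborel. Q j u) +
      (2 - (1 - ln 2)) * (\<Sum>j\<in>offline G. (LINT u|lborel. D j u) - (LINT u|lborel. E j u))"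
    by (simp add: int_Q int_D int_E sum.distrib sum_distrib_left)
  also have "\<dots> \<le> (1 - ln 2) * sampled_gain v + (2 - (1 - ln 2)) * (2 * sampled_gain v - 2 * fractional_gain v)"
    unfolding sumQ using sumDE ln2_bounds by (intro add_left_mono mult_left_mono) auto
  finally show ?thesis
    by (simp add: lhs)
qed

text \<open>\<open>m i\<close> bounds every net value and is nonnegative, and the
  \<open>q i j\<close> sum to at most 1, so \<open>m i\<close> dominates the weighted sum of the net
  values under \<open>q\<close>. The left side is the negative time derivative of the
  potential.\<close>

lemma drift_lower_bound:
  assumes t: "t \<le> 1"
    and m: "\<And>i j. j \<in> off_nbrs G i \<Longrightarrow> gain G v i j - regularizer G x v t i j \<le> m i"
    and m0: "\<And>i. i \<in> online G \<Longrightarrow> 0 \<le> m i"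
  shows "2 * (1 + ln 2) * \<beta>_fun t * fractional_gain v -
      (\<alpha>_fun t + (3 + ln 2) * \<beta>_fun t - 1) * sampled_gain v \<le> (\<Sum>i\<in>online G. rate G i * m i)"
proof -
  obtain q where q: "half_split v q"
    using half_split_exists by blast
  have q0: "0 \<le> q i j" if "i \<in> online G" "j \<in> off_nbrs G i" for i j
    using q that by (auto simp: half_split_def)
  have q1: "(\<Sum>j\<in>off_nbrs G i. q i j) \<le> 1" if "i \<in> online G" for i
  proof -
    \<comment> \<open>All gains are nonnegative, so level 0 selects every neighbor.\<close>
    have "(\<Sum>j\<in>{j\<in>off_nbrs G i. 0 \<le> gain G v i j}. q i j) = p_fun (type_ratio G x v 0 i)"
      using q that unfolding half_split_def by blast
    then show ?thesis by (simp add: p_fun_def)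
  qed
  define SG FL SL where "SG = (\<Sum>i\<in>online G. rate G i * (\<Sum>j\<in>off_nbrs G i. q i j * gain G v i j))"
    and "FL = (\<Sum>i\<in>online G. rate G i * (\<Sum>j\<in>off_nbrs G i. q i j * fractional_loss v i j))"
    and "SL = (\<Sum>i\<in>online G. rate G i * (\<Sum>j\<in>off_nbrs G i. q i j * sampled_loss v i j))"
  have SG: "SG = sampled_gain v"
    by (simp add: SG_def sampled_gain_def half_split_gain[OF q])
  have FL: "FL \<le> SG"
    unfolding FL_def SG_def
    by (intro sum_mono mult_left_mono fractional_loss_le)
       (auto intro: q0 less_imp_le[OF rate_pos] dest: off_nbrsD)
  have SL: "SL \<le> (1 - ln 2) * sampled_gain v + (1 + ln 2) * (2 * sampled_gain v - 2 * fractional_gain v)"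
    unfolding SL_def by (rule sampled_loss_bound[OF q])
  have "\<alpha>_fun t * FL \<le> \<alpha>_fun t * sampled_gain v"
    using FL SG \<alpha>_fun_nonneg[OF t] by (intro mult_left_mono) auto
  moreover have "\<beta>_fun t * SL \<le> \<beta>_fun t * ((1 - ln 2) * sampled_gain v + (1 + ln 2) * (2 * sampled_gain v - 2 * fractional_gain v))"
    using SL \<beta>_fun_nonneg[OF t] by (intro mult_left_mono) auto
  ultimately have "2 * (1 + ln 2) * \<beta>_fun t * fractional_gain v -
      (\<alpha>_fun t + (3 + ln 2) * \<beta>_fun t - 1) * sampled_gain v \<le> SG - \<alpha>_fun t * FL - \<beta>_fun t * SL"
    by (simp add: SG algebra_simps)
  also have "\<dots> = (\<Sum>i\<in>online G. rate G i * (\<Sum>j\<in>off_nbrs G i. q i j * (gain G v i j - regularizer G x v t i j)))"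
    unfolding SG_def FL_def SL_def sum_distrib_left sum_subtractf[symmetric]
    by (intro sum.cong refl) (simp add: regularizer_eq algebra_simps)
  also have "\<dots> \<le> (\<Sum>i\<in>online G. rate G i * m i)"
  proof (intro sum_mono mult_left_mono)
    fix i assume i: "i \<in> online G"
    have "(\<Sum>j\<in>off_nbrs G i. q i j * (gain G v i j - regularizer G x v t i j)) \<le> (\<Sum>j\<in>off_nbrs G i. q i j * m i)"
      using i by (intro sum_mono mult_left_mono m q0)
    also have "\<dots> = (\<Sum>j\<in>off_nbrs G i. q i j) * m i"
      by (simp add: sum_distrib_right)
    also have "\<dots> \<le> m i"
      using mult_right_mono[OF q1[OF i] m0[OF i]] by simp
    finally show "(\<Sum>j\<in>off_nbrs G i. q i j * (gain G v i j - regularizer G x v t i j)) \<le> m i" .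
  qed (auto intro: rate_pos less_imp_le)
  finally show ?thesis .
qed

end

section \<open>The potential along the algorithm\<close>

context lp_instance begin

definition potential :: "real \<Rightarrow> ('j \<Rightarrow> real) \<Rightarrow> real" where
  "potential t v = (\<Sum>j\<in>offline G. v j) + \<alpha>_fun t * fractional_gain v + \<beta>_fun t * sampled_gain v"

definition potential_deriv :: "real \<Rightarrow> ('j \<Rightarrow> real) \<Rightarrow> real" where
  "potential_deriv t v = - 2 * (1 + ln 2) * \<beta>_fun t * fractional_gain v +
     (\<alpha>_fun t + (3 + ln 2) * \<beta>_fun t - 1) * sampled_gain v"

lemma DERIV_potential: "((\<lambda>t. potential t v) has_real_derivative potential_deriv t v) (at t)"
  unfolding potential_def potential_deriv_def
  by (rule derivative_eq_intros DERIV_\<alpha>_fun DERIV_\<beta>_fun refl)+ simp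

lemma isCont_potential: "isCont (\<lambda>t. potential t v) t"
  using DERIV_potential by (rule DERIV_isCont)

lemma isCont_potential_deriv: "isCont (\<lambda>t. potential_deriv t v) t"
  unfolding potential_deriv_def
  by (intro continuous_intros DERIV_isCont[OF DERIV_\<alpha>_fun] DERIV_isCont[OF DERIV_\<beta>_fun])

lemma potential_raise:
  assumes "j \<in> off_nbrs G i"
  shows "potential t (v(j := v j + gain G v i j)) = potential t v + (gain G v i j - regularizer G x v t i j)"
proof -
  have j: "j \<in> offline G"
    using assms by (rule off_nbrsD)
  have "(\<Sum>k\<in>offline G. (v(j := v j + gain G v i j)) k) = (\<Sum>k\<in>offline G. v k + (if k = j then gain G v i j else 0))"
    by (intro sum.cong) auto
  also have "\<dots> = (\<Sum>k\<in>offline G. v k) + gain G v i j"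
    using j by (simp add: sum.distrib)
  finally show ?thesis
    unfolding potential_def
    by (simp add: fractional_gain_raise[OF j] sampled_gain_raise[OF j] regularizer_eq[OF assms] algebra_simps)
qed

lemma sampled_gain_le: "sampled_gain v \<le> 2 * fractional_gain v"
proof -
  have "sampled_gain v \<le> (\<Sum>i\<in>online G. rate G i * (LINT w|lborel. 2 * (indicator {0<..} w * type_ratio G x v w i)))"
    unfolding sampled_gain_def
  proof (rule sum_mono, rule mult_left_mono, rule integral_mono)
    fix i assume i: "i \<in> online G"
    show "integrable lborel (\<lambda>w. indicator {0<..} w * p_fun (type_ratio G x v w i))"
      "integrable lborel (\<lambda>w. 2 * (indicator {0<..} w * type_ratio G x v w i))"
      using integrable_type_ratio[OF i] by auto
    show "0 \<le> rate G i"
      using rate_pos[OF i] by simp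
  qed (auto simp: p_fun_def indicator_def)
  also have "\<dots> = 2 * fractional_gain v"
    unfolding fractional_gain_eq by (simp add: sum_distrib_left mult.left_commute)
  finally show ?thesis .
qed

lemma fractional_gain_bounds:
  assumes "\<And>j. 0 \<le> v j"
  shows "0 \<le> fractional_gain v" "fractional_gain v \<le> lp_value G x"
proof -
  show "0 \<le> fractional_gain v"
    unfolding fractional_gain_def by (intro sum_nonneg mult_nonneg_nonneg x_nonneg) auto
  have "fractional_gain v \<le> (\<Sum>i\<in>online G. \<Sum>j\<in>off_nbrs G i. x i j * weight G i j)"
    unfolding fractional_gain_def
  proof (intro sum_mono mult_left_mono x_nonneg)
    fix i j assume "j \<in> off_nbrs G i"
    then have "0 < weight G i j"
      using type_graph by (auto simp: type_graph_def off_nbrs_def)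
    then show "gain G v i j \<le> weight G i j"
      using assms[of j] by (simp add: gain_def)
  qed
  also have "\<dots> = lp_value G x"
    by (simp add: lp_value_def sum_edges mult.commute)
  finally show "fractional_gain v \<le> lp_value G x" .
qed

lemma potential_0_ge: "0.706 * lp_value G x \<le> potential 0 (\<lambda>_. 0)"
proof -
  have lp: "fractional_gain (\<lambda>_. 0) = lp_value G x"
    unfolding fractional_gain_def lp_value_def sum_edges
    using type_graph
    by (intro sum.cong refl) (force simp: gain_def type_graph_def off_nbrs_def max_def)
  have nn: "0 \<le> lp_value G x"
    using fractional_gain_bounds(1)[of "\<lambda>_. 0"] by (simp add: lp)
  have "0.706 * lp_value G x \<le> (\<alpha>_fun 0 + \<beta>_fun 0) * lp_value G x"
    using \<alpha>_plus_\<beta>_fun_0_ge nn by (intro mult_right_mono)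
  also have "\<dots> = \<alpha>_fun 0 * lp_value G x + \<beta>_fun 0 * fractional_gain (\<lambda>_. 0)"
    by (simp add: lp algebra_simps)
  also have "\<dots> \<le> \<alpha>_fun 0 * lp_value G x + \<beta>_fun 0 * sampled_gain (\<lambda>_. 0)"
    by (intro add_left_mono mult_left_mono fractional_gain_le_sampled_gain \<beta>_fun_nonneg) auto
  finally show ?thesis
    by (simp add: potential_def lp)
qed

text \<open>With a bound on the levels this is uniform over histories and times, as the constant
  \<open>C\<close> in \<open>subsolution_le_layers\<close> must be.\<close>

lemma potential_le:
  assumes t: "t \<le> 1" and v: "\<And>j. 0 \<le> v j" "\<And>j. v j \<le> B"
  shows "potential t v \<le> real (card (offline G)) * B + lp_value G x"
proof -
  have "\<beta>_fun t * sampled_gain v \<le> \<beta>_fun t * (2 * fractional_gain v)"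
    using t by (intro mult_left_mono sampled_gain_le \<beta>_fun_nonneg)
  then have "\<alpha>_fun t * fractional_gain v + \<beta>_fun t * sampled_gain v \<le> (\<alpha>_fun t + 2 * \<beta>_fun t) * fractional_gain v"
    by (simp add: algebra_simps)
  also have "\<dots> \<le> 1 * fractional_gain v"
    using fractional_gain_bounds(1)[of v] v(1) by (intro mult_right_mono) (auto simp: \<alpha>_plus_2_\<beta>_fun)
  also have "\<dots> \<le> lp_value G x"
    using fractional_gain_bounds(2)[of v] v(1) by simp
  finally show ?thesis
    using sum_bounded_above[of "offline G" v B] v(2) by (simp add: potential_def)
qed

end

section \<open>The potential along a run of the greedy policy\<close>

locale greedy_run = lp_instance G x
  for G :: "('i, 'j) type_graph" and x +
  fixes A :: "('i, 'j) policy"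
  assumes policy: "online_policy G A"
    and optimal: "lp_optimal G x"
    and greedy: "\<And>h t i. t \<in> {0..1} \<Longrightarrow> i \<in> online G \<Longrightarrow> off_nbrs G i \<noteq> {} \<Longrightarrow>
       \<exists>j. A h (t, i) = Some j \<and> greedy_choice G x (level G A h) t i j"
begin

lemma policyD: "A h (t, i) = Some j \<Longrightarrow> i \<in> online G \<Longrightarrow> j \<in> off_nbrs G i"
  using policy unfolding online_policy_def by blast

lemma level_le:
  assumes "set (map snd h) \<subseteq> online G"
  shows "level G A h j \<le> (\<Sum>(i, j)\<in>edges G. weight G i j)"
  using assms
proof (induction h rule: rev_induct)
  have nn: "0 \<le> (case e of (i, j) \<Rightarrow> weight G i j)" if "e \<in> edges G" for e
    using that type_graph by (auto simp: type_graph_def intro: less_imp_le)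
  case Nil
  then show ?case using nn by (simp add: sum_nonneg)
next
  case (snoc p h)
  obtain t i where p: "p = (t, i)" by (cases p)
  have "weight G i j \<le> (\<Sum>(i, j)\<in>edges G. weight G i j)" if "A h p = Some j"
  proof -
    have "(i, j) \<in> edges G"
      using policyD[of h t i j] that snoc.prems by (simp add: p off_nbrs_def)
    then show ?thesis
      using type_graph member_le_sum[of "(i, j)" "edges G" "\<lambda>(i, j). weight G i j"]
      by (force simp: type_graph_def intro: less_imp_le)
  qed
  then show ?case
    using snoc by (simp add: level_snoc p)
qed

lemma potential_step:
  fixes h :: "(real \<times> 'i) list" and t :: real and i :: 'i and j :: 'j
  assumes t: "t \<in> {0..1}" and i: "i \<in> online G"
  defines "v \<equiv> level G A h" and "m \<equiv> potential t (level G A (h @ [(t, i)])) - potential t (level G A h)"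
  shows "0 \<le> m" "j \<in> off_nbrs G i \<Longrightarrow> gain G v i j - regularizer G x v t i j \<le> m"
proof -
  have "0 \<le> m \<and> (\<forall>j\<in>off_nbrs G i. gain G v i j - regularizer G x v t i j \<le> m)"
  proof (cases "off_nbrs G i = {}")
    case True
    then have "A h (t, i) \<noteq> Some k" for k
      using policyD[of h t i k] i by auto
    then have "level G A (h @ [(t, i)]) = level G A h"
      by (simp add: level_snoc fun_eq_iff)
    then show ?thesis
      using True by (simp add: m_def)
  next
    case False
    then obtain k where k: "A h (t, i) = Some k" "greedy_choice G x v t i k"
      using greedy[OF t i] v_def by blast
    have kN: "k \<in> off_nbrs G i"
      using policyD[OF k(1) i] .
    \<comment> \<open>Adding the truncated gain yields the maximum of old level and new weight, also
      when the new edge is not heavier.\<close>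
    have "level G A (h @ [(t, i)]) = v(k := v k + gain G v i k)"
      using k(1) by (auto simp: level_snoc fun_eq_iff gain_def v_def max_def)
    then have m: "m = gain G v i k - regularizer G x v t i k"
      using potential_raise[OF kN, of t v] by (simp add: m_def v_def)
    show ?thesis
      using k(2) regularizer_le_gain[OF kN, of t v] t
      by (auto simp: m greedy_choice_def is_arg_max_def not_less)
  qed
  then show "0 \<le> m" "j \<in> off_nbrs G i \<Longrightarrow> gain G v i j - regularizer G x v t i j \<le> m"
    by auto
qed

lemma potential_drift:
  assumes t: "t \<in> {0..1}"
  shows "total_rate * potential t (level G A h) - potential_deriv t (level G A h) \<le>
    (\<Sum>i\<in>online G. rate G i * potential t (level G A (h @ [(t, i)])))"
proof -
  define v where "v = level G A h"
  define m where "m i = (if i \<in> online G then potential t (level G A (h @ [(t, i)])) - potential t v else 0)" for i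
  have "2 * (1 + ln 2) * \<beta>_fun t * fractional_gain v -
      (\<alpha>_fun t + (3 + ln 2) * \<beta>_fun t - 1) * sampled_gain v \<le> (\<Sum>i\<in>online G. rate G i * m i)"
  proof (rule drift_lower_bound)
    fix i j assume j: "j \<in> off_nbrs G i"
    show "gain G v i j - regularizer G x v t i j \<le> m i"
      using potential_step(2)[OF t off_nbrsD(2)[OF j], where h = h, OF j] off_nbrsD(2)[OF j] by (simp add: m_def v_def)
  next
    fix i assume "i \<in> online G"
    then show "0 \<le> m i"
      using potential_step(1)[OF t, where i = i and h = h] by (simp add: m_def v_def)
  qed (use t in auto)
  also have "(\<Sum>i\<in>online G. rate G i * m i) =
      (\<Sum>i\<in>online G. rate G i * potential t (level G A (h @ [(t, i)]))) - total_rate * potential t v"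
    by (simp add: m_def right_diff_distrib sum_subtractf total_rate_def sum_distrib_right)
  finally show ?thesis
    by (simp add: potential_deriv_def v_def algebra_simps)
qed

text \<open>The layers do not contain the probability of having no further arrivals. The factor
  \<open>exp (total_rate * (1 - t))\<close> compensates for it: its derivative produces the term
  \<open>total_rate * potential\<close>, the value before the jump. At t = 1 both coefficients
  vanish and only the sum of the levels remains; at t = 0 the factor cancels against
  \<open>exp (- total_rate)\<close>.\<close>

lemma potential_le_expected_objective: "ennreal (potential 0 (\<lambda>_. 0)) \<le> expected_objective G A"
proof -
  let ?\<Phi> = "\<lambda>t h. exp (total_rate * (1 - t)) * potential t (level G A h)"
  let ?\<phi> = "\<lambda>t h. exp (total_rate * (1 - t)) * (total_rate * potential t (level G A h) - potential_deriv t (level G A h))"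
  let ?W = "\<Sum>(i, j)\<in>edges G. weight G i j"
  let ?C = "exp total_rate * (real (card (offline G)) * ?W + lp_value G x)"
  have W: "0 \<le> ?W"
    using type_graph unfolding type_graph_def by (intro sum_nonneg) (auto intro: less_imp_le)
  have lp: "0 \<le> lp_value G x"
    using fractional_gain_bounds[of "\<lambda>_. 0"] by linarith
  have "ennreal (exp (- total_rate)) * ennreal (?\<Phi> 0 []) \<le>
      (\<integral>\<^sup>+ \<omega>. ennreal (objective G A (arrivals G \<omega>)) \<partial>arrival_space G)"
  proof (rule subsolution_le_expectation[where \<Phi> = ?\<Phi> and \<phi> = ?\<phi> and C = ?C])
    show "history_measurable (\<lambda>h. ennreal (objective G A h))"
      using policy by (rule objective_measurable)
    show "0 \<le> ?C"
      using W lp by simp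
    fix t :: real and h :: "(real \<times> 'i) list"
    assume t: "t \<in> {0..1}" and h: "set (map snd h) \<subseteq> online G"
    have "?\<Phi> t h \<le> exp (total_rate * (1 - t)) * (real (card (offline G)) * ?W + lp_value G x)"
      using t h by (intro mult_left_mono potential_le level_nonneg level_le) auto
    also have "\<dots> \<le> ?C"
      using t total_rate_nonneg W lp by (intro mult_right_mono) (auto simp: mult_left_le)
    finally show "?\<Phi> t h \<le> ?C" .
    show "((\<lambda>t. ?\<Phi> t h) has_real_derivative - ?\<phi> t h) (at t)"
      by (rule derivative_eq_intros DERIV_potential refl)+ (simp add: algebra_simps)
    show "isCont (\<lambda>t. ?\<phi> t h) t"
      by (intro continuous_intros isCont_potential isCont_potential_deriv)
    have "?\<phi> t h \<le> exp (total_rate * (1 - t)) * (\<Sum>i\<in>online G. rate G i * potential t (level G A (h @ [(t, i)])))"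
      by (intro mult_left_mono potential_drift t) auto
    then show "?\<phi> t h \<le> (\<Sum>i\<in>online G. rate G i * ?\<Phi> t (h @ [(t, i)]))"
      by (simp add: sum_distrib_left mult.left_commute)
  next
    fix h :: "(real \<times> 'i) list"
    show "ennreal (?\<Phi> 1 h) \<le> ennreal (objective G A h)"
      by (simp add: potential_def \<alpha>_\<beta>_fun_1 objective_def)
  qed
  moreover have "ennreal (exp (- total_rate)) * ennreal (?\<Phi> 0 []) = ennreal (potential 0 (level G A []))"
    by (simp add: exp_minus mult.assoc[symmetric] flip: ennreal_mult')
  moreover have "level G A [] = (\<lambda>_. 0)"
    by auto
  ultimately show ?thesis
    by (simp add: expected_objective_def)
qed

lemma competitive_ratio: "ennreal 0.706 * expected_opt G \<le> expected_objective G A"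
proof -
  have "ennreal 0.706 * expected_opt G \<le> ennreal 0.706 * ennreal (lp_value G x)"
    by (intro mult_left_mono expected_opt_le_lp_value optimal) auto
  also have "\<dots> = ennreal (0.706 * lp_value G x)"
    by (rule ennreal_mult'[symmetric]) simp
  also have "\<dots> \<le> ennreal (potential 0 (\<lambda>_. 0))"
    by (intro ennreal_leI potential_0_ge)
  also have "\<dots> \<le> expected_objective G A"
    by (rule potential_le_expected_objective)
  finally show ?thesis .
qed

end

theorem mainTheorem6:
  shows "competitive 0.706 (regularized_greedy :: ('i, 'j) algorithm)"
  unfolding competitive_def
proof (intro allI impI)
  fix G :: "('i, 'j) type_graph" and A
  assume G: "type_graph G" and A: "online_policy G A" and "regularized_greedy G A"
  then obtain x where x: "lp_optimal G x" and
    greedy: "\<And>h t i. t \<in> {0..1} \<Longrightarrow> i \<in> online G \<Longrightarrow> off_nbrs G i \<noteq> {} \<Longrightarrow>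
       \<exists>j. A h (t, i) = Some j \<and> greedy_choice G x (level G A h) t i j"
    unfolding regularized_greedy_def by blast
  have "lp_feasible G x"
    using x by (simp add: lp_optimal_def is_arg_max_def)
  then interpret greedy_run G x A
    using G A x greedy by unfold_locales auto
  show "ennreal 0.706 * expected_opt G \<le> expected_objective G A"
    by (rule competitive_ratio)
qed

end
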